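(* Let $p$ be a prime and let $\langle M, W, \beta\rangle$ be an $\aleph_0$-categorical bilinear map in $\mathcal{B}(p)$ with few relations; let $k\ge 1$ be an integer such that $\dim(N(H_0))\le k\dim(H_0)$ for every finite subspace $H_0$ of $M$. If $H$ is a finite subspace of $M$, then $\mathrm{cl}_k(H)$ is finite and $\mathrm{cl}_k(H)\subseteq\mathrm{acl}(H)$.
   Context: Let $p$ be a prime. $\mathcal{B}(p)$ consists of the structures $\langle M,W,\beta\rangle$ where $M$ and $W$ are vector spaces over the field $\mathbb{F}_p$ and $\beta: M\times M\to W$ is an alternating bilinear map whose image generates $W$. Such a structure is regarded as a two-sorted first-order structure (vector space structure on both sorts together with $\beta$); $\aleph_0$-categorical means that its complete first-order theory is $\aleph_0$-categorical, and $\mathrm{acl}$ is the model-theoretic algebraic closure in this structure. Let $\Lambda^2 M$ be the exterior square of $M$ and $f_\beta:\Lambda^2 M\to W$ the linear map with $f_\beta(a\wedge b)=\beta(a,b)$; put $N(\beta)=\ker f_\beta$. For a subspace $H$ of $M$, $\Lambda^2 H$ is regarded as a subspace of $\Lambda^2 M$ in the canonical way and $N(H)=N(\beta)\cap\Lambda^2 H$. Here $\dim$ is linear dimension over $\mathbb{F}_p$. The map $\langle M,W,\beta\rangle$ has few relations if there is a natural number $k$ with $\dim(N(H))\le k\dim(H)$ for all finite subspaces $H$ of $M$. Fix such a $k\geq 1$. For a finite subspace $H$ of $M$ put $\delta_k(H)=\dim(H)-\frac1k\dim(N(H))$. A finite subspace $H$ is selfsufficient if $\delta_k(K)\ge\delta_k(H)$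 for every finite subspace $K\supseteq H$ of $M$. For a finite subspace $H$, $CSS(H)$ is the intersection of all finite selfsufficient subspaces of $M$ containing $H$ (it is finite and selfsufficient). $\langle X\rangle$ denotes the linear span of $X$. For finite subsets $A,B$ of $M$, one says $A\subseteq\mathrm{cl}_k(B)$ if $\delta_k(CSS(\langle B\rangle))=\delta_k(CSS(\langle A\cup B\rangle))$. As a set, $\mathrm{cl}_k(B)$ consists of all $a\in M$ with $\{a\}\subseteq\mathrm{cl}_k(B)$. *)

theory Defs
  imports
    "HOL-Library.Poly_Mapping"
    "Berlekamp_Zassenhaus.Finite_Field"
begin

section \<open>Alternating bilinear maps and the exterior square\<close>

definition alternating_bilinear ::
  "('k::field \<Rightarrow> 'm::ab_group_add \<Rightarrow> 'm) \<Rightarrow> ('k \<Rightarrow> 'w::ab_group_add \<Rightarrow> 'w)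
    \<Rightarrow> ('m \<Rightarrow> 'm \<Rightarrow> 'w) \<Rightarrow> bool"
where
  "alternating_bilinear sM sW \<beta> \<longleftrightarrow>
     (\<forall>a. Vector_Spaces.linear sM sW (\<lambda>b. \<beta> a b)) \<and>
     (\<forall>b. Vector_Spaces.linear sM sW (\<lambda>a. \<beta> a b)) \<and>
     (\<forall>a. \<beta> a a = 0)"

text \<open>
  The exterior square is the quotient of the free vector space on the set of pairs of
  elements of \<open>M\<close> by the span of the relations making the canonical map alternating
  and bilinear.
\<close>

definition free_scale :: "'k::field \<Rightarrow> ('a \<Rightarrow>\<^sub>0 'k) \<Rightarrow> ('a \<Rightarrow>\<^sub>0 'k)" where
  "free_scale c x = Poly_Mapping.map ((*) c) x"

abbreviation free_gen :: "'a \<Rightarrow> 'a \<Rightarrow> ('a \<times> 'a \<Rightarrow>\<^sub>0 'k::field)" where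
  "free_gen a b \<equiv> Poly_Mapping.single (a, b) 1"

definition free_lift ::
  "('k::field \<Rightarrow> 'w::ab_group_add \<Rightarrow> 'w) \<Rightarrow> ('m \<Rightarrow> 'm \<Rightarrow> 'w) \<Rightarrow> ('m \<times> 'm \<Rightarrow>\<^sub>0 'k) \<Rightarrow> 'w"
where
  "free_lift sW \<beta> x =
     (\<Sum>(a, b)\<in>Poly_Mapping.keys x. sW (Poly_Mapping.lookup x (a, b)) (\<beta> a b))"

lemma lookup_free_scale [simp]:
  "Poly_Mapping.lookup (free_scale c x) i = c * Poly_Mapping.lookup x i"
  unfolding free_scale_def by (simp add: Poly_Mapping.map.rep_eq when_def)

interpretation free: vector_space free_scale
  by standard (auto intro!: poly_mapping_eqI simp: lookup_add algebra_simps)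

definition ext_relations ::
  "('k::field \<Rightarrow> 'm::ab_group_add \<Rightarrow> 'm) \<Rightarrow> ('m \<times> 'm \<Rightarrow>\<^sub>0 'k) set"
where
  "ext_relations sM = free.span (
     {free_gen (a + b) c - free_gen a c - free_gen b c | a b c. True} \<union>
     {free_gen a (b + c) - free_gen a b - free_gen a c | a b c. True} \<union>
     {free_gen (sM r a) b - free_scale r (free_gen a b) | r a b. True} \<union>
     {free_gen a (sM r b) - free_scale r (free_gen a b) | r a b. True} \<union>
     {free_gen a a | a. True})"

text \<open>
  The quotient depends on the scalar multiplication of \<open>M\<close>, so it cannot be a
  quotient type.  Instead, its elements are normal forms: \<open>ext_proj sM\<close> is a (chosen)
  linear projection of the free space whose kernel is exactly the space of relations, and the
  exterior square is its image, which is canonically isomorphic to the quotient.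
  Lemma \<open>ext_square_universal\<close> below states the universal property.
\<close>

definition is_ext_proj ::
  "('k::field \<Rightarrow> 'm::ab_group_add \<Rightarrow> 'm)
    \<Rightarrow> (('m \<times> 'm \<Rightarrow>\<^sub>0 'k) \<Rightarrow> ('m \<times> 'm \<Rightarrow>\<^sub>0 'k)) \<Rightarrow> bool"
where
  "is_ext_proj sM \<pi> \<longleftrightarrow>
     Vector_Spaces.linear free_scale free_scale \<pi> \<and>
     (\<forall>x. \<pi> (\<pi> x) = \<pi> x) \<and>
     {x. \<pi> x = 0} = ext_relations sM"

definition ext_proj ::
  "('k::field \<Rightarrow> 'm::ab_group_add \<Rightarrow> 'm) \<Rightarrow> ('m \<times> 'm \<Rightarrow>\<^sub>0 'k) \<Rightarrow> ('m \<times> 'm \<Rightarrow>\<^sub>0 'k)"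
where
  "ext_proj sM = (SOME \<pi>. is_ext_proj sM \<pi>)"

definition wedge ::
  "('k::field \<Rightarrow> 'm::ab_group_add \<Rightarrow> 'm) \<Rightarrow> 'm \<Rightarrow> 'm \<Rightarrow> ('m \<times> 'm \<Rightarrow>\<^sub>0 'k)"
where
  "wedge sM a b = ext_proj sM (free_gen a b)"

definition ext_square ::
  "('k::field \<Rightarrow> 'm::ab_group_add \<Rightarrow> 'm) \<Rightarrow> ('m \<times> 'm \<Rightarrow>\<^sub>0 'k) set"
where
  "ext_square sM = range (ext_proj sM)"

text \<open>For a subspace \<open>H\<close>, the canonical copy of its exterior square inside that of \<open>M\<close>.\<close>

definition ext_square_of ::
  "('k::field \<Rightarrow> 'm::ab_group_add \<Rightarrow> 'm) \<Rightarrow> 'm set \<Rightarrow> ('m \<times> 'm \<Rightarrow>\<^sub>0 'k) set"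
where
  "ext_square_of sM H = free.span {wedge sM a b | a b. a \<in> H \<and> b \<in> H}"

lemma ext_proj: "is_ext_proj sM (ext_proj sM)"
proof -
  let ?R = "ext_relations sM"
  interpret vp: vector_space_pair free_scale free_scale ..
  have R: "free.subspace ?R"
    unfolding ext_relations_def by (rule free.subspace_span)
  obtain g where g: "range g \<subseteq> ?R" "Vector_Spaces.linear free_scale free_scale g"
    "\<And>v. v \<in> ?R \<Longrightarrow> g v = v"
    using vp.linear_exists_left_inverse_on[OF free.linear_ident R] by auto
  let ?p = "\<lambda>x. x - g x"
  have lin: "Vector_Spaces.linear free_scale free_scale ?p"
    by (rule vp.linear_compose_sub[OF free.linear_ident g(2)])
  have gg: "g (x - g x) = 0" for x
    using g(3)[of "g x"] subsetD[OF g(1) rangeI] vp.linear_diff[OF g(2)] by simp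
  have ker: "{x. ?p x = 0} = ?R"
  proof (intro equalityI subsetI)
    fix x assume "x \<in> {x. x - g x = 0}"
    then have "x = g x" by simp
    then show "x \<in> ?R" using g(1) rangeI[of g x] by auto
  next
    fix x assume "x \<in> ?R"
    then show "x \<in> {x. x - g x = 0}" using g(3) by simp
  qed
  have "is_ext_proj sM ?p"
    unfolding is_ext_proj_def using lin ker by (simp add: gg)
  then show ?thesis
    unfolding ext_proj_def by (rule someI[of "is_ext_proj sM"])
qed

lemma free_lift_eq_sum:
  assumes "vector_space sW" "finite S" "Poly_Mapping.keys x \<subseteq> S"
  shows "free_lift sW \<beta> x = (\<Sum>(a, b)\<in>S. sW (Poly_Mapping.lookup x (a, b)) (\<beta> a b))"
proof -
  interpret W: vector_space sW by fact
  show ?thesis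
    unfolding free_lift_def
    by (rule sum.mono_neutral_left) (use assms in \<open>auto simp: in_keys_iff\<close>)
qed

lemma linear_free_lift:
  assumes "vector_space sW"
  shows "Vector_Spaces.linear free_scale sW (free_lift sW \<beta>)"
proof -
  interpret W: vector_space sW by fact
  have add: "free_lift sW \<beta> (x + y) = free_lift sW \<beta> x + free_lift sW \<beta> y" for x y
  proof -
    let ?S = "Poly_Mapping.keys x \<union> Poly_Mapping.keys y"
    have "Poly_Mapping.keys (x + y) \<subseteq> ?S" by (rule Poly_Mapping.keys_add)
    then show ?thesis
      by (simp add: free_lift_eq_sum[OF assms, of ?S] lookup_add W.scale_left_distrib
          sum.distrib case_prod_unfold)
  qed
  have scale: "free_lift sW \<beta> (free_scale c x) = sW c (free_lift sW \<beta> x)" for c x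
  proof -
    have "Poly_Mapping.keys (free_scale c x) \<subseteq> Poly_Mapping.keys x"
      by (auto simp: in_keys_iff)
    then show ?thesis
      by (simp add: free_lift_eq_sum[OF assms, of "Poly_Mapping.keys x"] W.scale_sum_right
          case_prod_unfold)
  qed
  show ?thesis
    by unfold_locales (auto simp: add scale)
qed

lemma free_lift_gen:
  assumes "vector_space sW"
  shows "free_lift sW \<beta> (free_gen a b) = \<beta> a b"
proof -
  interpret W: vector_space sW by fact
  show ?thesis by (simp add: free_lift_def)
qed

lemma free_lift_relations:
  assumes "alternating_bilinear sM sW \<beta>" "x \<in> ext_relations sM"
  shows "free_lift sW \<beta> x = 0"
proof -
  have l1: "Vector_Spaces.linear sM sW (\<lambda>b. \<beta> a b)"
    and l2: "Vector_Spaces.linear sM sW (\<lambda>a. \<beta> a b)" and alt: "\<beta> a a = 0" for a b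
    using assms(1) by (auto simp: alternating_bilinear_def)
  have W: "vector_space sW"
    using l1 unfolding Vector_Spaces.linear_def vector_space_pair_def by blast
  interpret L: Vector_Spaces.linear free_scale sW "free_lift sW \<beta>"
    by (rule linear_free_lift[OF W])
  note gen = free_lift_gen[OF W]
  have add1: "\<beta> (a + b) c = \<beta> a c + \<beta> b c" and sc1: "\<beta> (sM r a) c = sW r (\<beta> a c)" for a b c r
    using l2[of c] by (auto simp: Vector_Spaces.linear_iff)
  have add2: "\<beta> c (a + b) = \<beta> c a + \<beta> c b" and sc2: "\<beta> c (sM r a) = sW r (\<beta> c a)" for a b c r
    using l1[of c] by (auto simp: Vector_Spaces.linear_iff)
  show ?thesis
    using assms(2) unfolding ext_relations_def
  proof (rule L.eq_0_on_span[rotated])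
    fix y
    assume "y \<in> {free_gen (a + b) c - free_gen a c - free_gen b c | a b c. True} \<union>
     {free_gen a (b + c) - free_gen a b - free_gen a c | a b c. True} \<union>
     {free_gen (sM r a) b - free_scale r (free_gen a b) | r a b. True} \<union>
     {free_gen a (sM r b) - free_scale r (free_gen a b) | r a b. True} \<union>
     {free_gen a a | a. True}"
    then show "free_lift sW \<beta> y = 0"
      by (auto simp: L.diff L.scale gen alt add1 add2 sc1 sc2)
  qed
qed

lemma wedge_alternating_bilinear:
  assumes "vector_space sM"
  shows "alternating_bilinear sM free_scale (wedge sM)"
proof -
  interpret M: vector_space sM by fact
  interpret P: Vector_Spaces.linear free_scale free_scale "ext_proj sM"
    using ext_proj[of sM] by (simp add: is_ext_proj_def)
  have ker: "ext_proj sM x = 0" if "x \<in> ext_relations sM" for x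
    using ext_proj[of sM] that by (auto simp: is_ext_proj_def)
  note base = ker[unfolded ext_relations_def, OF free.span_base]
  have rels: "ext_proj sM (free_gen (a + b) c - free_gen a c - free_gen b c) = 0"
    "ext_proj sM (free_gen a (b + c) - free_gen a b - free_gen a c) = 0"
    "ext_proj sM (free_gen (sM r a) b - free_scale r (free_gen a b)) = 0"
    "ext_proj sM (free_gen a (sM r b) - free_scale r (free_gen a b)) = 0"
    "ext_proj sM (free_gen a a) = 0" for a b c r
    by (rule base, blast)+
  have "wedge sM (a + b) c = wedge sM a c + wedge sM b c"
    "wedge sM a (b + c) = wedge sM a b + wedge sM a c"
    "wedge sM (sM r a) b = free_scale r (wedge sM a b)"
    "wedge sM a (sM r b) = free_scale r (wedge sM a b)"
    "wedge sM a a = 0" for a b c r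
    using rels(1)[of a b c] rels(2)[of a b c] rels(3)[of r a b] rels(4)[of a r b] rels(5)[of a]
    unfolding wedge_def by (simp_all only: P.diff P.scale P.add diff_diff_eq right_minus_eq)
  then show ?thesis
    unfolding alternating_bilinear_def
    by (auto intro!: Vector_Spaces.linear.intro vector_space_pair.intro assms
        free.vector_space_axioms simp: Vector_Spaces.linear_iff)
qed

lemma span_free_gen: "free.span {free_gen a b | a b. True} = UNIV"
proof -
  have "x \<in> free.span {free_gen a b | a b. True}" for x :: "'a \<times> 'a \<Rightarrow>\<^sub>0 'k::field"
  proof -
    have "Poly_Mapping.single i c \<in> free.span {free_gen a b | a b. True}" for i and c :: 'k
    proof -
      have "Poly_Mapping.single i c = free_scale c (free_gen (fst i) (snd i))"
        by (rule poly_mapping_eqI) (simp add: lookup_single when_def)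
      then show ?thesis
        by (simp only:) (rule free.span_scale, rule free.span_base, blast)
    qed
    moreover have x: "x = (\<Sum>i\<in>Poly_Mapping.keys x. Poly_Mapping.single i (Poly_Mapping.lookup x i))"
      by (rule poly_mapping_eqI)
        (simp add: lookup_sum lookup_single when_def in_keys_iff)
    ultimately show ?thesis
      by (subst x) (rule free.span_sum, blast)
  qed
  then show ?thesis by blast
qed

lemma ext_square_of_UNIV: "ext_square_of sM UNIV = ext_square sM"
proof -
  interpret P: Vector_Spaces.linear free_scale free_scale "ext_proj sM"
    using ext_proj[of sM] by (simp add: is_ext_proj_def)
  have "{wedge sM a b | a b. a \<in> UNIV \<and> b \<in> UNIV} = ext_proj sM ` {free_gen a b | a b. True}"
    by (auto simp: wedge_def)
  then show ?thesis
    unfolding ext_square_of_def ext_square_def by (simp only: P.span_image span_free_gen)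
qed

text \<open>
  Together with \<open>wedge_alternating_bilinear\<close>, \<open>ext_square_of_UNIV\<close> and
  \<open>linear_free_lift\<close>, the next lemma shows that every alternating bilinear map factors
  through \<open>wedge\<close> by a linear map on \<open>ext_square\<close>, which is unique because the
  elements \<open>wedge sM a b\<close> span.
\<close>

lemma ext_square_universal:
  assumes "alternating_bilinear sM sW \<beta>"
  shows "free_lift sW \<beta> (wedge sM a b) = \<beta> a b"
proof -
  have "Vector_Spaces.linear sM sW (\<beta> a)"
    using assms by (simp add: alternating_bilinear_def)
  then have W: "vector_space sW"
    unfolding Vector_Spaces.linear_def vector_space_pair_def by blast
  interpret L: Vector_Spaces.linear free_scale sW "free_lift sW \<beta>"
    by (rule linear_free_lift[OF W])
  interpret P: Vector_Spaces.linear free_scale free_scale "ext_proj sM"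
    using ext_proj[of sM] by (simp add: is_ext_proj_def)
  let ?g = "free_gen a b"
  have "ext_proj sM (?g - ext_proj sM ?g) = 0"
    using ext_proj[of sM] by (simp add: P.diff is_ext_proj_def)
  then have "?g - ext_proj sM ?g \<in> ext_relations sM"
    using ext_proj[of sM] by (auto simp: is_ext_proj_def)
  then have "free_lift sW \<beta> (?g - ext_proj sM ?g) = 0"
    by (rule free_lift_relations[OF assms])
  then show ?thesis
    by (simp add: wedge_def L.diff free_lift_gen[OF W])
qed


section \<open>The class \<open>\<B>(p)\<close>, predimension and closure\<close>

text \<open>The prime \<open>p\<close> is \<open>CARD('p)\<close>, and \<open>'p mod_ring\<close> is the field with \<open>p\<close> elements.\<close>

locale bilinear_Bp =
  M: vector_space scaleM + W: vector_space scaleW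
  for scaleM :: "'p::prime_card mod_ring \<Rightarrow> 'm::ab_group_add \<Rightarrow> 'm"
    and scaleW :: "'p mod_ring \<Rightarrow> 'w::ab_group_add \<Rightarrow> 'w" +
  fixes \<beta> :: "'m \<Rightarrow> 'm \<Rightarrow> 'w"
  assumes alternating: "alternating_bilinear scaleM scaleW \<beta>"
    and generates: "W.span {\<beta> a b | a b. True} = UNIV"
begin

definition fin_subspace :: "'m set \<Rightarrow> bool" where
  "fin_subspace H \<longleftrightarrow> finite H \<and> M.subspace H"

definition f_beta :: "('m \<times> 'm \<Rightarrow>\<^sub>0 'p mod_ring) \<Rightarrow> 'w" where
  "f_beta = free_lift scaleW \<beta>"

definition N_beta :: "('m \<times> 'm \<Rightarrow>\<^sub>0 'p mod_ring) set" where
  "N_beta = {x \<in> ext_square scaleM. f_beta x = 0}"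

definition N :: "'m set \<Rightarrow> ('m \<times> 'm \<Rightarrow>\<^sub>0 'p mod_ring) set" where
  "N H = N_beta \<inter> ext_square_of scaleM H"

definition relations_bounded :: "nat \<Rightarrow> bool" where
  "relations_bounded k \<longleftrightarrow> (\<forall>H. fin_subspace H \<longrightarrow> free.dim (N H) \<le> k * M.dim H)"

definition few_relations :: bool where
  "few_relations \<longleftrightarrow> (\<exists>k. relations_bounded k)"

definition delta :: "nat \<Rightarrow> 'm set \<Rightarrow> real" where
  "delta k H = real (M.dim H) - 1 / real k * real (free.dim (N H))"

definition selfsufficient :: "nat \<Rightarrow> 'm set \<Rightarrow> bool" where
  "selfsufficient k H \<longleftrightarrow>
     fin_subspace H \<and> (\<forall>K. fin_subspace K \<and> H \<subseteq> K \<longrightarrow> delta k K \<ge> delta k H)"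

definition CSS :: "nat \<Rightarrow> 'm set \<Rightarrow> 'm set" where
  "CSS k H = \<Inter>{K. selfsufficient k K \<and> H \<subseteq> K}"

definition in_cl :: "nat \<Rightarrow> 'm set \<Rightarrow> 'm set \<Rightarrow> bool" where
  "in_cl k A B \<longleftrightarrow> delta k (CSS k (M.span B)) = delta k (CSS k (M.span (A \<union> B)))"

definition cl :: "nat \<Rightarrow> 'm set \<Rightarrow> 'm set" where
  "cl k B = {a. in_cl k {a} B}"

end


section \<open>Two-sorted first-order logic\<close>

text \<open>
  The language has two sorts \<open>M\<close> and \<open>W\<close>, on each of them the symbols of vector spaces
  over \<open>'k\<close> (zero, addition, and a unary function for every scalar), and a binary function
  symbol from \<open>M\<close> to \<open>W\<close>.  The two sorts have separate, named variables.
\<close>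

datatype 'k mterm =
    MVar nat
  | MZero
  | MAdd "'k mterm" "'k mterm"
  | MScale 'k "'k mterm"

datatype 'k wterm =
    WVar nat
  | WZero
  | WAdd "'k wterm" "'k wterm"
  | WScale 'k "'k wterm"
  | Beta "'k mterm" "'k mterm"

datatype 'k fm =
    MEq "'k mterm" "'k mterm"
  | WEq "'k wterm" "'k wterm"
  | Neg "'k fm"
  | Conj "'k fm" "'k fm"
  | MEx nat "'k fm"
  | WEx nat "'k fm"

record ('k, 'm, 'w) two_sorted =
  Mdom :: "'m set"
  Wdom :: "'w set"
  mzero :: 'm
  wzero :: 'w
  madd :: "'m \<Rightarrow> 'm \<Rightarrow> 'm"
  wadd :: "'w \<Rightarrow> 'w \<Rightarrow> 'w"
  mscale :: "'k \<Rightarrow> 'm \<Rightarrow> 'm"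
  wscale :: "'k \<Rightarrow> 'w \<Rightarrow> 'w"
  form :: "'m \<Rightarrow> 'm \<Rightarrow> 'w"

definition is_structure :: "('k, 'm, 'w) two_sorted \<Rightarrow> bool" where
  "is_structure S \<longleftrightarrow>
     mzero S \<in> Mdom S \<and> wzero S \<in> Wdom S \<and>
     (\<forall>a\<in>Mdom S. \<forall>b\<in>Mdom S. madd S a b \<in> Mdom S \<and> form S a b \<in> Wdom S) \<and>
     (\<forall>a\<in>Wdom S. \<forall>b\<in>Wdom S. wadd S a b \<in> Wdom S) \<and>
     (\<forall>r. \<forall>a\<in>Mdom S. mscale S r a \<in> Mdom S) \<and>
     (\<forall>r. \<forall>a\<in>Wdom S. wscale S r a \<in> Wdom S)"

primrec mval :: "('k, 'm, 'w) two_sorted \<Rightarrow> (nat \<Rightarrow> 'm) \<Rightarrow> 'k mterm \<Rightarrow> 'm" where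
  "mval S e (MVar i) = e i"
| "mval S e MZero = mzero S"
| "mval S e (MAdd s t) = madd S (mval S e s) (mval S e t)"
| "mval S e (MScale r t) = mscale S r (mval S e t)"

primrec wval ::
  "('k, 'm, 'w) two_sorted \<Rightarrow> (nat \<Rightarrow> 'm) \<Rightarrow> (nat \<Rightarrow> 'w) \<Rightarrow> 'k wterm \<Rightarrow> 'w"
where
  "wval S e d (WVar i) = d i"
| "wval S e d WZero = wzero S"
| "wval S e d (WAdd s t) = wadd S (wval S e d s) (wval S e d t)"
| "wval S e d (WScale r t) = wscale S r (wval S e d t)"
| "wval S e d (Beta s t) = form S (mval S e s) (mval S e t)"

primrec sat ::
  "('k, 'm, 'w) two_sorted \<Rightarrow> (nat \<Rightarrow> 'm) \<Rightarrow> (nat \<Rightarrow> 'w) \<Rightarrow> 'k fm \<Rightarrow> bool"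
where
  "sat S e d (MEq s t) \<longleftrightarrow> mval S e s = mval S e t"
| "sat S e d (WEq s t) \<longleftrightarrow> wval S e d s = wval S e d t"
| "sat S e d (Neg \<phi>) \<longleftrightarrow> \<not> sat S e d \<phi>"
| "sat S e d (Conj \<phi> \<psi>) \<longleftrightarrow> sat S e d \<phi> \<and> sat S e d \<psi>"
| "sat S e d (MEx i \<phi>) \<longleftrightarrow> (\<exists>a\<in>Mdom S. sat S (e(i := a)) d \<phi>)"
| "sat S e d (WEx i \<phi>) \<longleftrightarrow> (\<exists>c\<in>Wdom S. sat S e (d(i := c)) \<phi>)"

primrec mvars :: "'k mterm \<Rightarrow> nat set" where
  "mvars (MVar i) = {i}"
| "mvars MZero = {}"
| "mvars (MAdd s t) = mvars s \<union> mvars t"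
| "mvars (MScale r t) = mvars t"

text \<open>\<open>wmvars\<close> and \<open>fmvars\<close> collect the free variables of sort \<open>M\<close>, \<open>wwvars\<close> and
  \<open>fwvars\<close> those of sort \<open>W\<close>.\<close>

primrec wmvars :: "'k wterm \<Rightarrow> nat set" where
  "wmvars (WVar i) = {}"
| "wmvars WZero = {}"
| "wmvars (WAdd s t) = wmvars s \<union> wmvars t"
| "wmvars (WScale r t) = wmvars t"
| "wmvars (Beta s t) = mvars s \<union> mvars t"

primrec wwvars :: "'k wterm \<Rightarrow> nat set" where
  "wwvars (WVar i) = {i}"
| "wwvars WZero = {}"
| "wwvars (WAdd s t) = wwvars s \<union> wwvars t"
| "wwvars (WScale r t) = wwvars t"
| "wwvars (Beta s t) = {}"

primrec fmvars :: "'k fm \<Rightarrow> nat set" where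
  "fmvars (MEq s t) = mvars s \<union> mvars t"
| "fmvars (WEq s t) = wmvars s \<union> wmvars t"
| "fmvars (Neg \<phi>) = fmvars \<phi>"
| "fmvars (Conj \<phi> \<psi>) = fmvars \<phi> \<union> fmvars \<psi>"
| "fmvars (MEx i \<phi>) = fmvars \<phi> - {i}"
| "fmvars (WEx i \<phi>) = fmvars \<phi>"

primrec fwvars :: "'k fm \<Rightarrow> nat set" where
  "fwvars (MEq s t) = {}"
| "fwvars (WEq s t) = wwvars s \<union> wwvars t"
| "fwvars (Neg \<phi>) = fwvars \<phi>"
| "fwvars (Conj \<phi> \<psi>) = fwvars \<phi> \<union> fwvars \<psi>"
| "fwvars (MEx i \<phi>) = fwvars \<phi>"
| "fwvars (WEx i \<phi>) = fwvars \<phi> - {i}"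

definition sentence :: "'k fm \<Rightarrow> bool" where
  "sentence \<phi> \<longleftrightarrow> fmvars \<phi> = {} \<and> fwvars \<phi> = {}"

definition holds :: "('k, 'm, 'w) two_sorted \<Rightarrow> 'k fm \<Rightarrow> bool" where
  "holds S \<phi> \<longleftrightarrow> (\<forall>e d. range e \<subseteq> Mdom S \<and> range d \<subseteq> Wdom S \<longrightarrow> sat S e d \<phi>)"

definition complete_theory :: "('k, 'm, 'w) two_sorted \<Rightarrow> 'k fm set" where
  "complete_theory S = {\<phi>. sentence \<phi> \<and> holds S \<phi>}"

definition models :: "('k, 'm, 'w) two_sorted \<Rightarrow> 'k fm set \<Rightarrow> bool" where
  "models S T \<longleftrightarrow> is_structure S \<and> (\<forall>\<phi>\<in>T. holds S \<phi>)"

definition isomorphic ::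
  "('k, 'm1, 'w1) two_sorted \<Rightarrow> ('k, 'm2, 'w2) two_sorted \<Rightarrow> bool"
where
  "isomorphic S T \<longleftrightarrow> (\<exists>f g.
     bij_betw f (Mdom S) (Mdom T) \<and> bij_betw g (Wdom S) (Wdom T) \<and>
     f (mzero S) = mzero T \<and> g (wzero S) = wzero T \<and>
     (\<forall>a\<in>Mdom S. \<forall>b\<in>Mdom S. f (madd S a b) = madd T (f a) (f b)) \<and>
     (\<forall>a\<in>Wdom S. \<forall>b\<in>Wdom S. g (wadd S a b) = wadd T (g a) (g b)) \<and>
     (\<forall>r. \<forall>a\<in>Mdom S. f (mscale S r a) = mscale T r (f a)) \<and>
     (\<forall>r. \<forall>a\<in>Wdom S. g (wscale S r a) = wscale T r (g a)) \<and>
     (\<forall>a\<in>Mdom S. \<forall>b\<in>Mdom S. g (form S a b) = form T (f a) (f b)))"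

text \<open>
  Any two models of cardinality \<open>\<aleph>\<^sub>0\<close> are isomorphic.  Every structure of cardinality
  \<open>\<aleph>\<^sub>0\<close> has an isomorphic copy both of whose carriers are sets of natural numbers, so
  quantifying over those is no restriction; one of the two carriers may be finite.
\<close>

definition aleph0_categorical_theory :: "'k fm set \<Rightarrow> bool" where
  "aleph0_categorical_theory T \<longleftrightarrow>
     (\<forall>(A :: ('k, nat, nat) two_sorted) (B :: ('k, nat, nat) two_sorted).
        models A T \<and> (infinite (Mdom A) \<or> infinite (Wdom A)) \<and>
        models B T \<and> (infinite (Mdom B) \<or> infinite (Wdom B)) \<longrightarrow> isomorphic A B)"

definition aleph0_categorical :: "('k, 'm, 'w) two_sorted \<Rightarrow> bool" where
  "aleph0_categorical S \<longleftrightarrow> aleph0_categorical_theory (complete_theory S)"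

text \<open>
  Algebraic closure of a set \<open>X\<close> of elements of both sorts (\<open>Inl\<close> for \<open>M\<close>, \<open>Inr\<close> for
  \<open>W\<close>): the elements lying in a finite set that is definable with parameters from \<open>X\<close>.
  The parameters are the values of the free variables other than the distinguished one.
\<close>

definition acl :: "('k, 'm, 'w) two_sorted \<Rightarrow> ('m + 'w) set \<Rightarrow> ('m + 'w) set" where
  "acl S X =
     {Inl a | a. a \<in> Mdom S \<and> (\<exists>\<phi> e d i.
        (\<forall>j \<in> fmvars \<phi> - {i}. Inl (e j) \<in> X) \<and> (\<forall>j \<in> fwvars \<phi>. Inr (d j) \<in> X) \<and>
        sat S (e(i := a)) d \<phi> \<and> finite {b \<in> Mdom S. sat S (e(i := b)) d \<phi>})} \<union>
     {Inr c | c. c \<in> Wdom S \<and> (\<exists>\<phi> e d i.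
        (\<forall>j \<in> fmvars \<phi>. Inl (e j) \<in> X) \<and> (\<forall>j \<in> fwvars \<phi> - {i}. Inr (d j) \<in> X) \<and>
        sat S e (d(i := c)) \<phi> \<and> finite {b \<in> Wdom S. sat S e (d(i := b)) \<phi>})}"

definition bilinear_structure ::
  "('k \<Rightarrow> 'm::ab_group_add \<Rightarrow> 'm) \<Rightarrow> ('k \<Rightarrow> 'w::ab_group_add \<Rightarrow> 'w) \<Rightarrow> ('m \<Rightarrow> 'm \<Rightarrow> 'w)
    \<Rightarrow> ('k, 'm, 'w) two_sorted"
where
  "bilinear_structure sM sW \<beta> =
     \<lparr>Mdom = UNIV, Wdom = UNIV, mzero = 0, wzero = 0, madd = (+), wadd = (+),
      mscale = sM, wscale = sW, form = \<beta>\<rparr>"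

end

theory Submission
  imports Defs "HOL-Library.Countable_Set"
begin

text \<open>
  Let \<open>d\<close> be the least value of \<open>\<delta>\<^sub>k\<close> on finite subspaces containing \<open>H\<close>, and call \<open>D \<supseteq> H\<close> tight
  if \<open>\<delta>\<^sub>k(D) = d\<close>.  By submodularity tight subspaces are closed under sums and intersections, and
  \<open>N(D + L) = N(D) + N(L)\<close> for them; \<open>cl\<^sub>k(H)\<close> is the union of all tight subspaces.

  The sets \<open>W\<^sub>n\<close> of those \<open>w\<close> that lie in the span of \<open>\<beta>(L, L)\<close> for some tight \<open>L\<close> of dimension
  at most \<open>n\<close> form an increasing chain of sets definable over \<open>H\<close>, so by the Ryll-Nardzewski theorem
  it stabilises at some \<open>B\<close>.  If \<open>w\<close> lies in the spans for tight \<open>D\<close> and \<open>L\<close>, then, since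
  \<open>N(D + L) = N(D) + N(L)\<close> and \<open>\<Lambda>\<^sup>2D \<inter> \<Lambda>\<^sup>2L = \<Lambda>\<^sup>2(D \<inter> L)\<close>, it lies in the span for \<open>D \<inter> L\<close>.
  Hence every element of the span of \<open>\<beta>(D, D)\<close> is supported on a subspace of \<open>D\<close> of dimension at
  most \<open>B\<close>.  With \<open>n = dim D\<close> there are \<open>p\<close> to the power \<open>O(n)\<close> such elements, but the span has
  at least \<open>p\<close> to the power \<open>n(n - 1)/2 - k n\<close> of them.  So \<open>dim D\<close> is bounded and \<open>cl\<^sub>k(H)\<close> is
  finite.  Being a finite union of sets that are existentially definable over \<open>H\<close>, it is contained
  in \<open>acl(H)\<close>.
\<close>

section \<open>Definable relations\<close>

instance mterm :: (countable) countable by countable_datatype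
instance wterm :: (countable) countable by countable_datatype
instance fm :: (countable) countable by countable_datatype

section \<open>Free variables and satisfaction\<close>

lemma finite_mvars [simp]: "finite (mvars t)"
  by (induction t) auto

lemma finite_wmvars [simp]: "finite (wmvars t)"
  by (induction t) auto

lemma finite_wwvars [simp]: "finite (wwvars t)"
  by (induction t) auto

lemma finite_fmvars [simp]: "finite (fmvars \<phi>)"
  by (induction \<phi>) auto

lemma finite_fwvars [simp]: "finite (fwvars \<phi>)"
  by (induction \<phi>) auto

lemma mval_cong: "(\<And>i. i \<in> mvars t \<Longrightarrow> e i = e' i) \<Longrightarrow> mval S e t = mval S e' t"
  by (induction t) auto

lemma wval_cong:
  "(\<And>i. i \<in> wmvars t \<Longrightarrow> e i = e' i) \<Longrightarrow> (\<And>i. i \<in> wwvars t \<Longrightarrow> d i = d' i)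
    \<Longrightarrow> wval S e d t = wval S e' d' t"
  by (induction t) (auto intro: mval_cong intro!: arg_cong2[of _ _ _ _ "form S"])

lemma sat_cong:
  "(\<And>i. i \<in> fmvars \<phi> \<Longrightarrow> e i = e' i) \<Longrightarrow> (\<And>i. i \<in> fwvars \<phi> \<Longrightarrow> d i = d' i)
    \<Longrightarrow> sat S e d \<phi> \<longleftrightarrow> sat S e' d' \<phi>"
proof (induction \<phi> arbitrary: e e' d d')
  case (MEq s t)
  have "mval S e s = mval S e' s" "mval S e t = mval S e' t"
    using MEq by (auto intro: mval_cong)
  then show ?case by simp
next
  case (WEq s t)
  have "wval S e d s = wval S e' d' s" "wval S e d t = wval S e' d' t"
    using WEq by (auto intro!: wval_cong)
  then show ?case by simp
next
  case (Neg \<phi>)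
  have "sat S e d \<phi> \<longleftrightarrow> sat S e' d' \<phi>"
    by (rule Neg.IH) (use Neg.prems in auto)
  then show ?case by simp
next
  case (Conj \<phi> \<psi>)
  have "sat S e d \<phi> \<longleftrightarrow> sat S e' d' \<phi>"
    by (rule Conj.IH(1)) (use Conj.prems in auto)
  moreover have "sat S e d \<psi> \<longleftrightarrow> sat S e' d' \<psi>"
    by (rule Conj.IH(2)) (use Conj.prems in auto)
  ultimately show ?case by simp
next
  case (MEx i \<phi>)
  have "sat S (e(i := a)) d \<phi> \<longleftrightarrow> sat S (e'(i := a)) d' \<phi>" for a
    by (rule MEx.IH) (use MEx.prems in auto)
  then show ?case by simp
next
  case (WEx i \<phi>)
  have "sat S e (d(i := a)) \<phi> \<longleftrightarrow> sat S e' (d'(i := a)) \<phi>" for a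
    by (rule WEx.IH) (use WEx.prems in auto)
  then show ?case by simp
qed

section \<open>Isomorphisms preserve satisfaction\<close>

lemma mval_isomorphism:
  assumes "is_structure S" "range e \<subseteq> Mdom S"
    "f (mzero S) = mzero T"
    "\<forall>a\<in>Mdom S. \<forall>b\<in>Mdom S. f (madd S a b) = madd T (f a) (f b)"
    "\<forall>r. \<forall>a\<in>Mdom S. f (mscale S r a) = mscale T r (f a)"
  shows "mval S e t \<in> Mdom S \<and> mval T (f \<circ> e) t = f (mval S e t)"
  using assms by (induction t) (auto simp: is_structure_def)

text \<open>Equality needs injectivity, the quantifiers need surjectivity. Assignments are confined
  to the carriers because nothing is known about \<open>f\<close>, \<open>g\<close> or the
  operations outside them.\<close>

lemma isomorphic_sat:
  assumes S: "is_structure S" and "isomorphic S T"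
  obtains f g where "\<And>a. a \<in> Mdom S \<Longrightarrow> f a \<in> Mdom T" "\<And>a. a \<in> Wdom S \<Longrightarrow> g a \<in> Wdom T"
    "\<And>e d \<phi>. range e \<subseteq> Mdom S \<Longrightarrow> range d \<subseteq> Wdom S \<Longrightarrow> sat T (f \<circ> e) (g \<circ> d) \<phi> \<longleftrightarrow> sat S e d \<phi>"
proof -
  from assms(2) obtain f g where
    f: "bij_betw f (Mdom S) (Mdom T)" and g: "bij_betw g (Wdom S) (Wdom T)" and
    z: "f (mzero S) = mzero T" "g (wzero S) = wzero T" and
    m: "\<forall>a\<in>Mdom S. \<forall>b\<in>Mdom S. f (madd S a b) = madd T (f a) (f b)"
      "\<forall>r. \<forall>a\<in>Mdom S. f (mscale S r a) = mscale T r (f a)" and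
    w: "\<forall>a\<in>Wdom S. \<forall>b\<in>Wdom S. g (wadd S a b) = wadd T (g a) (g b)"
      "\<forall>r. \<forall>a\<in>Wdom S. g (wscale S r a) = wscale T r (g a)" and
    b: "\<forall>a\<in>Mdom S. \<forall>b\<in>Mdom S. g (form S a b) = form T (f a) (f b)"
    unfolding isomorphic_def by blast
  have mv: "mval S e t \<in> Mdom S" "mval T (f \<circ> e) t = f (mval S e t)"
    if "range e \<subseteq> Mdom S" for e t
    using mval_isomorphism[OF S that z(1) m] by auto
  have wv: "wval S e d t \<in> Wdom S \<and> wval T (f \<circ> e) (g \<circ> d) t = g (wval S e d t)"
    if "range e \<subseteq> Mdom S" "range d \<subseteq> Wdom S" for e d t
    using that by (induction t) (use S mv z w b in \<open>auto simp: is_structure_def\<close>)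
  have "sat T (f \<circ> e) (g \<circ> d) \<phi> \<longleftrightarrow> sat S e d \<phi>"
    if "range e \<subseteq> Mdom S" "range d \<subseteq> Wdom S" for e d \<phi>
    using that
  proof (induction \<phi> arbitrary: e d)
    case (MEq s t)
    then show ?case using mv f inj_on_eq_iff[of f "Mdom S"] unfolding bij_betw_def sat.simps by metis
  next
    case (WEq s t)
    then show ?case using wv g inj_on_eq_iff[of g "Wdom S"] unfolding bij_betw_def sat.simps by metis
  next
    case (MEx i \<phi>)
    have "sat T ((f \<circ> e)(i := f a)) (g \<circ> d) \<phi> \<longleftrightarrow> sat S (e(i := a)) d \<phi>" if "a \<in> Mdom S" for a
    proof -
      have "(f \<circ> e)(i := f a) = f \<circ> e(i := a)" by auto
      moreover have "range (e(i := a)) \<subseteq> Mdom S" using MEx.prems that by auto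
      ultimately show ?thesis using MEx.IH[of "e(i := a)" d] MEx.prems by metis
    qed
    moreover have "Mdom T = f ` Mdom S" using f by (simp add: bij_betw_def)
    ultimately show ?case by (simp only: sat.simps bex_simps) blast
  next
    case (WEx i \<phi>)
    have "sat T (f \<circ> e) ((g \<circ> d)(i := g a)) \<phi> \<longleftrightarrow> sat S e (d(i := a)) \<phi>" if "a \<in> Wdom S" for a
    proof -
      have "(g \<circ> d)(i := g a) = g \<circ> d(i := a)" by auto
      moreover have "range (d(i := a)) \<subseteq> Wdom S" using WEx.prems that by auto
      ultimately show ?thesis using WEx.IH[of e "d(i := a)"] WEx.prems by metis
    qed
    moreover have "Wdom T = g ` Wdom S" using g by (simp add: bij_betw_def)
    ultimately show ?case by (simp only: sat.simps bex_simps) blast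
  qed auto
  then show ?thesis
    using f g by (intro that[of f g]) (auto simp: bij_betw_def)
qed

text \<open>The lower bound \<open>r\<close> keeps a fresh variable clear of formulas that depend
  only on variables below \<open>r\<close>.\<close>

lemma fresh_nat:
  assumes "finite (A :: nat set)"
  obtains j where "j \<notin> A" "r \<le> j"
proof -
  obtain j where "j \<notin> A \<union> {..<r}"
    using assms by (metis ex_new_if_finite finite_Un finite_lessThan infinite_UNIV_nat)
  with that show ?thesis by auto
qed

section \<open>Renaming of variables\<close>

lemma mval_rename: "\<exists>t'. \<forall>a. mval S a t' = mval S (a \<circ> e) t"
proof (induction t)
  case (MVar i)
  show ?case by (rule exI[of _ "MVar (e i)"]) simp
next
  case MZero
  show ?case by (rule exI[of _ MZero]) simp
next
  case (MAdd s t)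
  then obtain s' t' where "\<forall>a. mval S a s' = mval S (a \<circ> e) s" "\<forall>a. mval S a t' = mval S (a \<circ> e) t"
    by blast
  then show ?case by (intro exI[of _ "MAdd s' t'"]) (simp add: o_def)
next
  case (MScale r t)
  then obtain t' where "\<forall>a. mval S a t' = mval S (a \<circ> e) t" by blast
  then show ?case by (intro exI[of _ "MScale r t'"]) (simp add: o_def)
qed

lemma wval_rename: "\<exists>t'. \<forall>a b. wval S a b t' = wval S (a \<circ> e) (b \<circ> d) t"
proof (induction t)
  case (WVar i)
  show ?case by (rule exI[of _ "WVar (d i)"]) simp
next
  case WZero
  show ?case by (rule exI[of _ WZero]) simp
next
  case (WAdd s t)
  then obtain s' t' where "\<forall>a b. wval S a b s' = wval S (a \<circ> e) (b \<circ> d) s"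
    "\<forall>a b. wval S a b t' = wval S (a \<circ> e) (b \<circ> d) t"
    by blast
  then show ?case by (intro exI[of _ "WAdd s' t'"]) (simp add: o_def)
next
  case (WScale r t)
  then obtain t' where "\<forall>a b. wval S a b t' = wval S (a \<circ> e) (b \<circ> d) t" by blast
  then show ?case by (intro exI[of _ "WScale r t'"]) (simp add: o_def)
next
  case (Beta s t)
  obtain s' t' where "\<forall>a. mval S a s' = mval S (a \<circ> e) s" "\<forall>a. mval S a t' = mval S (a \<circ> e) t"
    using mval_rename by meson
  then show ?case by (intro exI[of _ "Beta s' t'"]) (simp add: o_def)
qed

text \<open>The maps \<open>e\<close> and \<open>d\<close> may identify variables, so a quantified
  \<open>i\<close> cannot simply keep its name: it becomes a \<open>j\<close> outside the image of
  the free variables, which prevents capture.\<close>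

lemma sat_rename: "\<exists>\<phi>'. \<forall>a b. sat S a b \<phi>' \<longleftrightarrow> sat S (a \<circ> e) (b \<circ> d) \<phi>"
proof (induction \<phi> arbitrary: e d)
  case (MEq s t)
  obtain s' t' where "\<forall>a. mval S a s' = mval S (a \<circ> e) s" "\<forall>a. mval S a t' = mval S (a \<circ> e) t"
    using mval_rename by meson
  then show ?case by (intro exI[of _ "MEq s' t'"]) (simp add: o_def)
next
  case (WEq s t)
  obtain s' where "\<forall>a b. wval S a b s' = wval S (a \<circ> e) (b \<circ> d) s"
    using wval_rename by meson
  moreover obtain t' where "\<forall>a b. wval S a b t' = wval S (a \<circ> e) (b \<circ> d) t"
    using wval_rename by meson
  ultimately show ?case by (intro exI[of _ "WEq s' t'"]) (simp add: o_def)
next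
  case (Neg \<phi>)
  then obtain \<phi>' where "\<forall>a b. sat S a b \<phi>' \<longleftrightarrow> sat S (a \<circ> e) (b \<circ> d) \<phi>" by blast
  then show ?case by (intro exI[of _ "Neg \<phi>'"]) (simp add: o_def)
next
  case (Conj \<phi> \<psi>)
  obtain \<phi>' where "\<forall>a b. sat S a b \<phi>' \<longleftrightarrow> sat S (a \<circ> e) (b \<circ> d) \<phi>" using Conj.IH(1) by blast
  moreover obtain \<psi>' where "\<forall>a b. sat S a b \<psi>' \<longleftrightarrow> sat S (a \<circ> e) (b \<circ> d) \<psi>"
    using Conj.IH(2) by blast
  ultimately show ?case by (intro exI[of _ "Conj \<phi>' \<psi>'"]) (simp add: o_def)
next
  case (MEx i \<phi>)
  obtain j where j: "j \<notin> e ` fmvars \<phi>"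
    using fresh_nat[of "e ` fmvars \<phi>" 0] by auto
  obtain \<phi>' where \<phi>': "\<forall>a b. sat S a b \<phi>' \<longleftrightarrow> sat S (a \<circ> e(i := j)) (b \<circ> d) \<phi>"
    using MEx.IH by blast
  have "sat S (a(j := c) \<circ> e(i := j)) (b \<circ> d) \<phi> \<longleftrightarrow> sat S ((a \<circ> e)(i := c)) (b \<circ> d) \<phi>" for a b c
    by (rule sat_cong) (use j in auto)
  then show ?case using \<phi>' by (intro exI[of _ "MEx j \<phi>'"]) (simp add: o_def)
next
  case (WEx i \<phi>)
  obtain j where j: "j \<notin> d ` fwvars \<phi>"
    using fresh_nat[of "d ` fwvars \<phi>" 0] by auto
  obtain \<phi>' where \<phi>': "\<forall>a b. sat S a b \<phi>' \<longleftrightarrow> sat S (a \<circ> e) (b \<circ> d(i := j)) \<phi>"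
    using WEx.IH by blast
  have "sat S (a \<circ> e) (b(j := c) \<circ> d(i := j)) \<phi> \<longleftrightarrow> sat S (a \<circ> e) ((b \<circ> d)(i := c)) \<phi>" for a b c
    by (rule sat_cong) (use j in auto)
  then show ?case using \<phi>' by (intro exI[of _ "WEx j \<phi>'"]) (simp add: o_def)
qed

text \<open>Formulas are replaced by their meaning in \<open>S\<close>, so that later ones arise
  from closure properties instead of explicit syntax. Parameters are not built in; they enter as
  values of free variables.\<close>

definition definable ::
  "('k, 'm, 'w) two_sorted \<Rightarrow> ((nat \<Rightarrow> 'm) \<Rightarrow> (nat \<Rightarrow> 'w) \<Rightarrow> bool) \<Rightarrow> bool"
where
  "definable S P \<longleftrightarrow> (\<exists>\<phi>. \<forall>e d. sat S e d \<phi> \<longleftrightarrow> P e d)"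

lemma definableI: "(\<And>e d. sat S e d \<phi> \<longleftrightarrow> P e d) \<Longrightarrow> definable S P"
  unfolding definable_def by blast

lemma definable_sat: "definable S (\<lambda>e d. sat S e d \<phi>)"
  by (rule definableI) simp

lemma definable_not: "definable S P \<Longrightarrow> definable S (\<lambda>e d. \<not> P e d)"
  unfolding definable_def by (metis sat.simps(3))

lemma definable_conj: "definable S P \<Longrightarrow> definable S Q \<Longrightarrow> definable S (\<lambda>e d. P e d \<and> Q e d)"
  unfolding definable_def by (metis sat.simps(4))

lemma definable_disj: "definable S P \<Longrightarrow> definable S Q \<Longrightarrow> definable S (\<lambda>e d. P e d \<or> Q e d)"
  using definable_not[OF definable_conj[OF definable_not definable_not]] by fastforce

lemma definable_const: "definable S (\<lambda>e d. Q)"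
proof -
  have "definable S (\<lambda>e d. True)" by (rule definableI[of _ "MEq MZero MZero"]) simp
  moreover have "definable S (\<lambda>e d. False)" by (rule definableI[of _ "Neg (MEq MZero MZero)"]) simp
  ultimately show ?thesis by (cases Q) auto
qed

lemma definable_ball:
  "finite I \<Longrightarrow> (\<And>i. i \<in> I \<Longrightarrow> definable S (P i)) \<Longrightarrow> definable S (\<lambda>e d. \<forall>i\<in>I. P i e d)"
proof (induction I rule: finite_induct)
  case empty
  show ?case using definable_const by simp
next
  case (insert i I)
  then have "definable S (\<lambda>e d. P i e d \<and> (\<forall>i\<in>I. P i e d))" by (intro definable_conj) auto
  then show ?case by simp
qed

lemma definable_bex:
  assumes "finite I" "\<And>i. i \<in> I \<Longrightarrow> definable S (P i)"
  shows "definable S (\<lambda>e d. \<exists>i\<in>I. P i e d)"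
  using definable_not[OF definable_ball[OF assms(1), of S "\<lambda>i e d. \<not> P i e d"]] assms(2)
  by (auto simp: definable_not)

lemma definable_rename: "definable S P \<Longrightarrow> definable S (\<lambda>a b. P (a \<circ> e) (b \<circ> d))"
  unfolding definable_def by (metis sat_rename)

lemma definable_MEx:
  assumes "Mdom S = UNIV" "definable S P"
  shows "definable S (\<lambda>e d. \<exists>c. P (e(i := c)) d)"
proof -
  from assms(2) obtain \<phi> where "\<And>e d. sat S e d \<phi> \<longleftrightarrow> P e d" unfolding definable_def by blast
  then show ?thesis using assms(1) by (intro definableI[of _ "MEx i \<phi>"]) simp
qed

lemma definable_WEx:
  assumes "Wdom S = UNIV" "definable S P"
  shows "definable S (\<lambda>e d. \<exists>c. P e (d(i := c)))"
proof -
  from assms(2) obtain \<phi> where "\<And>e d. sat S e d \<phi> \<longleftrightarrow> P e d" unfolding definable_def by blast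
  then show ?thesis using assms(1) by (intro definableI[of _ "WEx i \<phi>"]) simp
qed

section \<open>Quantification over blocks of variables\<close>

lemma exists_formula_MEx:
  assumes "Mdom S = UNIV" "finite I"
  shows "\<exists>\<phi>'. fmvars \<phi>' = fmvars \<phi> - I \<and> fwvars \<phi>' = fwvars \<phi> \<and>
    (\<forall>e d. sat S e d \<phi>' \<longleftrightarrow> (\<exists>e'. (\<forall>i. i \<notin> I \<longrightarrow> e' i = e i) \<and> sat S e' d \<phi>))"
  using assms(2)
proof (induction I rule: finite_induct)
  case empty
  show ?case by (rule exI[of _ \<phi>]) (simp flip: fun_eq_iff)
next
  case (insert i I)
  then obtain \<phi>' where \<phi>': "fmvars \<phi>' = fmvars \<phi> - I" "fwvars \<phi>' = fwvars \<phi>"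
    and sat: "\<And>e d. sat S e d \<phi>' \<longleftrightarrow> (\<exists>e'. (\<forall>i. i \<notin> I \<longrightarrow> e' i = e i) \<and> sat S e' d \<phi>)"
    by blast
  have "sat S e d (MEx i \<phi>') \<longleftrightarrow> (\<exists>e'. (\<forall>j. j \<notin> insert i I \<longrightarrow> e' j = e j) \<and> sat S e' d \<phi>)" for e d
  proof
    assume "sat S e d (MEx i \<phi>')"
    then obtain c e' where "\<forall>j. j \<notin> I \<longrightarrow> e' j = (e(i := c)) j" "sat S e' d \<phi>"
      by (auto simp only: sat.simps sat)
    then show "\<exists>e'. (\<forall>j. j \<notin> insert i I \<longrightarrow> e' j = e j) \<and> sat S e' d \<phi>"
      by (intro exI[of _ e']) auto
  next
    assume "\<exists>e'. (\<forall>j. j \<notin> insert i I \<longrightarrow> e' j = e j) \<and> sat S e' d \<phi>"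
    then obtain e' where "\<forall>j. j \<notin> insert i I \<longrightarrow> e' j = e j" "sat S e' d \<phi>" by blast
    then have "sat S (e(i := e' i)) d \<phi>'"
      unfolding sat by (intro exI[of _ e']) auto
    then show "sat S e d (MEx i \<phi>')" using assms(1) by auto
  qed
  then show ?case using \<phi>' by (intro exI[of _ "MEx i \<phi>'"]) auto
qed

lemma exists_formula_WEx:
  assumes "Wdom S = UNIV" "finite I"
  shows "\<exists>\<phi>'. fmvars \<phi>' = fmvars \<phi> \<and> fwvars \<phi>' = fwvars \<phi> - I \<and>
    (\<forall>e d. sat S e d \<phi>' \<longleftrightarrow> (\<exists>d'. (\<forall>i. i \<notin> I \<longrightarrow> d' i = d i) \<and> sat S e d' \<phi>))"
  using assms(2)
proof (induction I rule: finite_induct)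
  case empty
  show ?case by (rule exI[of _ \<phi>]) (simp flip: fun_eq_iff)
next
  case (insert i I)
  then obtain \<phi>' where \<phi>': "fmvars \<phi>' = fmvars \<phi>" "fwvars \<phi>' = fwvars \<phi> - I"
    and sat: "\<And>e d. sat S e d \<phi>' \<longleftrightarrow> (\<exists>d'. (\<forall>i. i \<notin> I \<longrightarrow> d' i = d i) \<and> sat S e d' \<phi>)"
    by blast
  have "sat S e d (WEx i \<phi>') \<longleftrightarrow> (\<exists>d'. (\<forall>j. j \<notin> insert i I \<longrightarrow> d' j = d j) \<and> sat S e d' \<phi>)" for e d
  proof
    assume "sat S e d (WEx i \<phi>')"
    then obtain c d' where "\<forall>j. j \<notin> I \<longrightarrow> d' j = (d(i := c)) j" "sat S e d' \<phi>"
      by (auto simp only: sat.simps sat)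
    then show "\<exists>d'. (\<forall>j. j \<notin> insert i I \<longrightarrow> d' j = d j) \<and> sat S e d' \<phi>"
      by (intro exI[of _ d']) auto
  next
    assume "\<exists>d'. (\<forall>j. j \<notin> insert i I \<longrightarrow> d' j = d j) \<and> sat S e d' \<phi>"
    then obtain d' where "\<forall>j. j \<notin> insert i I \<longrightarrow> d' j = d j" "sat S e d' \<phi>" by blast
    then have "sat S e (d(i := d' i)) \<phi>'"
      unfolding sat by (intro exI[of _ d']) auto
    then show "sat S e d (WEx i \<phi>')" using assms(1) by auto
  qed
  then show ?case using \<phi>' by (intro exI[of _ "WEx i \<phi>'"]) auto
qed

text \<open>Only the finitely many free variables outside \<open>V\<close> and \<open>V'\<close>
  have to be quantified, so these two sets may be arbitrary. The bounds on the free variables matter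
  for \<open>acl\<close>, where the values of free variables are the parameters.\<close>

lemma formula_project:
  assumes "Mdom S = UNIV" "Wdom S = UNIV"
  obtains \<phi>' where "fmvars \<phi>' \<subseteq> V" "fwvars \<phi>' \<subseteq> V'"
    "\<And>e d. sat S e d \<phi>' \<longleftrightarrow>
      (\<exists>e' d'. (\<forall>i\<in>V. e' i = e i) \<and> (\<forall>i\<in>V'. d' i = d i) \<and> sat S e' d' \<phi>)"
proof -
  obtain \<phi>1 where 1: "fmvars \<phi>1 = fmvars \<phi> - (fmvars \<phi> - V)" "fwvars \<phi>1 = fwvars \<phi>"
    "\<And>e d. sat S e d \<phi>1 \<longleftrightarrow> (\<exists>e'. (\<forall>i. i \<notin> fmvars \<phi> - V \<longrightarrow> e' i = e i) \<and> sat S e' d \<phi>)"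
    using exists_formula_MEx[OF assms(1), of "fmvars \<phi> - V" \<phi>] by auto
  obtain \<phi>2 where 2: "fmvars \<phi>2 = fmvars \<phi>1" "fwvars \<phi>2 = fwvars \<phi>1 - (fwvars \<phi> - V')"
    "\<And>e d. sat S e d \<phi>2 \<longleftrightarrow> (\<exists>d'. (\<forall>i. i \<notin> fwvars \<phi> - V' \<longrightarrow> d' i = d i) \<and> sat S e d' \<phi>1)"
    using exists_formula_WEx[OF assms(2), of "fwvars \<phi> - V'" \<phi>1] by auto
  show ?thesis
  proof (rule that[of \<phi>2])
    fix e d
    show "sat S e d \<phi>2 \<longleftrightarrow>
      (\<exists>e' d'. (\<forall>i\<in>V. e' i = e i) \<and> (\<forall>i\<in>V'. d' i = d i) \<and> sat S e' d' \<phi>)" (is "?L \<longleftrightarrow> ?R")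
    proof
      assume ?L
      then obtain e' d' where "\<forall>i. i \<notin> fwvars \<phi> - V' \<longrightarrow> d' i = d i"
        "\<forall>i. i \<notin> fmvars \<phi> - V \<longrightarrow> e' i = e i" "sat S e' d' \<phi>"
        unfolding 2(3) 1(3) by blast
      then show ?R by (intro exI[of _ e'] exI[of _ d']) auto
    next
      assume ?R
      then obtain e' d' where *: "\<forall>i\<in>V. e' i = e i" "\<forall>i\<in>V'. d' i = d i" "sat S e' d' \<phi>"
        by blast
      \<comment> \<open>Only quantified variables take the witnessing values; every other free
        variable lies in \<open>V\<close> or \<open>V'\<close>, where both assignments
        agree.\<close>
      let ?e = "\<lambda>i. if i \<in> fmvars \<phi> - V then e' i else e i"
      let ?d = "\<lambda>i. if i \<in> fwvars \<phi> - V' then d' i else d i"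
      have "sat S ?e ?d \<phi>"
        using *(3) by (rule iffD1[OF sat_cong, rotated -1]) (use * in auto)
      then show ?L
        unfolding 2(3) 1(3) by (intro exI[of _ ?e] exI[of _ ?d] conjI) auto
    qed
  qed (use 1 2 in auto)
qed

lemma definable_project:
  assumes "Mdom S = UNIV" "Wdom S = UNIV" "definable S P"
  shows "definable S (\<lambda>e d. \<exists>e' d'. (\<forall>i\<in>V. e' i = e i) \<and> (\<forall>i\<in>V'. d' i = d i) \<and> P e' d')"
proof -
  from assms(3) obtain \<phi> where \<phi>: "\<And>e d. sat S e d \<phi> \<longleftrightarrow> P e d" unfolding definable_def by blast
  obtain \<phi>' where "\<And>e d. sat S e d \<phi>' \<longleftrightarrow>
      (\<exists>e' d'. (\<forall>i\<in>V. e' i = e i) \<and> (\<forall>i\<in>V'. d' i = d i) \<and> sat S e' d' \<phi>)"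
    by (rule formula_project[OF assms(1,2), of V V' \<phi>]) auto
  then show ?thesis unfolding \<phi> by (rule definableI)
qed

section \<open>Generic models and the Ryll-Nardzewski theorem for chains\<close>

text \<open>A generic filter presented as a descending sequence: the requirements, each dense in
  \<open>C\<close>, are enumerated, and step \<open>n\<close> meets the \<open>n\<close>-th
  one.\<close>

lemma rasiowa_sikorski:
  fixes p0 :: "'c::preorder"
  assumes "countable D" "p0 \<in> C" "\<And>R p. R \<in> D \<Longrightarrow> p \<in> C \<Longrightarrow> \<exists>q\<in>C. q \<le> p \<and> R q"
  shows "\<exists>G :: nat \<Rightarrow> 'c. (\<forall>n. G n \<in> C) \<and> (\<forall>n. G (Suc n) \<le> G n) \<and> (\<forall>R\<in>D. \<exists>n. R (G n))"
proof (cases "D = {}")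
  case True
  show ?thesis by (rule exI[of _ "\<lambda>_. p0"]) (use True assms(2) in auto)
next
  case False
  have "\<exists>G. \<forall>n. G n \<in> C \<and> (G (Suc n) \<le> G n \<and> from_nat_into D n (G (Suc n)))"
  proof (rule dependent_nat_choice)
    show "\<exists>x. x \<in> C" using assms(2) by blast
    show "\<exists>y. y \<in> C \<and> (y \<le> x \<and> from_nat_into D n y)" if "x \<in> C" for x n
      using assms(3)[OF from_nat_into[OF False] that] by blast
  qed
  then obtain G where G: "\<And>n. G n \<in> C" "\<And>n. G (Suc n) \<le> G n"
    "\<And>n. from_nat_into D n (G (Suc n))" by blast
  show ?thesis
  proof (intro exI[of _ G] conjI allI ballI G)
    fix R assume "R \<in> D"
    then obtain n where "R = from_nat_into D n"
      using from_nat_into_surj[OF assms(1)] by metis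
    then show "\<exists>n. R (G n)" using G(3) by blast
  qed
qed

text \<open>
  The variables serve as Henkin constants: a chain deciding every formula and containing a
  witnessing variable for every existential formula determines a structure on variables.
\<close>

locale generic_chain =
  fixes S :: "('k, 'm, 'w) two_sorted" and G :: "nat \<Rightarrow> (nat \<Rightarrow> 'm) \<Rightarrow> (nat \<Rightarrow> 'w) \<Rightarrow> bool"
  assumes full: "Mdom S = UNIV" "Wdom S = UNIV"
    and decreasing: "G (Suc n) \<le> G n"
    and nonempty: "\<exists>a b. G n a b"
    and decides: "\<exists>n. (\<forall>a b. G n a b \<longrightarrow> sat S a b \<phi>) \<or> (\<forall>a b. G n a b \<longrightarrow> \<not> sat S a b \<phi>)"
    and witness_M: "\<exists>n j. \<forall>a b. G n a b \<longrightarrow> (\<exists>c. sat S (a(i := c)) b \<phi>) \<longrightarrow> sat S (a(i := a j)) b \<phi>"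
    and witness_W: "\<exists>n j. \<forall>a b. G n a b \<longrightarrow> (\<exists>c. sat S a (b(i := c)) \<phi>) \<longrightarrow> sat S a (b(i := b j)) \<phi>"
begin

text \<open>The filter generated by the chain. On definable relations it is an ultrafilter
  (\<open>large_not\<close>), so it acts as the complete type of an assignment with Henkin
  witnesses.\<close>

definition large :: "((nat \<Rightarrow> 'm) \<Rightarrow> (nat \<Rightarrow> 'w) \<Rightarrow> bool) \<Rightarrow> bool" where
  "large Q \<longleftrightarrow> (\<exists>n. \<forall>a b. G n a b \<longrightarrow> Q a b)"

lemma antimono: "n \<le> m \<Longrightarrow> G m a b \<Longrightarrow> G n a b"
  using lift_Suc_antimono_le[of G n m] decreasing by (auto simp: le_fun_def)

lemma large_mono: "large P \<Longrightarrow> (\<And>a b. P a b \<Longrightarrow> Q a b) \<Longrightarrow> large Q"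
  unfolding large_def by blast

lemma large_True: "(\<And>a b. P a b) \<Longrightarrow> large P"
  unfolding large_def by blast

lemma large_conj: "large P \<Longrightarrow> large Q \<Longrightarrow> large (\<lambda>a b. P a b \<and> Q a b)"
proof -
  assume "large P" "large Q"
  then obtain n m where "\<And>a b. G n a b \<Longrightarrow> P a b" "\<And>a b. G m a b \<Longrightarrow> Q a b"
    unfolding large_def by blast
  then show ?thesis
    unfolding large_def using antimono[of n "max n m"] antimono[of m "max n m"]
    by (intro exI[of _ "max n m"]) auto
qed

lemma large_conj_iff: "large (\<lambda>a b. P a b \<and> Q a b) \<longleftrightarrow> large P \<and> large Q"
proof
  assume PQ: "large (\<lambda>a b. P a b \<and> Q a b)"
  show "large P \<and> large Q"
    using large_mono[OF PQ, of P] large_mono[OF PQ, of Q] by simp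
qed (simp add: large_conj)

lemma large_mp: "large P \<Longrightarrow> large (\<lambda>a b. P a b \<longrightarrow> Q a b) \<Longrightarrow> large Q"
  by (drule (1) large_conj, erule large_mono) blast

lemma large_cong:
  assumes "large P" "\<And>a b. P a b \<Longrightarrow> Q a b \<longleftrightarrow> R a b"
  shows "large Q \<longleftrightarrow> large R"
proof
  assume "large Q"
  from large_conj[OF assms(1) this] show "large R" by (rule large_mono) (use assms(2) in blast)
next
  assume "large R"
  from large_conj[OF assms(1) this] show "large Q" by (rule large_mono) (use assms(2) in blast)
qed

lemma not_large_False: "\<not> large (\<lambda>a b. False)"
  unfolding large_def using nonempty by blast

lemma large_not:
  assumes "definable S P"
  shows "large (\<lambda>a b. \<not> P a b) \<longleftrightarrow> \<not> large P"
proof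
  assume "large (\<lambda>a b. \<not> P a b)"
  then show "\<not> large P"
    using large_conj[of P "\<lambda>a b. \<not> P a b"] not_large_False by auto
next
  obtain \<phi> where "\<And>a b. sat S a b \<phi> \<longleftrightarrow> P a b" using assms unfolding definable_def by blast
  with decides[of \<phi>] have "large P \<or> large (\<lambda>a b. \<not> P a b)"
    unfolding large_def by auto
  then show "large (\<lambda>a b. \<not> P a b)" if "\<not> large P" using that by blast
qed

text \<open>Since \<open>e\<close> need not be injective, \<open>i\<close> is first renamed to a
  variable \<open>v\<close> outside the image of the free variables; the Henkin property for
  \<open>v\<close> then gives the witness.\<close>

lemma large_ex_M:
  assumes "large (\<lambda>a b. \<exists>c. sat S ((a \<circ> e)(i := c)) (b \<circ> d) \<phi>)"
  shows "\<exists>j. large (\<lambda>a b. sat S ((a \<circ> e)(i := a j)) (b \<circ> d) \<phi>)"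
proof -
  obtain v where v: "v \<notin> e ` fmvars \<phi>"
    using fresh_nat[of "e ` fmvars \<phi>" 0] by auto
  obtain \<phi>' where \<phi>': "\<And>a b. sat S a b \<phi>' \<longleftrightarrow> sat S (a \<circ> e(i := v)) (b \<circ> d) \<phi>"
    using sat_rename by meson
  have *: "sat S (a(v := c)) b \<phi>' \<longleftrightarrow> sat S ((a \<circ> e)(i := c)) (b \<circ> d) \<phi>" for a b c
    unfolding \<phi>' by (rule sat_cong) (use v in auto)
  obtain j where "large (\<lambda>a b. (\<exists>c. sat S ((a \<circ> e)(i := c)) (b \<circ> d) \<phi>) \<longrightarrow> sat S ((a \<circ> e)(i := a j)) (b \<circ> d) \<phi>)"
    using witness_M[of v \<phi>'] unfolding * large_def by metis
  from large_mp[OF assms this] show ?thesis ..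
qed

lemma large_ex_W:
  assumes "large (\<lambda>a b. \<exists>c. sat S (a \<circ> e) ((b \<circ> d)(i := c)) \<phi>)"
  shows "\<exists>j. large (\<lambda>a b. sat S (a \<circ> e) ((b \<circ> d)(i := b j)) \<phi>)"
proof -
  obtain v where v: "v \<notin> d ` fwvars \<phi>"
    using fresh_nat[of "d ` fwvars \<phi>" 0] by auto
  obtain \<phi>' where \<phi>': "\<And>a b. sat S a b \<phi>' \<longleftrightarrow> sat S (a \<circ> e) (b \<circ> d(i := v)) \<phi>"
    using sat_rename by meson
  have *: "sat S a (b(v := c)) \<phi>' \<longleftrightarrow> sat S (a \<circ> e) ((b \<circ> d)(i := c)) \<phi>" for a b c
    unfolding \<phi>' by (rule sat_cong) (use v in auto)
  obtain j where "large (\<lambda>a b. (\<exists>c. sat S (a \<circ> e) ((b \<circ> d)(i := c)) \<phi>) \<longrightarrow> sat S (a \<circ> e) ((b \<circ> d)(i := b j)) \<phi>)"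
    using witness_W[of v \<phi>'] unfolding * large_def by metis
  from large_mp[OF assms this] show ?thesis ..
qed

text \<open>This is the Henkin property for \<open>x = t\<close>, where \<open>x\<close> does not
  occur in \<open>t\<close>.\<close>

lemma term_witness_M: "\<exists>l. large (\<lambda>a b. a l = mval S (a \<circ> e) t)"
proof -
  obtain t' where t': "\<And>a. mval S a t' = mval S (a \<circ> e) t" using mval_rename by meson
  obtain v where v: "v \<notin> mvars t'" using fresh_nat[of "mvars t'" 0] by auto
  have *: "mval S (a(v := c)) t' = mval S (a \<circ> e) t" for a c
    unfolding t'[symmetric] by (rule mval_cong) (use v in auto)
  show ?thesis
    using large_ex_M[of id v id "MEq (MVar v) t'"] by (auto simp: * intro: large_True)
qed

lemma term_witness_W: "\<exists>l. large (\<lambda>a b. b l = wval S (a \<circ> e) (b \<circ> d) t)"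
proof -
  obtain t' where t': "\<And>a b. wval S a b t' = wval S (a \<circ> e) (b \<circ> d) t" using wval_rename by meson
  obtain v where v: "v \<notin> wwvars t'" using fresh_nat[of "wwvars t'" 0] by auto
  have *: "wval S a (b(v := c)) t' = wval S (a \<circ> e) (b \<circ> d) t" for a b c
    unfolding t'[symmetric] by (rule wval_cong) (use v in auto)
  show ?thesis
    using large_ex_W[of id id v "WEq (WVar v) t'"] by (auto simp: * intro: large_True)
qed

text \<open>Least representatives are used in place of equivalence classes, so that the carrier is a
  set of natural numbers, as in the models over which \<open>aleph0_categorical_theory\<close>
  quantifies.\<close>

definition rM :: "nat \<Rightarrow> nat" where
  "rM i = (LEAST j. large (\<lambda>a b. a i = a j))"

definition rW :: "nat \<Rightarrow> nat" where
  "rW i = (LEAST j. large (\<lambda>a b. b i = b j))"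

lemma large_rM: "large (\<lambda>a b. a i = a (rM i))"
  unfolding rM_def by (rule LeastI[of _ i]) (simp add: large_True)

lemma large_rW: "large (\<lambda>a b. b i = b (rW i))"
  unfolding rW_def by (rule LeastI[of _ i]) (simp add: large_True)

lemma rM_eq_iff: "rM i = rM j \<longleftrightarrow> large (\<lambda>a b. a i = a j)"
proof
  assume "rM i = rM j"
  then have "large (\<lambda>a b. a i = a (rM i) \<and> a j = a (rM i))"
    using large_conj[OF large_rM[of i] large_rM[of j]] by simp
  then show "large (\<lambda>a b. a i = a j)" by (rule large_mono) simp
next
  assume ij: "large (\<lambda>a b. a i = a j)"
  have "large (\<lambda>a b. a i = a l) \<longleftrightarrow> large (\<lambda>a b. a j = a l)" for l
    by (rule large_cong[OF ij]) simp
  then show "rM i = rM j" unfolding rM_def by simp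
qed

lemma rW_eq_iff: "rW i = rW j \<longleftrightarrow> large (\<lambda>a b. b i = b j)"
proof
  assume "rW i = rW j"
  then have "large (\<lambda>a b. b i = b (rW i) \<and> b j = b (rW i))"
    using large_conj[OF large_rW[of i] large_rW[of j]] by simp
  then show "large (\<lambda>a b. b i = b j)" by (rule large_mono) simp
next
  assume ij: "large (\<lambda>a b. b i = b j)"
  have "large (\<lambda>a b. b i = b l) \<longleftrightarrow> large (\<lambda>a b. b j = b l)" for l
    by (rule large_cong[OF ij]) simp
  then show "rW i = rW j" unfolding rW_def by simp
qed

lemma rM_idem [simp]: "rM (rM i) = rM i"
  using rM_eq_iff large_rM by metis

lemma rW_idem [simp]: "rW (rW i) = rW i"
  using rW_eq_iff large_rW by metis

text \<open>The result lies in \<open>range rM\<close> even if no variable names the value, which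
  makes the carrier closed under the operations by construction. For values of terms,
  \<open>term_witness_M\<close> supplies a name.\<close>

definition nameM :: "((nat \<Rightarrow> 'm) \<Rightarrow> 'm) \<Rightarrow> nat" where
  "nameM F = rM (SOME l. large (\<lambda>a b. a l = F a))"

definition nameW :: "((nat \<Rightarrow> 'm) \<Rightarrow> (nat \<Rightarrow> 'w) \<Rightarrow> 'w) \<Rightarrow> nat" where
  "nameW F = rW (SOME l. large (\<lambda>a b. b l = F a b))"

lemma nameM_eq:
  assumes "large (\<lambda>a b. a l = F' a)" "large (\<lambda>a b. F a = F' a)"
  shows "nameM F = rM l"
proof -
  have l: "large (\<lambda>a b. a l = F a)"
    using large_conj[OF assms] by (rule large_mono) simp
  then have "large (\<lambda>a b. a (SOME l. large (\<lambda>a b. a l = F a)) = F a)" by (rule someI)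
  from large_conj[OF this l] have "large (\<lambda>a b. a (SOME l. large (\<lambda>a b. a l = F a)) = a l)"
    by (rule large_mono) simp
  then show ?thesis unfolding nameM_def rM_eq_iff .
qed

lemma nameW_eq:
  assumes "large (\<lambda>a b. b l = F' a b)" "large (\<lambda>a b. F a b = F' a b)"
  shows "nameW F = rW l"
proof -
  have l: "large (\<lambda>a b. b l = F a b)"
    using large_conj[OF assms] by (rule large_mono) simp
  then have "large (\<lambda>a b. b (SOME l. large (\<lambda>a b. b l = F a b)) = F a b)" by (rule someI)
  from large_conj[OF this l] have "large (\<lambda>a b. b (SOME l. large (\<lambda>a b. b l = F a b)) = b l)"
    by (rule large_mono) simp
  then show ?thesis unfolding nameW_def rW_eq_iff .
qed

section \<open>The Henkin structure on representatives\<close>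

definition model :: "('k, nat, nat) two_sorted" where
  "model = \<lparr>Mdom = range rM, Wdom = range rW,
     mzero = nameM (\<lambda>a. mzero S), wzero = nameW (\<lambda>a b. wzero S),
     madd = (\<lambda>i j. nameM (\<lambda>a. madd S (a i) (a j))),
     wadd = (\<lambda>i j. nameW (\<lambda>a b. wadd S (b i) (b j))),
     mscale = (\<lambda>r i. nameM (\<lambda>a. mscale S r (a i))),
     wscale = (\<lambda>r i. nameW (\<lambda>a b. wscale S r (b i))),
     form = (\<lambda>i j. nameW (\<lambda>a b. form S (a i) (a j)))\<rparr>"

lemma model_sel:
  "Mdom model = range rM" "Wdom model = range rW"
  "mzero model = nameM (\<lambda>a. mzero S)" "wzero model = nameW (\<lambda>a b. wzero S)"
  "madd model i j = nameM (\<lambda>a. madd S (a i) (a j))"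
  "wadd model i j = nameW (\<lambda>a b. wadd S (b i) (b j))"
  "mscale model r i = nameM (\<lambda>a. mscale S r (a i))"
  "wscale model r i = nameW (\<lambda>a b. wscale S r (b i))"
  "form model i j = nameW (\<lambda>a b. form S (a i) (a j))"
  by (simp_all add: model_def)

lemma is_structure_model: "is_structure model"
  unfolding is_structure_def by (simp add: model_sel nameM_def nameW_def)

lemma mval_model:
  "large (\<lambda>a b. a l = mval S (a \<circ> e) t) \<Longrightarrow> mval model (rM \<circ> e) t = rM l"
proof (induction t arbitrary: l)
  case (MVar i)
  then show ?case by (simp add: rM_eq_iff[symmetric])
next
  case MZero
  then show ?case by (auto simp: model_sel intro: nameM_eq large_True)
next
  case (MAdd s t)
  obtain i j where i: "large (\<lambda>a b. a i = mval S (a \<circ> e) s)" and j: "large (\<lambda>a b. a j = mval S (a \<circ> e) t)"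
    using term_witness_M by meson
  have "nameM (\<lambda>a. madd S (a (rM i)) (a (rM j))) = rM l"
    by (rule nameM_eq[OF MAdd.prems],
        rule large_mono[OF large_conj[OF large_conj[OF i j] large_conj[OF large_rM[of i] large_rM[of j]]]]) (metis mval.simps)
  then show ?case using MAdd.IH(1)[OF i] MAdd.IH(2)[OF j] by (simp only: mval.simps wval.simps model_sel)
next
  case (MScale r t)
  obtain i where i: "large (\<lambda>a b. a i = mval S (a \<circ> e) t)"
    using term_witness_M by meson
  have "nameM (\<lambda>a. mscale S r (a (rM i))) = rM l"
    by (rule nameM_eq[OF MScale.prems],
        rule large_mono[OF large_conj[OF i large_rM[of i]]]) (metis mval.simps)
  then show ?case using MScale.IH[OF i] by (simp only: mval.simps wval.simps model_sel)
qed

lemma wval_model: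
  "large (\<lambda>a b. b l = wval S (a \<circ> e) (b \<circ> d) t) \<Longrightarrow> wval model (rM \<circ> e) (rW \<circ> d) t = rW l"
proof (induction t arbitrary: l)
  case (WVar i)
  then show ?case by (simp add: rW_eq_iff[symmetric])
next
  case WZero
  then show ?case by (auto simp: model_sel intro: nameW_eq large_True)
next
  case (WAdd s t)
  obtain i j where i: "large (\<lambda>a b. b i = wval S (a \<circ> e) (b \<circ> d) s)"
    and j: "large (\<lambda>a b. b j = wval S (a \<circ> e) (b \<circ> d) t)"
    using term_witness_W by meson
  have "nameW (\<lambda>a b. wadd S (b (rW i)) (b (rW j))) = rW l"
    by (rule nameW_eq[OF WAdd.prems],
        rule large_mono[OF large_conj[OF large_conj[OF i j] large_conj[OF large_rW[of i] large_rW[of j]]]]) (metis wval.simps)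
  then show ?case using WAdd.IH(1)[OF i] WAdd.IH(2)[OF j] by (simp only: mval.simps wval.simps model_sel)
next
  case (WScale r t)
  obtain i where i: "large (\<lambda>a b. b i = wval S (a \<circ> e) (b \<circ> d) t)"
    using term_witness_W by meson
  have "nameW (\<lambda>a b. wscale S r (b (rW i))) = rW l"
    by (rule nameW_eq[OF WScale.prems],
        rule large_mono[OF large_conj[OF i large_rW[of i]]]) (metis wval.simps)
  then show ?case using WScale.IH[OF i] by (simp only: mval.simps wval.simps model_sel)
next
  case (Beta s t)
  obtain i j where i: "large (\<lambda>a b. a i = mval S (a \<circ> e) s)" and j: "large (\<lambda>a b. a j = mval S (a \<circ> e) t)"
    using term_witness_M by meson
  have "nameW (\<lambda>a b. form S (a (rM i)) (a (rM j))) = rW l"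
    by (rule nameW_eq[OF Beta.prems],
        rule large_mono[OF large_conj[OF large_conj[OF i j] large_conj[OF large_rM[of i] large_rM[of j]]]]) (metis wval.simps)
  then show ?case using mval_model[OF i] mval_model[OF j] by (simp only: mval.simps wval.simps model_sel)
qed

text \<open>The truth lemma: deciding conditions handle negation, witnesses handle quantifiers. The
  renamings \<open>e\<close>, \<open>d\<close> are arbitrary so that the induction covers updates,
  because updating \<open>rM \<circ> e\<close> by a representative \<open>rM j\<close> amounts to
  updating \<open>e\<close> by \<open>j\<close>.\<close>

lemma sat_model:
  "sat model (rM \<circ> e) (rW \<circ> d) \<phi> \<longleftrightarrow> large (\<lambda>a b. sat S (a \<circ> e) (b \<circ> d) \<phi>)"
proof (induction \<phi> arbitrary: e d)
  case (MEq s t)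
  obtain i j where i: "large (\<lambda>a b. a i = mval S (a \<circ> e) s)" and j: "large (\<lambda>a b. a j = mval S (a \<circ> e) t)"
    using term_witness_M by meson
  have "large (\<lambda>a b. a i = a j) \<longleftrightarrow> large (\<lambda>a b. mval S (a \<circ> e) s = mval S (a \<circ> e) t)"
    by (rule large_cong[OF large_conj[OF i j]]) metis
  then show ?case by (simp only: sat.simps mval_model[OF i] mval_model[OF j] rM_eq_iff)
next
  case (WEq s t)
  obtain i j where i: "large (\<lambda>a b. b i = wval S (a \<circ> e) (b \<circ> d) s)"
    and j: "large (\<lambda>a b. b j = wval S (a \<circ> e) (b \<circ> d) t)"
    using term_witness_W by meson
  have "large (\<lambda>a b. b i = b j) \<longleftrightarrow> large (\<lambda>a b. wval S (a \<circ> e) (b \<circ> d) s = wval S (a \<circ> e) (b \<circ> d) t)"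
    by (rule large_cong[OF large_conj[OF i j]]) metis
  then show ?case by (simp only: sat.simps wval_model[OF i] wval_model[OF j] rW_eq_iff)
next
  case (Neg \<phi>)
  show ?case
    unfolding sat.simps Neg.IH large_not[OF definable_rename[OF definable_sat]] ..
next
  case (Conj \<phi> \<psi>)
  show ?case
    unfolding sat.simps Conj.IH large_conj_iff ..
next
  case (MEx i \<phi>)
  have up: "(rM \<circ> e)(i := rM j) = rM \<circ> e(i := j)" for j by auto
  have up': "(a \<circ> e)(i := a j) = a \<circ> e(i := j)" for a :: "nat \<Rightarrow> 'm" and j by auto
  have "sat model (rM \<circ> e) (rW \<circ> d) (MEx i \<phi>) \<longleftrightarrow>
      (\<exists>j. large (\<lambda>a b. sat S ((a \<circ> e)(i := a j)) (b \<circ> d) \<phi>))"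
    by (simp only: sat.simps model_sel(1) bex_simps up up' MEx.IH bex_UNIV)
  also have "\<dots> \<longleftrightarrow> large (\<lambda>a b. \<exists>c. sat S ((a \<circ> e)(i := c)) (b \<circ> d) \<phi>)"
  proof
    assume "\<exists>j. large (\<lambda>a b. sat S ((a \<circ> e)(i := a j)) (b \<circ> d) \<phi>)"
    then obtain j where "large (\<lambda>a b. sat S ((a \<circ> e)(i := a j)) (b \<circ> d) \<phi>)" ..
    then show "large (\<lambda>a b. \<exists>c. sat S ((a \<circ> e)(i := c)) (b \<circ> d) \<phi>)"
      by (rule large_mono) blast
  qed (rule large_ex_M)
  finally show ?case by (simp only: sat.simps full bex_UNIV)
next
  case (WEx i \<phi>)
  have up: "(rW \<circ> d)(i := rW j) = rW \<circ> d(i := j)" for j by auto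
  have up': "(b \<circ> d)(i := b j) = b \<circ> d(i := j)" for b :: "nat \<Rightarrow> 'w" and j by auto
  have "sat model (rM \<circ> e) (rW \<circ> d) (WEx i \<phi>) \<longleftrightarrow>
      (\<exists>j. large (\<lambda>a b. sat S (a \<circ> e) ((b \<circ> d)(i := b j)) \<phi>))"
    by (simp only: sat.simps model_sel(2) bex_simps up up' WEx.IH bex_UNIV)
  also have "\<dots> \<longleftrightarrow> large (\<lambda>a b. \<exists>c. sat S (a \<circ> e) ((b \<circ> d)(i := c)) \<phi>)"
  proof
    assume "\<exists>j. large (\<lambda>a b. sat S (a \<circ> e) ((b \<circ> d)(i := b j)) \<phi>)"
    then obtain j where "large (\<lambda>a b. sat S (a \<circ> e) ((b \<circ> d)(i := b j)) \<phi>)" ..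
    then show "large (\<lambda>a b. \<exists>c. sat S (a \<circ> e) ((b \<circ> d)(i := c)) \<phi>)"
      by (rule large_mono) blast
  qed (rule large_ex_W)
  finally show ?case by (simp only: sat.simps full bex_UNIV)
qed

lemma range_rM: "range e \<subseteq> range rM \<Longrightarrow> rM \<circ> e = e"
proof
  fix i assume "range e \<subseteq> range rM"
  then obtain j where "e i = rM j" by blast
  then show "(rM \<circ> e) i = e i" by simp
qed

lemma range_rW: "range d \<subseteq> range rW \<Longrightarrow> rW \<circ> d = d"
proof
  fix i assume "range d \<subseteq> range rW"
  then obtain j where "d i = rW j" by blast
  then show "(rW \<circ> d) i = d i" by simp
qed

lemma sat_model_range:
  assumes "range e \<subseteq> Mdom model" "range d \<subseteq> Wdom model"
  shows "sat model e d \<phi> \<longleftrightarrow> large (\<lambda>a b. sat S (a \<circ> e) (b \<circ> d) \<phi>)"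
  using sat_model[of e d \<phi>] range_rM[of e] range_rW[of d] assms
  by (simp add: model_sel(1) model_sel(2))

lemma models_model: "models model (complete_theory S)"
  unfolding models_def
proof (intro conjI ballI)
  fix \<phi> assume "\<phi> \<in> complete_theory S"
  then have "sat S a b \<phi>" for a b
    by (simp add: complete_theory_def holds_def full)
  then show "holds model \<phi>"
    unfolding holds_def by (auto simp: sat_model_range large_True)
qed (rule is_structure_model)

text \<open>If there were finitely many representatives, the formula saying that a variable differs
  from all of them could always be satisfied, and its Henkin witness would differ from its own
  representative.\<close>

lemma infinite_Mdom_model:
  assumes "infinite (UNIV :: 'm set)"
  shows "infinite (Mdom model)"
proof
  assume fin: "finite (Mdom model)"
  \<comment> \<open>This index exceeds every representative, so changing the value at
    \<open>j\<close> leaves the values at representatives alone.\<close>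
  define j where "j = Suc (Max (range rM))"
  have j: "i < j" if "i \<in> range rM" for i
    using that fin unfolding j_def by (simp add: model_sel(1) less_Suc_eq_le)
  have "definable S (\<lambda>a b. \<forall>i\<in>range rM. \<not> sat S a b (MEq (MVar j) (MVar i)))"
    using fin by (intro definable_ball definable_not definable_sat) (simp add: model_sel(1))
  then obtain \<phi> where \<phi>: "\<And>a b. sat S a b \<phi> \<longleftrightarrow> (\<forall>i\<in>range rM. a j \<noteq> a i)"
    unfolding definable_def by auto
  have "\<exists>c. sat S (a(j := c)) b \<phi>" for a b
  proof -
    have "finite (a ` range rM)" using fin by (simp add: model_sel(1))
    then obtain c where "c \<notin> a ` range rM"
      using ex_new_if_finite[OF assms] by blast
    then show ?thesis unfolding \<phi> using j by (intro exI[of _ c]) fastforce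
  qed
  then obtain l where "large (\<lambda>a b. sat S (a(j := a l)) b \<phi>)"
    using large_ex_M[of id j id \<phi>] by (auto simp: large_True)
  then have "large (\<lambda>a b. a l \<noteq> a (rM l))"
  proof (rule large_mono)
    fix a b assume "sat S (a(j := a l)) b \<phi>"
    then have "(a(j := a l)) j \<noteq> (a(j := a l)) (rM l)" unfolding \<phi> by blast
    then show "a l \<noteq> a (rM l)" using j[of "rM l"] by simp
  qed
  from large_conj[OF this large_rM[of l]] have "large (\<lambda>a b. False)"
    by (rule large_mono) simp
  then show False using not_large_False by simp
qed

end

section \<open>Forcing with definable relations\<close>

text \<open>
  The forcing conditions: definable sets of assignments not covered by finitely many formulas of
  \<open>\<Theta>\<close>.  In the structure given by a generic chain of conditions, the assignment of every
  variable to itself satisfies no formula of \<open>\<Theta>\<close>.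
\<close>

definition omittable ::
  "('k, 'm, 'w) two_sorted \<Rightarrow> 'k fm set \<Rightarrow> ((nat \<Rightarrow> 'm) \<Rightarrow> (nat \<Rightarrow> 'w) \<Rightarrow> bool) set"
where
  "omittable S \<Theta> = {P. definable S P \<and> (\<forall>\<Phi>. finite \<Phi> \<longrightarrow> \<Phi> \<subseteq> \<Theta> \<longrightarrow>
     (\<exists>a b. P a b \<and> (\<forall>\<theta>\<in>\<Phi>. \<not> sat S a b \<theta>)))}"

lemma omittableI:
  assumes "definable S P"
    "\<And>\<Phi>. finite \<Phi> \<Longrightarrow> \<Phi> \<subseteq> \<Theta> \<Longrightarrow> \<exists>a b. P a b \<and> (\<forall>\<theta>\<in>\<Phi>. \<not> sat S a b \<theta>)"
  shows "P \<in> omittable S \<Theta>"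
  using assms unfolding omittable_def by blast

lemma omittableD:
  assumes "P \<in> omittable S \<Theta>"
  shows "definable S P"
    "finite \<Phi> \<Longrightarrow> \<Phi> \<subseteq> \<Theta> \<Longrightarrow> \<exists>a b. P a b \<and> (\<forall>\<theta>\<in>\<Phi>. \<not> sat S a b \<theta>)"
  using assms unfolding omittable_def by blast+

text \<open>A semantic substitute for having all free variables, of both sorts, below
  \<open>r\<close>; it suits formulas known only up to equivalence in \<open>S\<close>. The
  implication yields an equivalence by exchanging the assignments.\<close>

definition depends_below ::
  "nat \<Rightarrow> ('k, 'm, 'w) two_sorted \<Rightarrow> 'k fm \<Rightarrow> bool"
where
  "depends_below r S \<theta> \<longleftrightarrow> (\<forall>e e' d d'. (\<forall>i<r. e i = e' i \<and> d i = d' i) \<longrightarrow>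
     sat S e d \<theta> \<longrightarrow> sat S e' d' \<theta>)"

lemma depends_belowD:
  assumes "depends_below r S \<theta>" "\<And>i. i < r \<Longrightarrow> e i = e' i" "\<And>i. i < r \<Longrightarrow> d i = d' i"
  shows "sat S e d \<theta> \<longleftrightarrow> sat S e' d' \<theta>"
proof
  show "sat S e' d' \<theta>" if "sat S e d \<theta>"
    using assms that unfolding depends_below_def by blast
  have "\<forall>i<r. e' i = e i \<and> d' i = d i" using assms by simp
  then show "sat S e d \<theta>" if "sat S e' d' \<theta>"
    using assms(1) that unfolding depends_below_def by blast
qed

text \<open>If finitely many formulas of \<Theta> covered \<open>P\<close> with
  \<open>\<phi>\<close> and finitely many covered \<open>P\<close> with its negation, their union
  would cover \<open>P\<close>.\<close>

lemma omittable_decide: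
  assumes P: "P \<in> omittable S \<Theta>"
  shows "\<exists>Q\<in>omittable S \<Theta>. Q \<le> P \<and>
    ((\<forall>a b. Q a b \<longrightarrow> sat S a b \<phi>) \<or> (\<forall>a b. Q a b \<longrightarrow> \<not> sat S a b \<phi>))"
proof (cases "(\<lambda>a b. P a b \<and> sat S a b \<phi>) \<in> omittable S \<Theta>")
  case True
  then show ?thesis by (rule bexI[rotated]) auto
next
  case False
  have defP: "definable S P" by (rule omittableD(1)[OF P])
  then have "definable S (\<lambda>a b. P a b \<and> sat S a b \<phi>)" by (intro definable_conj definable_sat)
  with False obtain \<Phi> where \<Phi>: "finite \<Phi>" "\<Phi> \<subseteq> \<Theta>"
    "\<And>a b. P a b \<Longrightarrow> \<forall>\<theta>\<in>\<Phi>. \<not> sat S a b \<theta> \<Longrightarrow> \<not> sat S a b \<phi>"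
    unfolding omittable_def by blast
  have "(\<lambda>a b. P a b \<and> \<not> sat S a b \<phi>) \<in> omittable S \<Theta>"
  proof (rule omittableI)
    fix \<Psi> assume \<Psi>: "finite \<Psi>" "\<Psi> \<subseteq> \<Theta>"
    obtain a b where "P a b" "\<forall>\<theta>\<in>\<Phi> \<union> \<Psi>. \<not> sat S a b \<theta>"
      using omittableD(2)[OF P, of "\<Phi> \<union> \<Psi>"] \<Phi> \<Psi> by auto
    then show "\<exists>a b. (P a b \<and> \<not> sat S a b \<phi>) \<and> (\<forall>\<theta>\<in>\<Psi>. \<not> sat S a b \<theta>)"
      using \<Phi>(3) by blast
  qed (intro definable_conj definable_not definable_sat defP)
  then show ?thesis by (rule bexI[rotated]) auto
qed

text \<open>The witness is stored in a variable \<open>j\<close> that is free in neither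
  \<open>\<phi>\<close> nor \<open>P\<close> and is at least \<open>r\<close>. Formulas of \<Theta>
  depend only on variables below \<open>r\<close>, so the changed point still avoids them.\<close>

lemma omittable_witness_M:
  fixes S :: "('k, 'm, 'w) two_sorted"
  assumes full: "Mdom S = UNIV" "Wdom S = UNIV"
    and dep: "\<And>\<theta>. \<theta> \<in> \<Theta> \<Longrightarrow> depends_below r S \<theta>"
    and P: "P \<in> omittable S \<Theta>"
  shows "\<exists>Q\<in>omittable S \<Theta>. Q \<le> P \<and>
    (\<exists>j. \<forall>a b. Q a b \<longrightarrow> (\<exists>c. sat S (a(i := c)) b \<phi>) \<longrightarrow> sat S (a(i := a j)) b \<phi>)"
proof -
  obtain \<psi> where \<psi>: "\<And>a b. sat S a b \<psi> \<longleftrightarrow> P a b"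
    using omittableD(1)[OF P] unfolding definable_def by blast
  obtain j where j: "j \<notin> insert i (fmvars \<phi> \<union> fmvars \<psi>)" "r \<le> j"
    using fresh_nat[of "insert i (fmvars \<phi> \<union> fmvars \<psi>)" r] by auto
  let ?Q = "\<lambda>a b. P a b \<and> ((\<exists>c. sat S (a(i := c)) b \<phi>) \<longrightarrow> sat S (a(i := a j)) b \<phi>)"
  have "definable S (\<lambda>a b. sat S (a \<circ> id(i := j)) (b \<circ> id) \<phi>)"
    by (intro definable_rename definable_sat)
  moreover have "a \<circ> id(i := j) = a(i := a j)" for a :: "nat \<Rightarrow> 'm" by auto
  ultimately have "definable S (\<lambda>a b. sat S (a(i := a j)) b \<phi>)" by simp
  moreover have "definable S (\<lambda>a b. \<exists>c. sat S (a(i := c)) b \<phi>)"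
    by (intro definable_MEx full definable_sat)
  moreover have "definable S P" by (rule omittableD(1)[OF P])
  ultimately have "definable S (\<lambda>a b. P a b \<and> (\<not> (\<exists>c. sat S (a(i := c)) b \<phi>) \<or> sat S (a(i := a j)) b \<phi>))"
    by (intro definable_conj definable_disj definable_not)
  then have defQ: "definable S ?Q" by (simp add: imp_conv_disj)
  have "?Q \<in> omittable S \<Theta>"
  proof (rule omittableI)
    fix \<Psi> assume \<Psi>: "finite \<Psi>" "\<Psi> \<subseteq> \<Theta>"
    obtain a b where ab: "P a b" "\<forall>\<theta>\<in>\<Psi>. \<not> sat S a b \<theta>"
      using omittableD(2)[OF P, of \<Psi>] \<Psi> by auto
    show "\<exists>a b. ?Q a b \<and> (\<forall>\<theta>\<in>\<Psi>. \<not> sat S a b \<theta>)"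
    proof (cases "\<exists>c. sat S (a(i := c)) b \<phi>")
      case True
      then obtain c where c: "sat S (a(i := c)) b \<phi>" by blast
      let ?a = "a(j := c)"
      have "P ?a b"
        using ab(1) unfolding \<psi>[symmetric]
        by (rule iffD1[OF sat_cong, rotated -1]) (use j in auto)
      moreover have "sat S (?a(i := ?a j)) b \<phi>"
        using c by (rule iffD1[OF sat_cong, rotated -1]) (use j in auto)
      moreover have "\<not> sat S ?a b \<theta>" if "\<theta> \<in> \<Psi>" for \<theta>
      proof
        assume "sat S ?a b \<theta>"
        then have "sat S a b \<theta>"
          using that \<Psi>(2) j(2)
            depends_belowD[OF dep[of \<theta>], of ?a a b b] by auto
        with ab(2) that show False by blast
      qed
      ultimately show ?thesis by blast
    next
      case False
      with ab show ?thesis by blast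
    qed
  qed (rule defQ)
  then show ?thesis by (rule bexI[rotated]) auto
qed

lemma omittable_witness_W:
  fixes S :: "('k, 'm, 'w) two_sorted"
  assumes full: "Mdom S = UNIV" "Wdom S = UNIV"
    and dep: "\<And>\<theta>. \<theta> \<in> \<Theta> \<Longrightarrow> depends_below r S \<theta>"
    and P: "P \<in> omittable S \<Theta>"
  shows "\<exists>Q\<in>omittable S \<Theta>. Q \<le> P \<and>
    (\<exists>j. \<forall>a b. Q a b \<longrightarrow> (\<exists>c. sat S a (b(i := c)) \<phi>) \<longrightarrow> sat S a (b(i := b j)) \<phi>)"
proof -
  obtain \<psi> where \<psi>: "\<And>a b. sat S a b \<psi> \<longleftrightarrow> P a b"
    using omittableD(1)[OF P] unfolding definable_def by blast
  obtain j where j: "j \<notin> insert i (fwvars \<phi> \<union> fwvars \<psi>)" "r \<le> j"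
    using fresh_nat[of "insert i (fwvars \<phi> \<union> fwvars \<psi>)" r] by auto
  let ?Q = "\<lambda>a b. P a b \<and> ((\<exists>c. sat S a (b(i := c)) \<phi>) \<longrightarrow> sat S a (b(i := b j)) \<phi>)"
  have "definable S (\<lambda>a b. sat S (a \<circ> id) (b \<circ> id(i := j)) \<phi>)"
    by (intro definable_rename definable_sat)
  moreover have "b \<circ> id(i := j) = b(i := b j)" for b :: "nat \<Rightarrow> 'w" by auto
  ultimately have "definable S (\<lambda>a b. sat S a (b(i := b j)) \<phi>)" by simp
  moreover have "definable S (\<lambda>a b. \<exists>c. sat S a (b(i := c)) \<phi>)"
    by (intro definable_WEx full definable_sat)
  moreover have "definable S P" by (rule omittableD(1)[OF P])
  ultimately have "definable S (\<lambda>a b. P a b \<and> (\<not> (\<exists>c. sat S a (b(i := c)) \<phi>) \<or> sat S a (b(i := b j)) \<phi>))"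
    by (intro definable_conj definable_disj definable_not)
  then have defQ: "definable S ?Q" by (simp add: imp_conv_disj)
  have "?Q \<in> omittable S \<Theta>"
  proof (rule omittableI)
    fix \<Psi> assume \<Psi>: "finite \<Psi>" "\<Psi> \<subseteq> \<Theta>"
    obtain a b where ab: "P a b" "\<forall>\<theta>\<in>\<Psi>. \<not> sat S a b \<theta>"
      using omittableD(2)[OF P, of \<Psi>] \<Psi> by auto
    show "\<exists>a b. ?Q a b \<and> (\<forall>\<theta>\<in>\<Psi>. \<not> sat S a b \<theta>)"
    proof (cases "\<exists>c. sat S a (b(i := c)) \<phi>")
      case True
      then obtain c where c: "sat S a (b(i := c)) \<phi>" by blast
      let ?b = "b(j := c)"
      have "P a ?b"
        using ab(1) unfolding \<psi>[symmetric]
        by (rule iffD1[OF sat_cong, rotated -1]) (use j in auto)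
      moreover have "sat S a (?b(i := ?b j)) \<phi>"
        using c by (rule iffD1[OF sat_cong, rotated -1]) (use j in auto)
      moreover have "\<not> sat S a ?b \<theta>" if "\<theta> \<in> \<Psi>" for \<theta>
      proof
        assume "sat S a ?b \<theta>"
        then have "sat S a b \<theta>"
          using that \<Psi>(2) j(2)
            depends_belowD[OF dep[of \<theta>], of a a ?b b] by auto
        with ab(2) that show False by blast
      qed
      ultimately show ?thesis by blast
    next
      case False
      with ab show ?thesis by blast
    qed
  qed (rule defQ)
  then show ?thesis by (rule bexI[rotated]) auto
qed

text \<open>The extra requirements \<open>D\<close> are what later makes a model omit a type, while
  the choice of \<Theta> makes one realise it.\<close>

lemma generic_chain_exists:
  fixes S :: "('k::countable, 'm, 'w) two_sorted"
  assumes full: "Mdom S = UNIV" "Wdom S = UNIV"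
    and dep: "\<And>\<theta>. \<theta> \<in> \<Theta> \<Longrightarrow> depends_below r S \<theta>"
    and pos: "(\<lambda>a b. True) \<in> omittable S \<Theta>"
    and D: "countable D" "\<And>R P. R \<in> D \<Longrightarrow> P \<in> omittable S \<Theta> \<Longrightarrow> \<exists>Q\<in>omittable S \<Theta>. Q \<le> P \<and> R Q"
  shows "\<exists>G. generic_chain S G \<and> (\<forall>n. G n \<in> omittable S \<Theta>) \<and> (\<forall>R\<in>D. \<exists>n. R (G n))"
proof -
  let ?C = "omittable S \<Theta>"
  define dec where "dec \<phi> P \<longleftrightarrow> (\<forall>a b. P a b \<longrightarrow> sat S a b \<phi>) \<or> (\<forall>a b. P a b \<longrightarrow> \<not> sat S a b \<phi>)"
    for \<phi> and P :: "(nat \<Rightarrow> 'm) \<Rightarrow> (nat \<Rightarrow> 'w) \<Rightarrow> bool"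
  define wM where "wM = (\<lambda>(i, \<phi>) P. \<exists>j. \<forall>a b. P a b \<longrightarrow> (\<exists>c. sat S (a(i := c)) b \<phi>) \<longrightarrow> sat S (a(i := a j)) b \<phi>)"
  define wW where "wW = (\<lambda>(i, \<phi>) P. \<exists>j. \<forall>a b. P a b \<longrightarrow> (\<exists>c. sat S a (b(i := c)) \<phi>) \<longrightarrow> sat S a (b(i := b j)) \<phi>)"
  have dense_dec: "\<exists>Q\<in>?C. Q \<le> P \<and> dec \<phi> Q" if "P \<in> ?C" for \<phi> P
    unfolding dec_def by (rule omittable_decide[OF that])
  have dense_wM: "\<exists>Q\<in>?C. Q \<le> P \<and> wM (i, \<phi>) Q" if "P \<in> ?C" for i \<phi> P
    unfolding wM_def prod.case by (rule omittable_witness_M[OF full dep that])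
  have dense_wW: "\<exists>Q\<in>?C. Q \<le> P \<and> wW (i, \<phi>) Q" if "P \<in> ?C" for i \<phi> P
    unfolding wW_def prod.case by (rule omittable_witness_W[OF full dep that])
  \<comment> \<open>Countability of \<open>'k\<close> enters here, through the countability of the
    set of formulas.\<close>
  have cnt: "countable (D \<union> range dec \<union> range wM \<union> range wW)"
    using D(1) by simp
  have dense: "\<exists>Q\<in>?C. Q \<le> P \<and> R Q"
    if "R \<in> D \<union> range dec \<union> range wM \<union> range wW" "P \<in> ?C" for R P
  proof -
    from that(1) consider "R \<in> D" | \<phi> where "R = dec \<phi>" | i \<phi> where "R = wM (i, \<phi>)"
      | i \<phi> where "R = wW (i, \<phi>)" by auto
    then show ?thesis
    proof cases
      case 1
      then show ?thesis by (rule D(2)[OF _ that(2)])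
    qed (use dense_dec[OF that(2)] dense_wM[OF that(2)] dense_wW[OF that(2)] in \<open>simp_all only:\<close>)
  qed
  have "\<exists>G. (\<forall>n. G n \<in> ?C) \<and> (\<forall>n. G (Suc n) \<le> G n) \<and>
    (\<forall>R\<in>D \<union> range dec \<union> range wM \<union> range wW. \<exists>n. R (G n))"
    by (rule rasiowa_sikorski[OF cnt pos]) (rule dense)
  then obtain G where "\<forall>n. G n \<in> ?C" "\<forall>n. G (Suc n) \<le> G n"
    "\<forall>R\<in>D \<union> range dec \<union> range wM \<union> range wW. \<exists>n. R (G n)"
    by (elim exE conjE)
  then have G: "G n \<in> ?C" "G (Suc n) \<le> G n"
    "R \<in> D \<union> range dec \<union> range wM \<union> range wW \<Longrightarrow> \<exists>n. R (G n)" for n R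
    by simp_all
  show ?thesis
  proof (intro exI[of _ G] conjI allI ballI)
    show "generic_chain S G"
    proof
      show "\<exists>a b. G n a b" for n
        using omittableD(2)[OF G(1), of "{}" n] by simp
      show "\<exists>n. (\<forall>a b. G n a b \<longrightarrow> sat S a b \<phi>) \<or> (\<forall>a b. G n a b \<longrightarrow> \<not> sat S a b \<phi>)" for \<phi>
        using G(3)[of "dec \<phi>"] by (simp add: dec_def)
      show "\<exists>n j. \<forall>a b. G n a b \<longrightarrow> (\<exists>c. sat S (a(i := c)) b \<phi>) \<longrightarrow> sat S (a(i := a j)) b \<phi>" for i \<phi>
      proof -
        have "\<exists>n. wM (i, \<phi>) (G n)" by (rule G(3)) simp
        then show ?thesis by (simp only: wM_def prod.case)
      qed
      show "\<exists>n j. \<forall>a b. G n a b \<longrightarrow> (\<exists>c. sat S a (b(i := c)) \<phi>) \<longrightarrow> sat S a (b(i := b j)) \<phi>" for i \<phi>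
      proof -
        have "\<exists>n. wW (i, \<phi>) (G n)" by (rule G(3)) simp
        then show ?thesis by (simp only: wW_def prod.case)
      qed
    qed (use full G(2) in auto)
    show "\<exists>n. R (G n)" if "R \<in> D" for R using G(3) that by blast
    show "G n \<in> ?C" for n by (rule G(1))
  qed
qed

text \<open>
  The instance of the Ryll-Nardzewski theorem for increasing chains.  If the chain does not
  stabilise, some tuple of some countable model lies in the boundary of its union (in no member
  of the chain and in no definable set disjoint from the chain), while another countable model
  omits this boundary.
\<close>

lemma aleph0_categorical_chain_stabilises:
  fixes S :: "('k::countable, 'm, 'w) two_sorted" and \<psi> :: "nat \<Rightarrow> 'k fm"
  assumes full: "Mdom S = UNIV" "Wdom S = UNIV"
    and inf: "infinite (UNIV :: 'm set)"
    and cat: "aleph0_categorical S"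
    and dep: "\<And>n. depends_below r S (\<psi> n)"
    and inc: "\<And>n m e d. n \<le> m \<Longrightarrow> sat S e d (\<psi> n) \<Longrightarrow> sat S e d (\<psi> m)"
  shows "\<exists>B. \<forall>n e d. sat S e d (\<psi> n) \<longrightarrow> sat S e d (\<psi> B)"
proof (rule ccontr)
  assume unstable: "\<not> ?thesis"
  \<comment> \<open>An assignment satisfying no formula of \<Theta> is a boundary point: outside
    every \<open>\<psi> n\<close>, and outside every set definable in the first \<open>r\<close>
    variables and disjoint from the chain.\<close>
  define \<Theta> where "\<Theta> = range \<psi> \<union>
    {\<chi>. depends_below r S \<chi> \<and> (\<forall>n e d. sat S e d \<chi> \<longrightarrow> \<not> sat S e d (\<psi> n))}"
  have dep\<Theta>: "depends_below r S \<theta>" if "\<theta> \<in> \<Theta>" for \<theta>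
    using that dep unfolding \<Theta>_def by blast
  have pos: "(\<lambda>a b. True) \<in> omittable S \<Theta>"
    unfolding omittable_def
  proof (intro CollectI conjI allI impI)
    fix \<Phi> assume \<Phi>: "finite \<Phi>" "\<Phi> \<subseteq> \<Theta>"
    then obtain I where I: "finite I" "\<Phi> \<inter> range \<psi> = \<psi> ` I"
      using finite_subset_image[of "\<Phi> \<inter> range \<psi>" \<psi> UNIV] by auto
    \<comment> \<open>A point that enters the chain only after all the \<open>\<psi> m\<close> in
      \<open>\<Phi>\<close>; being in the chain, it avoids the sets disjoint from it. Inserting
      \<open>0\<close> covers the case of empty \<open>I\<close>.\<close>
    obtain n e d where n: "sat S e d (\<psi> n)" "\<not> sat S e d (\<psi> (Max (insert 0 I)))"
      using unstable by blast
    have "\<not> sat S e d \<theta>" if "\<theta> \<in> \<Phi>" for \<theta>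
    proof (cases "\<theta> \<in> range \<psi>")
      case True
      then obtain m where "m \<in> I" "\<theta> = \<psi> m" using I(2) \<open>\<theta> \<in> \<Phi>\<close> by blast
      then show ?thesis using inc[of m "Max (insert 0 I)"] n(2) I(1) by auto
    next
      case False
      then show ?thesis using n(1) \<Phi>(2) that unfolding \<Theta>_def by blast
    qed
    then show "\<exists>a b. True \<and> (\<forall>\<theta>\<in>\<Phi>. \<not> sat S a b \<theta>)" by blast
  qed (rule definable_const)
  have "\<exists>G. generic_chain S G \<and> (\<forall>n. G n \<in> omittable S \<Theta>) \<and> (\<forall>R\<in>{}. \<exists>n. R (G n))"
    by (rule generic_chain_exists[OF full dep\<Theta> pos]) simp_all
  then obtain G where "generic_chain S G" and G: "\<forall>n. G n \<in> omittable S \<Theta>"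
    by (elim exE conjE)
  interpret A: generic_chain S G by fact
  \<comment> \<open>The tuple of all representatives is a boundary point: a condition of the chain
    forcing \<open>\<theta>\<close> would be covered by \<open>{\<theta>}\<close>.\<close>
  have realised: "\<not> sat A.model A.rM A.rW \<theta>" if "\<theta> \<in> \<Theta>" for \<theta>
  proof
    assume "sat A.model A.rM A.rW \<theta>"
    then have "A.large (\<lambda>a b. sat S a b \<theta>)"
      using A.sat_model[of id id \<theta>] by simp
    then obtain n where "\<And>a b. G n a b \<Longrightarrow> sat S a b \<theta>" unfolding A.large_def by blast
    then show False using omittableD(2)[of "G n" S \<Theta> "{\<theta>}"] G that by auto
  qed
  \<comment> \<open>Formulas of \<Theta> see only the first \<open>r\<close> values, so finite
    lists, continued by \<open>0\<close>, code enough tuples of variables. This leaves countably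
    many requirements \<open>req\<close>, each asking that the coded tuple be put into a set of
    \<Theta>.\<close>
  define asg where "asg l i = (if i < length l then l ! i else 0)" for l :: "nat list" and i
  define req where "req = (\<lambda>(l, l') P. \<exists>\<theta>\<in>\<Theta>. \<forall>a b. P a b \<longrightarrow> sat S (a \<circ> asg l) (b \<circ> asg l') \<theta>)"
  \<comment> \<open>For the empty set of formulas, the conditions are the nonempty definable
    relations. Either some point of \<open>P\<close> has its coded tuple in the chain, and
    \<open>P\<close> is shrunk accordingly, or the projection of \<open>P\<close> to the coded tuple
    is itself a set of \<Theta>.\<close>
  have "\<exists>Q\<in>omittable S {}. Q \<le> P \<and> req (l, l') Q" if P: "P \<in> omittable S {}" for P l l'
  proof -
    have defP: "definable S P" using P by (simp add: omittable_def)
    let ?e = "asg l" and ?d = "asg l'"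
    show ?thesis
    proof (cases "\<exists>n a b. P a b \<and> sat S (a \<circ> ?e) (b \<circ> ?d) (\<psi> n)")
      case True
      then obtain n where n: "\<exists>a b. P a b \<and> sat S (a \<circ> ?e) (b \<circ> ?d) (\<psi> n)" by blast
      then have "(\<lambda>a b. P a b \<and> sat S (a \<circ> ?e) (b \<circ> ?d) (\<psi> n)) \<in> omittable S {}"
        unfolding omittable_def
        by (auto intro!: definable_conj defP definable_rename[of S "\<lambda>a b. sat S a b (\<psi> n)"] definable_sat)
      then show ?thesis
        by (rule bexI[rotated]) (auto simp: req_def \<Theta>_def)
    next
      case False
      \<comment> \<open>The projection is to be defined in the variables below \<open>r\<close>; the
        variables of \<open>P\<close> are shifted by \<open>r\<close> to make room, and position
        \<open>i\<close> is tied to the shifted variable \<open>?e i\<close> or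
        \<open>?d i\<close>.\<close>
      define E where "E a b \<longleftrightarrow> P (a \<circ> (+) r) (b \<circ> (+) r) \<and>
        (\<forall>i\<in>{..<r}. a i = a (r + ?e i) \<and> b i = b (r + ?d i))" for a b
      have "definable S (\<lambda>a b. a i = a j)" "definable S (\<lambda>a b. b i = b j)" for i j
        using definable_sat[of S "MEq (MVar i) (MVar j)"] definable_sat[of S "WEq (WVar i) (WVar j)"]
        by simp_all
      then have "definable S E"
        unfolding E_def
        by (intro definable_conj definable_ball definable_rename[of S P] defP) auto
      from definable_project[OF full this, of "{..<r}" "{..<r}", unfolded definable_def]
      obtain \<chi> where "\<forall>e d. sat S e d \<chi> \<longleftrightarrow>
        (\<exists>e' d'. (\<forall>i\<in>{..<r}. e' i = e i) \<and> (\<forall>i\<in>{..<r}. d' i = d i) \<and> E e' d')" ..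
      then have \<chi>: "sat S e d \<chi> \<longleftrightarrow>
        (\<exists>e' d'. (\<forall>i\<in>{..<r}. e' i = e i) \<and> (\<forall>i\<in>{..<r}. d' i = d i) \<and> E e' d')" for e d
        by simp
      have dep\<chi>: "depends_below r S \<chi>"
        unfolding depends_below_def
      proof (intro allI impI)
        fix e e' d d' assume eq: "\<forall>i<r. e i = e' i \<and> d i = d' i" and "sat S e d \<chi>"
        then obtain e1 d1 where "\<forall>i\<in>{..<r}. e1 i = e i" "\<forall>i\<in>{..<r}. d1 i = d i" "E e1 d1"
          unfolding \<chi> by blast
        then show "sat S e' d' \<chi>"
          unfolding \<chi> using eq by (intro exI[of _ e1] exI[of _ d1]) simp
      qed
      have "\<not> sat S e d (\<psi> n)" if sat: "sat S e d \<chi>" for n e d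
      proof -
        obtain e' d' where ed: "\<forall>i\<in>{..<r}. e' i = e i" "\<forall>i\<in>{..<r}. d' i = d i" "E e' d'"
          using sat unfolding \<chi> by blast
        then have "\<not> sat S (e' \<circ> (+) r \<circ> ?e) (d' \<circ> (+) r \<circ> ?d) (\<psi> n)"
          using False unfolding E_def by blast
        moreover have "sat S (e' \<circ> (+) r \<circ> ?e) (d' \<circ> (+) r \<circ> ?d) (\<psi> n) \<longleftrightarrow> sat S e d (\<psi> n)"
          by (rule depends_belowD[OF dep]) (use ed in \<open>auto simp: E_def\<close>)
        ultimately show ?thesis by blast
      qed
      with dep\<chi> have "\<chi> \<in> \<Theta>" unfolding \<Theta>_def by blast
      moreover have "sat S (a \<circ> ?e) (b \<circ> ?d) \<chi>" if "P a b" for a b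
      proof -
        \<comment> \<open>The given point of \<open>P\<close> is moved up by \<open>r\<close>, with
          its coded tuple placed in front.\<close>
        let ?a = "\<lambda>i. if i < r then a (?e i) else a (i - r)"
        let ?b = "\<lambda>i. if i < r then b (?d i) else b (i - r)"
        have "?a \<circ> (+) r = a" "?b \<circ> (+) r = b" by auto
        then have "E ?a ?b" unfolding E_def using that by auto
        then show ?thesis unfolding \<chi> by (intro exI[of _ ?a] exI[of _ ?b]) auto
      qed
      ultimately show ?thesis using P by (intro bexI[of _ P]) (auto simp: req_def)
    qed
  qed
  then have dense: "\<exists>Q\<in>omittable S {}. Q \<le> P \<and> R Q"
    if "R \<in> range req" "P \<in> omittable S {}" for R P
    using that by force
  have pos': "(\<lambda>a b. True) \<in> omittable S {}"
    by (rule omittableI) (auto intro: definable_const)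
  have dep': "depends_below r S \<theta>" if "\<theta> \<in> {}" for \<theta>
    using that by simp
  have "countable (range req)" by simp
  then have "\<exists>G. generic_chain S G \<and> (\<forall>n. G n \<in> omittable S {}) \<and> (\<forall>R\<in>range req. \<exists>n. R (G n))"
    by (intro generic_chain_exists[OF full, of "{}" r "range req"]) (rule dep' pos' dense | assumption)+
  then obtain G' where "generic_chain S G'" and "\<forall>R\<in>range req. \<exists>n. R (G' n)"
    by (elim exE conjE)
  then have G': "\<exists>n. req (l, l') (G' n)" for l l'
    by simp
  interpret B: generic_chain S G' by fact
  have omitted: "\<exists>\<theta>\<in>\<Theta>. sat B.model e d \<theta>"
    if ed: "range e \<subseteq> Mdom B.model" "range d \<subseteq> Wdom B.model" for e d
  proof -
    let ?l = "map e [0..<r]" and ?l' = "map d [0..<r]"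
    obtain \<theta> where \<theta>: "\<theta> \<in> \<Theta>" "B.large (\<lambda>a b. sat S (a \<circ> asg ?l) (b \<circ> asg ?l') \<theta>)"
      using G'[of ?l ?l'] unfolding req_def B.large_def prod.case by blast
    have "sat S (a \<circ> asg ?l) (b \<circ> asg ?l') \<theta> \<longleftrightarrow> sat S (a \<circ> e) (b \<circ> d) \<theta>" for a b
      by (rule depends_belowD[OF dep\<Theta>[OF \<theta>(1)]]) (auto simp: asg_def)
    then have "sat B.model e d \<theta>"
      using \<theta>(2) B.sat_model_range[OF ed] by simp
    with \<theta>(1) show ?thesis by blast
  qed
  have "isomorphic A.model B.model"
    using cat A.models_model B.models_model A.infinite_Mdom_model[OF inf] B.infinite_Mdom_model[OF inf]
    unfolding aleph0_categorical_def aleph0_categorical_theory_def by blast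
  then obtain f g where f: "\<And>a. a \<in> Mdom A.model \<Longrightarrow> f a \<in> Mdom B.model"
    and g: "\<And>a. a \<in> Wdom A.model \<Longrightarrow> g a \<in> Wdom B.model"
    and sat: "\<And>e d \<phi>. range e \<subseteq> Mdom A.model \<Longrightarrow> range d \<subseteq> Wdom A.model \<Longrightarrow>
      sat B.model (f \<circ> e) (g \<circ> d) \<phi> \<longleftrightarrow> sat A.model e d \<phi>"
    by (rule isomorphic_sat[OF A.is_structure_model]) (rule that)
  \<comment> \<open>The isomorphic image of the boundary point of the first model would be one in
    the second, which has none.\<close>
  have "range (f \<circ> A.rM) \<subseteq> Mdom B.model" "range (g \<circ> A.rW) \<subseteq> Wdom B.model"
    using f g by (auto simp: A.model_sel(1,2))
  then obtain \<theta> where "\<theta> \<in> \<Theta>" "sat B.model (f \<circ> A.rM) (g \<circ> A.rW) \<theta>"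
    using omitted by blast
  then show False
    using sat[of A.rM A.rW \<theta>] realised by (simp add: A.model_sel(1,2))
qed

section \<open>Exterior squares over finite fields\<close>

lemma card_eq_card_fibre_times_card_image:
  assumes "finite V" "\<And>y. y \<in> g ` V \<Longrightarrow> card {x \<in> V. g x = y} = c"
  shows "card V = c * card (g ` V)"
proof -
  have "card V = (\<Sum>y\<in>g ` V. card {x \<in> V. g x = y})"
    using sum.image_gen[OF assms(1), of "\<lambda>_. 1::nat" g] by simp
  also have "\<dots> = (\<Sum>y\<in>g ` V. c)" by (rule sum.cong[OF refl assms(2)])
  finally show ?thesis by simp
qed

text \<open>The ambient space may have infinite dimension. Statements about finite subspaces are
  reduced to counting by \<open>card V = CARD('k) ^ dim V\<close>.\<close>

locale finite_field_vector_space = vector_space scale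
  for scale :: "'k::{field, finite} \<Rightarrow> 'v::ab_group_add \<Rightarrow> 'v"
begin

lemma card_field_gt_1: "1 < CARD('k)"
proof -
  have "card {0, 1 :: 'k} \<le> CARD('k)" by (rule card_mono) auto
  then show ?thesis by simp
qed

lemma card_span_independent:
  assumes "finite B" "independent B"
  shows "card (span B) = CARD('k) ^ card B"
  using assms
proof (induction B rule: finite_induct)
  case empty
  then show ?case by simp
next
  case (insert x B)
  then have B: "independent B" and x: "x \<notin> span B"
    by (simp_all add: independent_insert split: if_splits)
  let ?f = "\<lambda>(c, v). scale c x + v"
  have "bij_betw ?f (UNIV \<times> span B) (span (insert x B))"
    unfolding bij_betw_def
  proof
    show "inj_on ?f (UNIV \<times> span B)"
    proof (rule inj_onI, clarify)
      fix c v d w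
      assume vw: "v \<in> span B" "w \<in> span B" and eq: "scale c x + v = scale d x + w"
      then have "scale (c - d) x = w - v" by (simp add: scale_left_diff_distrib algebra_simps)
      then have "scale (c - d) x \<in> span B" using vw by (simp add: span_diff)
      then have "scale (inverse (c - d)) (scale (c - d) x) \<in> span B" by (rule span_scale)
      then have "c = d" using x by (cases "c = d") simp_all
      then show "c = d \<and> v = w" using eq by simp
    qed
    show "?f ` (UNIV \<times> span B) = span (insert x B)"
    proof (intro equalityI subsetI)
      fix y assume "y \<in> span (insert x B)"
      then obtain c where "y - scale c x \<in> span B" unfolding span_insert by blast
      then show "y \<in> ?f ` (UNIV \<times> span B)"
        by (intro image_eqI[of _ _ "(c, y - scale c x)"]) auto
    next
      fix y assume "y \<in> ?f ` (UNIV \<times> span B)"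
      then obtain c v where "v \<in> span B" "y = scale c x + v" by auto
      then have "y - scale c x \<in> span B" by simp
      then show "y \<in> span (insert x B)" unfolding span_insert by blast
    qed
  qed
  from bij_betw_same_card[OF this] show ?case
    using insert.IH[OF B] insert.hyps by (simp add: card_cartesian_product)
qed

lemma finite_span: "finite S \<Longrightarrow> finite (span S)"
proof -
  assume S: "finite S"
  obtain B where B: "B \<subseteq> S" "independent B" "S \<subseteq> span B"
    using maximal_independent_subset[of S] by auto
  have "finite B" using B(1) S finite_subset by blast
  then have "card (span B) > 0" using card_span_independent[OF _ B(2)] card_field_gt_1 by simp
  moreover have "span B = span S"
    using span_mono[OF B(1)] span_minimal[OF B(3)] by simp
  ultimately show "finite (span S)" using card_ge_0_finite by metis
qed

lemma card_finite_subspace: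
  assumes "subspace V" "finite V"
  shows "card V = CARD('k) ^ dim V"
proof -
  obtain B where B: "B \<subseteq> V" "independent B" "V \<subseteq> span B" "card B = dim V"
    using basis_exists by blast
  moreover have "span B = V" using B span_minimal[OF B(1) assms(1)] by blast
  ultimately show ?thesis
    using card_span_independent[of B] finite_subset[OF B(1) assms(2)] by simp
qed

lemma dim_mono_finite:
  assumes "subspace A" "subspace B" "finite B" "A \<subseteq> B"
  shows "dim A \<le> dim B"
proof -
  have "CARD('k) ^ dim A \<le> CARD('k) ^ dim B"
    using card_mono[OF assms(3,4)] assms finite_subset[OF assms(4,3)]
    by (simp add: card_finite_subspace)
  then show ?thesis using card_field_gt_1 by simp
qed

lemma subspace_eq_of_dim_le:
  assumes "subspace A" "subspace B" "finite B" "A \<subseteq> B" "dim B \<le> dim A"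
  shows "A = B"
proof -
  have "dim A = dim B" using dim_mono_finite[OF assms(1-4)] assms(5) by simp
  then have "card A = card B"
    using assms finite_subset[OF assms(4,3)] by (simp add: card_finite_subspace)
  then show ?thesis using card_subset_eq[OF assms(3,4)] by simp
qed

text \<open>All fibres of the addition map on \<open>A \<times> B\<close> are translates of
  \<open>A \<inter> B\<close>, embedded antidiagonally.\<close>

lemma dim_sums_Int_finite:
  assumes A: "subspace A" "finite A" and B: "subspace B" "finite B"
  shows "finite {x + y |x y. x \<in> A \<and> y \<in> B}"
    "dim {x + y |x y. x \<in> A \<and> y \<in> B} + dim (A \<inter> B) = dim A + dim B"
proof -
  let ?f = "\<lambda>(x, y). x + y" and ?S = "{x + y |x y. x \<in> A \<and> y \<in> B}"
  have img: "?f ` (A \<times> B) = ?S" by auto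
  show fin: "finite ?S" unfolding img[symmetric] using A(2) B(2) by simp
  have "card (A \<times> B) = card (A \<inter> B) * card (?f ` (A \<times> B))"
  proof (rule card_eq_card_fibre_times_card_image)
    fix s assume "s \<in> ?f ` (A \<times> B)"
    then obtain a b where ab: "a \<in> A" "b \<in> B" "s = a + b" by auto
    have "bij_betw (\<lambda>t. (a + t, b - t)) (A \<inter> B) {x \<in> A \<times> B. ?f x = s}"
    proof (rule bij_betwI[where g = "\<lambda>(x, y). x - a"])
      show "(\<lambda>t. (a + t, b - t)) \<in> A \<inter> B \<rightarrow> {x \<in> A \<times> B. ?f x = s}"
        using ab A(1) B(1) by (auto simp: subspace_add subspace_diff)
      show "(\<lambda>(x, y). x - a) \<in> {x \<in> A \<times> B. ?f x = s} \<rightarrow> A \<inter> B"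
      proof
        fix z assume "z \<in> {x \<in> A \<times> B. ?f x = s}"
        then obtain x y where z: "z = (x, y)" and xy: "x \<in> A" "y \<in> B" "x + y = s" by auto
        then have "x - a = b - y" using ab by (simp add: algebra_simps)
        then show "(case z of (x, y) \<Rightarrow> x - a) \<in> A \<inter> B"
          using subspace_diff[OF A(1) xy(1) ab(1)] subspace_diff[OF B(1) ab(2) xy(2)] z by simp
      qed
    qed (auto simp: ab algebra_simps)
    then show "card {x \<in> A \<times> B. ?f x = s} = card (A \<inter> B)"
      by (rule bij_betw_same_card[symmetric])
  qed (use A(2) B(2) in simp)
  then have "CARD('k) ^ (dim A + dim B) = CARD('k) ^ (dim ?S + dim (A \<inter> B))"
    using A B fin subspace_sums[OF A(1) B(1)] subspace_inter[OF A(1) B(1)]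
    unfolding img by (simp add: card_cartesian_product card_finite_subspace power_add mult.commute)
  then show "dim ?S + dim (A \<inter> B) = dim A + dim B"
    using card_field_gt_1 by simp
qed

end

section \<open>Exterior squares of subspaces\<close>

lemma alternating_bilinearI:
  assumes "vector_space sM" "vector_space sW"
    "\<And>a b c. \<gamma> (a + b) c = \<gamma> a c + \<gamma> b c" "\<And>a b c. \<gamma> a (b + c) = \<gamma> a b + \<gamma> a c"
    "\<And>r a b. \<gamma> (sM r a) b = sW r (\<gamma> a b)" "\<And>r a b. \<gamma> a (sM r b) = sW r (\<gamma> a b)"
    "\<And>a. \<gamma> a a = 0"
  shows "alternating_bilinear sM sW \<gamma>"
  unfolding alternating_bilinear_def
  using assms by (auto simp: Vector_Spaces.linear_iff intro: vector_space_pair.intro)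

locale exterior_square = vector_space scale
  for scale :: "'k::field \<Rightarrow> 'm::ab_group_add \<Rightarrow> 'm"
begin

abbreviation "\<Lambda> \<equiv> ext_square_of scale"
abbreviation "wdg \<equiv> wedge scale"

lemma wedge_simps:
  "wdg (a + b) c = wdg a c + wdg b c" "wdg a (b + c) = wdg a b + wdg a c"
  "wdg (scale r a) b = free_scale r (wdg a b)" "wdg a (scale r b) = free_scale r (wdg a b)"
  "wdg a a = 0"
  using wedge_alternating_bilinear[OF vector_space_axioms]
  by (auto simp: alternating_bilinear_def Vector_Spaces.linear_iff)

lemma wedge_swap: "wdg a b = - wdg b a"
  using wedge_simps(5)[of "a + b"] unfolding wedge_simps(1,2)
  by (simp add: wedge_simps(5) eq_neg_iff_add_eq_0 add.commute)

lemma linear_wedge: "Vector_Spaces.linear scale free_scale (wdg a)"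
  using wedge_alternating_bilinear[OF vector_space_axioms] by (simp add: alternating_bilinear_def)

lemma subspace_ext: "free.subspace (\<Lambda> D)"
  unfolding ext_square_of_def by (rule free.subspace_span)

lemma wedge_in_ext: "a \<in> D \<Longrightarrow> b \<in> D \<Longrightarrow> wdg a b \<in> \<Lambda> D"
  unfolding ext_square_of_def by (rule free.span_base) blast

lemma ext_mono: "D \<subseteq> E \<Longrightarrow> \<Lambda> D \<subseteq> \<Lambda> E"
  unfolding ext_square_of_def by (rule free.span_mono) blast

lemma ext_subset_ext_square: "\<Lambda> D \<subseteq> ext_square scale"
  using ext_mono[of D UNIV] by (simp add: ext_square_of_UNIV)

lemma ext_minimal:
  "free.subspace T \<Longrightarrow> (\<And>a b. a \<in> D \<Longrightarrow> b \<in> D \<Longrightarrow> wdg a b \<in> T) \<Longrightarrow> \<Lambda> D \<subseteq> T"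
  unfolding ext_square_of_def by (rule free.span_minimal) blast+

text \<open>A projection onto \<open>D\<close> that maps \<open>L\<close> into \<open>D \<inter> L\<close> induces a map on the exterior
  square that fixes \<open>\<Lambda> D\<close> and maps \<open>\<Lambda> L\<close> into \<open>\<Lambda> (D \<inter> L)\<close>.\<close>

lemma ext_Int:
  assumes D: "subspace D" and L: "subspace L"
  shows "\<Lambda> D \<inter> \<Lambda> L = \<Lambda> (D \<inter> L)"
proof
  interpret P: vector_space_pair scale scale ..
  obtain B1 where B1: "B1 \<subseteq> D" "independent B1" "D \<subseteq> span B1"
    using maximal_independent_subset[of D] by blast
  \<comment> \<open>A basis of \<open>D\<close> is extended by vectors of \<open>L\<close> only. The
    map \<open>g\<close> kills these, so it moves elements of \<open>L\<close> only by elements of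
    \<open>L\<close>.\<close>
  obtain B where B: "B1 \<subseteq> B" "B \<subseteq> B1 \<union> L" "independent B" "B1 \<union> L \<subseteq> span B"
    using maximal_independent_subset_extend[of B1 "B1 \<union> L"] B1(2) by blast
  obtain g where g: "Vector_Spaces.linear scale scale g" "\<And>b. b \<in> B \<Longrightarrow> g b = (if b \<in> B1 then b else 0)"
    using P.linear_independent_extend[OF B(3), of "\<lambda>b. if b \<in> B1 then b else 0"] by blast
  interpret g: Vector_Spaces.linear scale scale g by fact
  have gD: "g x = x" if "x \<in> D" for x
  proof -
    have "x \<in> span B1" using that B1(3) by blast
    then show ?thesis
      by (rule P.linear_eq_on[OF g(1) linear_ident]) (use g(2) B(1) in auto)
  qed
  have gL: "g x \<in> D \<inter> L" if "x \<in> L" for x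
  proof -
    have "x \<in> span (B1 \<union> (B - B1))" using that B(1,4) by (auto simp: Un_absorb1)
    then obtain d l where x: "x = d + l" and d: "d \<in> span B1" and l: "l \<in> span (B - B1)"
      unfolding span_Un by blast
    have dD: "d \<in> D" using d span_minimal[OF B1(1) D] by blast
    have "l \<in> L" using l span_minimal[OF _ L, of "B - B1"] B(2) by blast
    then have "x - l \<in> L" by (rule subspace_diff[OF L that])
    then have "d \<in> L" unfolding x by simp
    moreover have "g l = 0"
      by (rule g.eq_0_on_span[OF _ l]) (use g(2) in auto)
    ultimately show ?thesis
      unfolding x using dD gD[OF dD] by (simp add: g.add)
  qed
  let ?\<gamma> = "\<lambda>a b. wdg (g a) (g b)"
  have \<gamma>: "alternating_bilinear scale free_scale ?\<gamma>"
    by (rule alternating_bilinearI)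
      (simp_all add: wedge_simps g.add g.scale vector_space_axioms free.vector_space_axioms)
  let ?g = "free_lift free_scale ?\<gamma>"
  interpret G: Vector_Spaces.linear free_scale free_scale ?g
    by (rule linear_free_lift[OF free.vector_space_axioms])
  interpret F: vector_space_pair free_scale free_scale ..
  have gw: "?g (wdg a b) = wdg (g a) (g b)" for a b
    by (rule ext_square_universal[OF \<gamma>])
  show "\<Lambda> D \<inter> \<Lambda> L \<subseteq> \<Lambda> (D \<inter> L)"
  proof
    fix x assume x: "x \<in> \<Lambda> D \<inter> \<Lambda> L"
    have "\<Lambda> D \<subseteq> {x. ?g x = x}"
      by (rule ext_minimal)
        (auto simp: free.subspace_def G.add G.scale gw gD)
    moreover have "\<Lambda> L \<subseteq> {x. ?g x \<in> \<Lambda> (D \<inter> L)}"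
    proof (rule ext_minimal)
      show "free.subspace {x. ?g x \<in> \<Lambda> (D \<inter> L)}"
        using subspace_ext[of "D \<inter> L"] by (auto simp: free.subspace_def G.add G.scale)
    qed (use gL in \<open>auto simp: gw intro!: wedge_in_ext\<close>)
    ultimately have "?g x = x" "?g x \<in> \<Lambda> (D \<inter> L)" using x by blast+
    then show "x \<in> \<Lambda> (D \<inter> L)" by simp
  qed
  show "\<Lambda> (D \<inter> L) \<subseteq> \<Lambda> D \<inter> \<Lambda> L"
    using ext_mono[of "D \<inter> L"] by auto
qed

text \<open>The contraction with a functional that is \<open>1\<close> at \<open>x\<close> and vanishes on \<open>D\<close> recovers \<open>d\<close>
  from \<open>x \<and> d + u\<close>.\<close>

lemma ext_insert:
  assumes D: "subspace D" and x: "x \<notin> D"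
  shows "bij_betw (\<lambda>(d, u). wdg x d + u) (D \<times> \<Lambda> D) (\<Lambda> (span (insert x D)))"
  unfolding bij_betw_def
proof
  interpret P: vector_space_pair scale "(*) :: 'k \<Rightarrow> 'k \<Rightarrow> 'k"
    by unfold_locales (auto simp: algebra_simps)
  obtain B where B: "B \<subseteq> D" "independent B" "D \<subseteq> span B"
    using maximal_independent_subset[of D] by blast
  have spB: "span B = D" using B span_minimal[OF B(1) D] by blast
  then have ind: "independent (insert x B)" using x B(2) by (simp add: independent_insertI)
  obtain \<phi> where \<phi>: "Vector_Spaces.linear scale (*) \<phi>" "\<And>b. b \<in> insert x B \<Longrightarrow> \<phi> b = (if b = x then 1 else 0)"
    using P.linear_independent_extend[OF ind, of "\<lambda>b. if b = x then 1 else 0"] by blast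
  interpret \<phi>: Vector_Spaces.linear scale "(*) :: 'k \<Rightarrow> 'k \<Rightarrow> 'k" \<phi> by fact
  have \<phi>x: "\<phi> x = 1" using \<phi>(2) by simp
  have \<phi>D: "\<phi> d = 0" if "d \<in> D" for d
    using that unfolding spB[symmetric]
    by (rule \<phi>.eq_0_on_span[rotated]) (use \<phi>(2) B(1) x in auto)
  \<comment> \<open>The lift of this map is the contraction with \<open>\<phi>\<close>: it sends
    \<open>wdg x d\<close> to \<open>d\<close>, as \<open>\<phi> x = 1\<close> and
    \<open>\<phi> d = 0\<close>, and it vanishes on \<open>\<Lambda> D\<close>.\<close>
  let ?\<gamma> = "\<lambda>a b. scale (\<phi> a) b - scale (\<phi> b) a"
  have \<gamma>: "alternating_bilinear scale scale ?\<gamma>"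
    by (rule alternating_bilinearI)
      (simp_all add: \<phi>.add \<phi>.scale vector_space_axioms scale_left_distrib scale_right_distrib
        scale_right_diff_distrib algebra_simps)
  let ?i = "free_lift scale ?\<gamma>"
  interpret I: Vector_Spaces.linear free_scale scale ?i
    by (rule linear_free_lift[OF vector_space_axioms])
  have iw: "?i (wdg a b) = ?\<gamma> a b" for a b
    by (rule ext_square_universal[OF \<gamma>])
  have "\<Lambda> D \<subseteq> {u. ?i u = 0}"
    by (rule ext_minimal) (auto simp: free.subspace_def I.add I.scale iw \<phi>D)
  then have i: "?i (wdg x d + u) = d" if "d \<in> D" "u \<in> \<Lambda> D" for d u
    using that by (auto simp: I.add iw \<phi>x \<phi>D)
  show "inj_on (\<lambda>(d, u). wdg x d + u) (D \<times> \<Lambda> D)"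
  proof (rule inj_onI, clarify)
    fix d u d' u' assume du: "d \<in> D" "u \<in> \<Lambda> D" "d' \<in> D" "u' \<in> \<Lambda> D"
      and eq: "wdg x d + u = wdg x d' + u'"
    then have "d = d'" using i[of d u] i[of d' u'] by simp
    then show "d = d' \<and> u = u'" using eq by simp
  qed
  let ?T = "{v + u |v u. v \<in> wdg x ` D \<and> u \<in> \<Lambda> D}"
  have img: "(\<lambda>(d, u). wdg x d + u) ` (D \<times> \<Lambda> D) = ?T" by force
  interpret w: Vector_Spaces.linear scale free_scale "wdg x" by (rule linear_wedge)
  have T: "free.subspace ?T"
    by (rule free.subspace_sums[OF w.subspace_image[OF D] subspace_ext])
  have "\<Lambda> (span (insert x D)) \<subseteq> ?T"
  proof (rule ext_minimal[OF T])
    fix a b assume "a \<in> span (insert x D)" "b \<in> span (insert x D)"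
    then obtain r s where "a - scale r x \<in> D" "b - scale s x \<in> D"
      unfolding span_insert using D by (auto simp: span_eq_iff[THEN iffD2])
    then obtain c d where a: "a = scale r x + c" and b: "b = scale s x + d" and cd: "c \<in> D" "d \<in> D"
      by (metis add.commute diff_add_cancel)
    \<comment> \<open>In the expanded product \<open>wdg x x\<close> vanishes and
      \<open>wdg c x\<close> becomes \<open>- wdg x c\<close>.\<close>
    have "wdg a b = wdg x (scale r d - scale s c) + wdg c d"
      unfolding a b using wedge_swap[of c x]
      by (simp add: wedge_simps w.diff w.scale free.scale_right_distrib)
    moreover have "scale r d - scale s c \<in> D"
      using cd D by (simp add: subspace_diff subspace_scale)
    ultimately show "wdg a b \<in> ?T" using wedge_in_ext[OF cd] by blast
  qed
  moreover have "?T \<subseteq> \<Lambda> (span (insert x D))"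
  proof clarify
    fix d u assume "d \<in> D" "u \<in> \<Lambda> D"
    then have "wdg x d \<in> \<Lambda> (span (insert x D))" "u \<in> \<Lambda> (span (insert x D))"
      using ext_mono[of D "span (insert x D)"] by (auto intro!: wedge_in_ext span_base)
    then show "wdg x d + u \<in> \<Lambda> (span (insert x D))"
      by (rule free.subspace_add[OF subspace_ext])
  qed
  ultimately show "(\<lambda>(d, u). wdg x d + u) ` (D \<times> \<Lambda> D) = \<Lambda> (span (insert x D))"
    unfolding img by blast
qed

lemma ext_zero: "\<Lambda> {0} = {0}"
proof -
  have "{wdg a b |a b. a \<in> {0} \<and> b \<in> {0}} = {0}" using wedge_simps(5) by auto
  then show ?thesis unfolding ext_square_of_def by simp
qed

end

text \<open>Induction along a basis: by \<open>ext_insert\<close>, a vector added to an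
  \<open>n\<close>-dimensional space multiplies the cardinality by that of the space, and
  \<open>n\<close> plus \<open>n choose 2\<close> is \<open>Suc n choose 2\<close>.\<close>

lemma card_ext_square_of:
  fixes scale :: "'k::{field, finite} \<Rightarrow> 'm::ab_group_add \<Rightarrow> 'm"
  assumes "vector_space scale" "module.subspace scale D" "finite D"
  shows "card (ext_square_of scale D) = CARD('k) ^ (vector_space.dim scale D choose 2)"
proof -
  interpret finite_field_vector_space scale
    using assms(1) by (rule finite_field_vector_space.intro)
  interpret exterior_square scale by unfold_locales
  have *: "card (\<Lambda> (span B)) = CARD('k) ^ (card B choose 2)" if "finite B" "independent B" for B
    using that
  proof (induction B rule: finite_induct)
    case empty
    show ?case by (simp add: ext_zero numeral_2_eq_2)
  next
    case (insert x B)
    then have B: "independent B" and x: "x \<notin> span B"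
      by (simp_all add: independent_insert split: if_splits)
    have "span (insert x (span B)) = span (insert x B)"
      unfolding insert_is_Un[of x B] insert_is_Un[of x "span B"] span_Un span_span ..
    then have "card (\<Lambda> (span (insert x B))) = card (span B \<times> \<Lambda> (span B))"
      using bij_betw_same_card[OF ext_insert[OF subspace_span x]] by simp
    also have "\<dots> = CARD('k) ^ card B * CARD('k) ^ (card B choose 2)"
      using insert B by (simp add: card_cartesian_product card_span_independent)
    also have "\<dots> = CARD('k) ^ (card (insert x B) choose 2)"
      using insert.hyps by (simp add: numeral_2_eq_2 power_add)
    finally show ?case .
  qed
  obtain B where B: "B \<subseteq> D" "independent B" "D \<subseteq> span B" "card B = dim D"
    using basis_exists by blast
  moreover have "span B = D" using B span_minimal[OF B(1) assms(2)] by blast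
  ultimately show ?thesis
    using *[of B] finite_subset[OF B(1) assms(3)] by simp
qed

section \<open>Tight subspaces\<close>

context bilinear_Bp
begin

sublocale Mf: finite_field_vector_space scaleM ..
sublocale Ff: finite_field_vector_space
  "free_scale :: 'p mod_ring \<Rightarrow> ('m \<times> 'm \<Rightarrow>\<^sub>0 'p mod_ring) \<Rightarrow> ('m \<times> 'm \<Rightarrow>\<^sub>0 'p mod_ring)" ..
sublocale ext: exterior_square scaleM ..

abbreviation "\<Lambda> \<equiv> ext_square_of scaleM"

lemma one_less_p: "1 < CARD('p)"
  using Mf.card_field_gt_1 by simp

lemma linear_f_beta: "Vector_Spaces.linear free_scale scaleW f_beta"
  unfolding f_beta_def by (rule linear_free_lift[OF W.vector_space_axioms])

sublocale f: Vector_Spaces.linear free_scale scaleW f_beta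
  by (rule linear_f_beta)

lemma f_beta_wedge: "f_beta (wedge scaleM a b) = \<beta> a b"
  unfolding f_beta_def by (rule ext_square_universal[OF alternating])

lemma N_eq: "N D = {x \<in> \<Lambda> D. f_beta x = 0}"
  using ext.ext_subset_ext_square[of D] by (auto simp: N_def N_beta_def)

lemma subspace_N: "free.subspace (N D)"
  using ext.subspace_ext[of D] unfolding N_eq
  by (auto simp: free.subspace_def f.add f.scale)

lemma N_mono: "D \<subseteq> E \<Longrightarrow> N D \<subseteq> N E"
  using ext.ext_mono[of D E] by (auto simp: N_eq)

lemma N_Int: "M.subspace D \<Longrightarrow> M.subspace L \<Longrightarrow> N (D \<inter> L) = N D \<inter> N L"
  using ext.ext_Int[of D L] by (auto simp: N_eq)

lemma card_ext:
  assumes "fin_subspace D"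
  shows "card (\<Lambda> D) = CARD('p) ^ (M.dim D choose 2)"
  using card_ext_square_of[OF M.vector_space_axioms, of D] assms by (simp add: fin_subspace_def)

lemma finite_ext: "fin_subspace D \<Longrightarrow> finite (\<Lambda> D)"
  using card_ext[of D] one_less_p by (intro card_ge_0_finite) simp

lemma finite_N: "fin_subspace D \<Longrightarrow> finite (N D)"
  using finite_ext[of D] by (auto simp: N_eq)

lemma card_fin_subspace: "fin_subspace D \<Longrightarrow> card D = CARD('p) ^ M.dim D"
  using Mf.card_finite_subspace[of D] by (simp add: fin_subspace_def)

definition beta_span :: "'m set \<Rightarrow> 'w set" where
  "beta_span D = f_beta ` \<Lambda> D"

text \<open>The nonempty fibres of \<open>f_beta\<close> on \<open>\<Lambda> D\<close> are cosets of
  \<open>N D\<close>.\<close>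

lemma card_beta_span:
  assumes D: "fin_subspace D"
  shows "CARD('p) ^ (M.dim D choose 2) = CARD('p) ^ free.dim (N D) * card (beta_span D)"
proof -
  have "card (\<Lambda> D) = card (N D) * card (f_beta ` \<Lambda> D)"
  proof (rule card_eq_card_fibre_times_card_image[OF finite_ext[OF D]])
    fix y assume "y \<in> f_beta ` \<Lambda> D"
    then obtain x where x: "x \<in> \<Lambda> D" "y = f_beta x" by blast
    have "bij_betw ((+) x) (N D) {z \<in> \<Lambda> D. f_beta z = y}"
      by (rule bij_betwI[where g = "\<lambda>z. z - x"])
        (use x free.subspace_add[OF ext.subspace_ext] free.subspace_diff[OF ext.subspace_ext] in
          \<open>auto simp: N_eq f.add f.diff\<close>)
    then show "card {z \<in> \<Lambda> D. f_beta z = y} = card (N D)"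
      by (rule bij_betw_same_card[symmetric])
  qed
  then show ?thesis
    using card_ext[OF D] Ff.card_finite_subspace[OF subspace_N finite_N[OF D]]
    by (simp add: beta_span_def)
qed

lemma beta_span_eq: "beta_span D = W.span {\<beta> a b |a b. a \<in> D \<and> b \<in> D}"
proof -
  have "f_beta ` {wedge scaleM a b |a b. a \<in> D \<and> b \<in> D} = {\<beta> a b |a b. a \<in> D \<and> b \<in> D}"
    by (force simp: f_beta_wedge)
  then show ?thesis
    unfolding beta_span_def ext_square_of_def by (simp only: f.span_image[symmetric])
qed

section \<open>Subspaces given by tuples\<close>

lemma beta_linear:
  "\<beta> (a + b) c = \<beta> a c + \<beta> b c" "\<beta> a (b + c) = \<beta> a b + \<beta> a c"
  "\<beta> (scaleM r a) b = scaleW r (\<beta> a b)" "\<beta> a (scaleM r b) = scaleW r (\<beta> a b)"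
  "\<beta> a a = 0"
  using alternating by (auto simp: alternating_bilinear_def Vector_Spaces.linear_iff)

lemma beta_sum:
  fixes g :: "'b \<Rightarrow> 'm" and h :: "'c \<Rightarrow> 'm"
  shows "\<beta> (\<Sum>i\<in>I. scaleM (c i) (g i)) (\<Sum>j\<in>J. scaleM (d j) (h j)) =
    (\<Sum>(i, j)\<in>I \<times> J. scaleW (c i * d j) (\<beta> (g i) (h j)))"
proof -
  have 1: "\<beta> (\<Sum>i\<in>I. f i) b = (\<Sum>i\<in>I. \<beta> (f i) b)" for f :: "'b \<Rightarrow> 'm" and b
  proof -
    interpret l: Vector_Spaces.linear scaleM scaleW "\<lambda>a. \<beta> a b"
      using alternating by (simp add: alternating_bilinear_def)
    show ?thesis by (rule l.sum)
  qed
  have 2: "\<beta> a (\<Sum>j\<in>J. f j) = (\<Sum>j\<in>J. \<beta> a (f j))" for f :: "'c \<Rightarrow> 'm" and a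
  proof -
    interpret r: Vector_Spaces.linear scaleM scaleW "\<beta> a"
      using alternating by (simp add: alternating_bilinear_def)
    show ?thesis by (rule r.sum)
  qed
  have "\<beta> (\<Sum>i\<in>I. scaleM (c i) (g i)) (\<Sum>j\<in>J. scaleM (d j) (h j)) =
      (\<Sum>i\<in>I. \<Sum>j\<in>J. \<beta> (scaleM (c i) (g i)) (scaleM (d j) (h j)))"
    unfolding 1 2 by (rule sum.swap)
  also have "\<dots> = (\<Sum>i\<in>I. \<Sum>j\<in>J. scaleW (c i * d j) (\<beta> (g i) (h j)))"
    by (simp add: beta_linear mult.commute)
  also have "\<dots> = (\<Sum>(i, j)\<in>I \<times> J. scaleW (c i * d j) (\<beta> (g i) (h j)))"
    by (rule sum.cartesian_product)
  finally show ?thesis .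
qed

text \<open>Formulas address subspaces through tuples of variables, so generators are indexed and
  may repeat. Extensional coefficient functions form a finite set, over which a formula can take
  disjunctions.\<close>

lemma span_tuple:
  assumes "finite I"
  shows "M.span (g ` I) = (\<lambda>c. \<Sum>i\<in>I. scaleM (c i) (g i)) ` (I \<rightarrow>\<^sub>E UNIV)" (is "_ = ?R")
proof
  let ?f = "\<lambda>c. \<Sum>i\<in>I. scaleM (c i) (g i)"
  have f: "?f c \<in> ?R" for c
    by (rule image_eqI[of _ _ "restrict c I"]) (auto intro: sum.cong)
  show "M.span (g ` I) \<subseteq> ?R"
  proof (rule M.span_minimal)
    show "g ` I \<subseteq> ?R"
    proof clarify
      fix i assume "i \<in> I"
      then have "g i = ?f (\<lambda>j. if j = i then 1 else 0)"
        using assms by (simp add: if_distrib[of "\<lambda>c. scaleM c _"] cong: if_cong)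
      then show "g i \<in> ?R" using f[of "\<lambda>j. if j = i then 1 else 0"] by (simp only:)
    qed
    show "M.subspace ?R"
    proof (rule M.subspaceI)
      show "0 \<in> ?R" using f[of "\<lambda>_. 0"] by simp
      fix x y assume "x \<in> ?R" "y \<in> ?R"
      then obtain c d where "x = ?f c" "y = ?f d" by blast
      then have "x + y = ?f (\<lambda>i. c i + d i)" by (simp add: M.scale_left_distrib sum.distrib)
      then show "x + y \<in> ?R" using f[of "\<lambda>i. c i + d i"] by (simp only:)
    next
      fix r x assume "x \<in> ?R"
      then obtain c where "x = ?f c" by blast
      then have "scaleM r x = ?f (\<lambda>i. r * c i)" by (simp add: M.scale_sum_right)
      then show "scaleM r x \<in> ?R" using f[of "\<lambda>i. r * c i"] by (simp only:)
    qed
  qed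
  show "?R \<subseteq> M.span (g ` I)"
  proof clarify
    show "?f c \<in> M.span (g ` I)" for c
      by (rule M.span_sum, rule M.span_scale, rule M.span_base) simp
  qed
qed

lemma beta_span_tuple:
  assumes I: "finite I"
  shows "beta_span (M.span (g ` I)) =
    (\<lambda>c. \<Sum>(i, j)\<in>I \<times> I. scaleW (c (i, j)) (\<beta> (g i) (g j))) ` (I \<times> I \<rightarrow>\<^sub>E UNIV)" (is "_ = ?R")
proof
  let ?f = "\<lambda>c. \<Sum>(i, j)\<in>I \<times> I. scaleW (c (i, j)) (\<beta> (g i) (g j))"
  have f: "?f c \<in> ?R" for c
    by (rule image_eqI[of _ _ "restrict c (I \<times> I)"]) (auto intro!: sum.cong)
  show "beta_span (M.span (g ` I)) \<subseteq> ?R"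
    unfolding beta_span_eq
  proof (rule W.span_minimal)
    show "{\<beta> a b |a b. a \<in> M.span (g ` I) \<and> b \<in> M.span (g ` I)} \<subseteq> ?R"
    proof clarify
      fix a b assume "a \<in> M.span (g ` I)" "b \<in> M.span (g ` I)"
      then obtain c d where "a = (\<Sum>i\<in>I. scaleM (c i) (g i))" "b = (\<Sum>i\<in>I. scaleM (d i) (g i))"
        unfolding span_tuple[OF I] by blast
      then have "\<beta> a b = ?f (\<lambda>(i, j). c i * d j)" by (simp add: beta_sum)
      then show "\<beta> a b \<in> ?R" using f[of "\<lambda>(i, j). c i * d j"] by (simp only:)
    qed
    show "W.subspace ?R"
    proof (rule W.subspaceI)
      show "0 \<in> ?R" using f[of "\<lambda>_. 0"] by (simp add: case_prod_unfold)
      fix x y assume "x \<in> ?R" "y \<in> ?R"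
      then obtain c d where "x = ?f c" "y = ?f d" by blast
      then have "x + y = ?f (\<lambda>i. c i + d i)"
        by (simp add: W.scale_left_distrib sum.distrib case_prod_unfold)
      then show "x + y \<in> ?R" using f[of "\<lambda>i. c i + d i"] by (simp only:)
    next
      fix r x assume "x \<in> ?R"
      then obtain c where "x = ?f c" by blast
      then have "scaleW r x = ?f (\<lambda>i. r * c i)" by (simp add: W.scale_sum_right case_prod_unfold)
      then show "scaleW r x \<in> ?R" using f[of "\<lambda>i. r * c i"] by (simp only:)
    qed
  qed
  show "?R \<subseteq> beta_span (M.span (g ` I))"
  proof clarify
    fix c
    have "\<beta> (g i) (g j) \<in> beta_span (M.span (g ` I))" if "i \<in> I" "j \<in> I" for i j
      unfolding beta_span_eq
      by (rule W.span_base) (use that in \<open>blast intro: M.span_base\<close>)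
    then show "?f c \<in> beta_span (M.span (g ` I))"
      unfolding beta_span_eq by (intro W.span_sum) (auto intro: W.span_scale)
  qed
qed

lemma fin_subspace_span: "finite S \<Longrightarrow> fin_subspace (M.span S)"
  unfolding fin_subspace_def by (simp add: Mf.finite_span)

text \<open>A basis is padded with zeros, so that tuples of the fixed length \<open>n\<close> reach
  every subspace of dimension at most \<open>n\<close>.\<close>

lemma fin_subspace_tuple:
  assumes "fin_subspace D" "M.dim D \<le> n"
  obtains g where "D = M.span (g ` {..<n})"
proof -
  obtain B where B: "B \<subseteq> D" "M.independent B" "D \<subseteq> M.span B" "card B = M.dim D"
    using M.basis_exists by blast
  have fin: "finite B" using B(1) assms(1) finite_subset by (auto simp: fin_subspace_def)
  have span: "M.span B = D"
    using B M.span_minimal[OF B(1)] assms(1) by (auto simp: fin_subspace_def)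
  obtain h where h: "bij_betw h {..<card B} B"
    using ex_bij_betw_nat_finite[OF fin] by (auto simp: atLeast0LessThan)
  let ?g = "\<lambda>i. if i < card B then h i else 0"
  have "h ` {..<card B} = B" using h by (simp add: bij_betw_def)
  then have "B \<subseteq> ?g ` {..<n}" "?g ` {..<n} \<subseteq> insert 0 B"
    using assms(2) B(4) by (fastforce, auto)
  then have "M.span (?g ` {..<n}) = M.span B"
    using M.span_mono[of B "?g ` {..<n}"] M.span_mono[of "?g ` {..<n}" "insert 0 B"] by auto
  then show ?thesis using that[of ?g] span by simp
qed

lemma dim_span_tuple: "M.dim (M.span (g ` {..<n})) \<le> n"
proof -
  have "M.dim (M.span (g ` {..<n})) \<le> card (g ` {..<n})"
    by (rule M.dim_le_card) auto
  also have "\<dots> \<le> n" using card_image_le[of "{..<n}" g] by simp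
  finally show ?thesis .
qed

section \<open>Submodularity of the predimension\<close>

definition ssum :: "'m set \<Rightarrow> 'm set \<Rightarrow> 'm set" where
  "ssum D L = {x + y |x y. x \<in> D \<and> y \<in> L}"

lemma ssum_upper: "M.subspace D \<Longrightarrow> M.subspace L \<Longrightarrow> D \<subseteq> ssum D L" "M.subspace D \<Longrightarrow> M.subspace L \<Longrightarrow> L \<subseteq> ssum D L"
  unfolding ssum_def using M.subspace_0 by (force, force)

lemma fin_subspace_ssum: "fin_subspace D \<Longrightarrow> fin_subspace L \<Longrightarrow> fin_subspace (ssum D L)"
  unfolding fin_subspace_def ssum_def
  using M.subspace_sums Mf.dim_sums_Int_finite(1) by blast

lemma fin_subspace_Int: "fin_subspace D \<Longrightarrow> fin_subspace L \<Longrightarrow> fin_subspace (D \<inter> L)"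
  unfolding fin_subspace_def using M.subspace_inter by blast

text \<open>The predimension, scaled by \<open>k\<close> so that it takes integer values.\<close>

definition rho :: "nat \<Rightarrow> 'm set \<Rightarrow> int" where
  "rho k D = int k * int (M.dim D) - int (free.dim (N D))"

lemma delta_eq_rho: "k \<ge> 1 \<Longrightarrow> delta k D = rho k D / k"
  by (simp add: delta_def rho_def field_simps)

text \<open>The dimension is modular, and \<open>N\<close> commutes with intersections by
  \<open>N_Int\<close>. The only possible loss is in the inclusion of \<open>N D + N L\<close> in
  \<open>N (ssum D L)\<close>, so equality of the predimensions makes this inclusion an
  equality.\<close>

lemma rho_submodular:
  assumes D: "fin_subspace D" and L: "fin_subspace L"
  shows "rho k (ssum D L) + rho k (D \<inter> L) \<le> rho k D + rho k L"
    and "rho k (ssum D L) + rho k (D \<inter> L) = rho k D + rho k L \<Longrightarrow>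
      N (ssum D L) = {x + y |x y. x \<in> N D \<and> y \<in> N L}"
proof -
  have sub: "M.subspace D" "M.subspace L" "finite D" "finite L" using D L by (auto simp: fin_subspace_def)
  let ?S = "{x + y |x y. x \<in> N D \<and> y \<in> N L}"
  have dM: "M.dim (ssum D L) + M.dim (D \<inter> L) = M.dim D + M.dim L"
    unfolding ssum_def by (rule Mf.dim_sums_Int_finite(2)) (use sub in auto)
  have dN: "free.dim ?S + free.dim (N (D \<inter> L)) = free.dim (N D) + free.dim (N L)"
    unfolding N_Int[OF sub(1,2)]
    by (rule Ff.dim_sums_Int_finite(2)) (use subspace_N finite_N D L in auto)
  have S: "?S \<subseteq> N (ssum D L)" "free.subspace ?S"
    using N_mono[OF ssum_upper(1)[OF sub(1,2)]] N_mono[OF ssum_upper(2)[OF sub(1,2)]]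
      free.subspace_add[OF subspace_N] free.subspace_sums[OF subspace_N subspace_N]
    by (blast, blast)
  have le: "free.dim ?S \<le> free.dim (N (ssum D L))"
    by (rule Ff.dim_mono_finite[OF S(2) subspace_N finite_N[OF fin_subspace_ssum[OF D L]] S(1)])
  have kM: "int k * int (M.dim (ssum D L)) + int k * int (M.dim (D \<inter> L)) = int k * int (M.dim D) + int k * int (M.dim L)"
    using dM by (metis distrib_left of_nat_add)
  show "rho k (ssum D L) + rho k (D \<inter> L) \<le> rho k D + rho k L"
    unfolding rho_def using kM dN le by linarith
  assume "rho k (ssum D L) + rho k (D \<inter> L) = rho k D + rho k L"
  then have "free.dim (N (ssum D L)) \<le> free.dim ?S"
    unfolding rho_def using kM dN by linarith
  then show "N (ssum D L) = ?S"
    using Ff.subspace_eq_of_dim_le[OF S(2) subspace_N finite_N[OF fin_subspace_ssum[OF D L]] S(1)]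
    by simp
qed

text \<open>By \<open>card_beta_span\<close> the two cardinalities determine \<open>dim D\<close>
  and \<open>dim (N D)\<close>. The predimension is thereby read off from \<open>D\<close> and its
  image in \<open>W\<close>, which formulas can address, without the exterior square.\<close>

lemma rho_eqI:
  assumes "fin_subspace D" "fin_subspace L" "card D = card L" "card (beta_span D) = card (beta_span L)"
  shows "rho k D = rho k L"
proof -
  have "M.dim D = M.dim L"
    using assms one_less_p by (simp add: card_fin_subspace)
  moreover have "card (beta_span L) \<noteq> 0"
    using card_beta_span[OF assms(2)] one_less_p by (metis mult_0_right not_one_less_zero power_eq_0_iff)
  ultimately have "free.dim (N D) = free.dim (N L)"
    using card_beta_span[OF assms(1)] card_beta_span[OF assms(2)] assms(4) one_less_p by simp
  with \<open>M.dim D = M.dim L\<close> show ?thesis by (simp add: rho_def)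
qed

end

section \<open>Tight subspaces and the closure\<close>

locale bounded_bilinear_Bp = bilinear_Bp scaleM scaleW \<beta>
  for scaleM :: "'p::prime_card mod_ring \<Rightarrow> 'm::ab_group_add \<Rightarrow> 'm"
    and scaleW :: "'p mod_ring \<Rightarrow> 'w::ab_group_add \<Rightarrow> 'w"
    and \<beta> :: "'m \<Rightarrow> 'm \<Rightarrow> 'w" +
  fixes k :: nat
  assumes k: "k \<ge> 1" and bounded: "relations_bounded k"
begin

lemma rho_nonneg: "fin_subspace D \<Longrightarrow> 0 \<le> rho k D"
  using bounded unfolding relations_bounded_def rho_def
  by (metis diff_ge_0_iff_ge of_nat_le_iff of_nat_mult)

lemma delta_le_iff: "delta k D \<le> delta k L \<longleftrightarrow> rho k D \<le> rho k L"
  using k by (simp add: delta_eq_rho divide_le_cancel)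

lemma delta_eq_iff: "delta k D = delta k L \<longleftrightarrow> rho k D = rho k L"
  using k by (simp add: delta_eq_rho)

lemma selfsufficient_iff:
  "selfsufficient k D \<longleftrightarrow> fin_subspace D \<and> (\<forall>K. fin_subspace K \<and> D \<subseteq> K \<longrightarrow> rho k D \<le> rho k K)"
  unfolding selfsufficient_def delta_le_iff ..

definition tight :: "'m set \<Rightarrow> 'm set \<Rightarrow> bool" where
  "tight H D \<longleftrightarrow> fin_subspace D \<and> H \<subseteq> D \<and> (\<forall>K. fin_subspace K \<longrightarrow> H \<subseteq> K \<longrightarrow> rho k D \<le> rho k K)"

lemma tightD:
  assumes "tight H D"
  shows "fin_subspace D" "H \<subseteq> D" "M.subspace D" "finite D"
    "fin_subspace K \<Longrightarrow> H \<subseteq> K \<Longrightarrow> rho k D \<le> rho k K"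
  using assms unfolding tight_def fin_subspace_def by auto

lemma tight_rho: "tight H D \<Longrightarrow> tight H E \<Longrightarrow> rho k D = rho k E"
  unfolding tight_def by (meson order_antisym)

lemma tight_iff:
  assumes "tight H D"
  shows "tight H E \<longleftrightarrow> fin_subspace E \<and> H \<subseteq> E \<and> rho k E \<le> rho k D"
  using assms unfolding tight_def by (meson order_trans)

lemma tight_selfsufficient: "tight H D \<Longrightarrow> selfsufficient k D"
  unfolding tight_def selfsufficient_iff by blast

text \<open>A minimum exists because \<open>rho\<close> takes integer values that are nonnegative by
  the bound on relations.\<close>

lemma tight_exists:
  assumes "fin_subspace H"
  shows "\<exists>D. tight H D"
proof -
  let ?P = "\<lambda>D. fin_subspace D \<and> H \<subseteq> D"
  have "\<exists>D. ?P D \<and> (\<forall>K. ?P K \<longrightarrow> nat (rho k D) \<le> nat (rho k K))"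
    by (rule ex_has_least_nat[of ?P H]) (use assms in blast)
  then obtain D where D: "?P D" "\<And>K. ?P K \<Longrightarrow> nat (rho k D) \<le> nat (rho k K)" by blast
  have "rho k D \<le> rho k K" if "?P K" for K
    using D(2)[OF that] rho_nonneg[of K] rho_nonneg[of D] that D(1) by linarith
  then show ?thesis using D(1) unfolding tight_def by blast
qed

text \<open>Intersection and sum both contain \<open>H\<close>, so neither has predimension below
  the minimum. Submodularity then forces equality throughout.\<close>

lemma tight_closed:
  assumes D: "tight H D" and E: "tight H E"
  shows "tight H (D \<inter> E)" "tight H (ssum D E)"
    "N (ssum D E) = {x + y |x y. x \<in> N D \<and> y \<in> N E}"
proof -
  have fin: "fin_subspace (D \<inter> E)" "fin_subspace (ssum D E)"
    using tightD(1)[OF D] tightD(1)[OF E] by (simp_all add: fin_subspace_Int fin_subspace_ssum)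
  have H: "H \<subseteq> D \<inter> E" "H \<subseteq> ssum D E"
    using tightD(2)[OF D] tightD(2)[OF E] ssum_upper(1)[OF tightD(3)[OF D] tightD(3)[OF E]] by auto
  have eq: "rho k E = rho k D" by (rule tight_rho[OF E D])
  have ge: "rho k D \<le> rho k (D \<inter> E)" "rho k D \<le> rho k (ssum D E)"
    using tightD(5)[OF D] fin H by blast+
  have le: "rho k (ssum D E) + rho k (D \<inter> E) \<le> rho k D + rho k E"
    by (rule rho_submodular(1)[OF tightD(1)[OF D] tightD(1)[OF E]])
  show "tight H (D \<inter> E)" "tight H (ssum D E)"
    unfolding tight_iff[OF D] using fin H eq ge le by auto
  show "N (ssum D E) = {x + y |x y. x \<in> N D \<and> y \<in> N E}"
    by (rule rho_submodular(2)[OF tightD(1)[OF D] tightD(1)[OF E], of k]) (use eq ge le in linarith)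
qed

text \<open>\<open>CSS k H\<close> is the tight subspace \<open>D\<close> of least cardinality. For
  selfsufficient \<open>K\<close> containing \<open>H\<close>, submodularity gives
  \<open>rho k (D \<inter> K) \<le> rho k D\<close>, so \<open>D \<inter> K\<close> is tight and
  equals \<open>D\<close>; and \<open>D\<close> itself is selfsufficient.\<close>

lemma CSS_tight:
  assumes H: "fin_subspace H"
  shows "tight H (CSS k H)"
proof -
  obtain D where D: "tight H D" "\<And>E. tight H E \<Longrightarrow> card D \<le> card E"
    using ex_has_least_nat[of "tight H" _ card] tight_exists[OF H] by metis
  have "D \<subseteq> K" if K: "selfsufficient k K" "H \<subseteq> K" for K
  proof -
    have finK: "fin_subspace K" using K(1) by (simp add: selfsufficient_iff)
    then have sK: "M.subspace K" by (simp add: fin_subspace_def)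
    have "rho k K \<le> rho k (ssum D K)"
      using K(1) fin_subspace_ssum[OF tightD(1)[OF D(1)] finK] ssum_upper(2)[OF tightD(3)[OF D(1)] sK]
      unfolding selfsufficient_iff by blast
    then have "rho k (D \<inter> K) \<le> rho k D"
      using rho_submodular(1)[OF tightD(1)[OF D(1)] finK, of k] by linarith
    then have "tight H (D \<inter> K)"
      unfolding tight_iff[OF D(1)]
      using fin_subspace_Int[OF tightD(1)[OF D(1)] finK] tightD(2)[OF D(1)] K(2) by blast
    then have "D \<inter> K = D"
      using D(2) card_seteq[OF tightD(4)[OF D(1)], of "D \<inter> K"] by blast
    then show ?thesis by blast
  qed
  then have "CSS k H = D"
    unfolding CSS_def using tight_selfsufficient[OF D(1)] tightD(2)[OF D(1)] by blast
  then show ?thesis using D(1) by simp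
qed

text \<open>\<open>CSS\<close> of the span of \<open>a\<close> and \<open>H\<close> has least
  predimension among the finite subspaces containing \<open>a\<close> and \<open>H\<close>. It
  attains the minimum over \<open>H\<close> exactly when some tight subspace contains
  \<open>a\<close>.\<close>

lemma cl_eq_Union_tight:
  assumes H: "fin_subspace H"
  shows "cl k H = \<Union> {D. tight H D}"
proof -
  have spH: "M.span H = H" using H by (simp add: fin_subspace_def)
  have "in_cl k {a} H \<longleftrightarrow> (\<exists>D. tight H D \<and> a \<in> D)" for a
  proof -
    let ?A = "M.span ({a} \<union> H)"
    have A: "fin_subspace ?A" using H by (intro fin_subspace_span) (simp add: fin_subspace_def)
    have HA: "H \<subseteq> ?A" "a \<in> ?A" by (auto intro: M.span_base)
    note tA = CSS_tight[OF A] and tH = CSS_tight[OF H]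
    show ?thesis
      unfolding in_cl_def delta_eq_iff spH
    proof
      assume "rho k (CSS k H) = rho k (CSS k ?A)"
      then have "tight H (CSS k ?A)"
        unfolding tight_iff[OF tH] using tightD(1,2)[OF tA] HA(1) by auto
      then show "\<exists>D. tight H D \<and> a \<in> D" using tightD(2)[OF tA] HA(2) by blast
    next
      assume "\<exists>D. tight H D \<and> a \<in> D"
      then obtain D where D: "tight H D" "a \<in> D" by blast
      then have "?A \<subseteq> D" using tightD(2)[OF D(1)] by (intro M.span_minimal tightD(3)[OF D(1)]) auto
      then have "rho k (CSS k ?A) \<le> rho k D" by (rule tightD(5)[OF tA tightD(1)[OF D(1)]])
      moreover have "rho k D = rho k (CSS k H)" by (rule tight_rho[OF D(1) tH])
      moreover have "rho k (CSS k H) \<le> rho k (CSS k ?A)"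
        using tightD(1,2)[OF tA] HA(1) by (intro tightD(5)[OF tH]) auto
      ultimately show "rho k (CSS k H) = rho k (CSS k ?A)" by linarith
    qed
  qed
  then show ?thesis unfolding cl_def by blast
qed

text \<open>Two preimages of \<open>w\<close> differ by an element of \<open>N (ssum D L)\<close>,
  which splits along \<open>N D\<close> and \<open>N L\<close>. Correcting each preimage by its part
  yields a common preimage in \<open>\<Lambda> D \<inter> \<Lambda> L\<close>.\<close>

lemma beta_span_Int_tight:
  assumes D: "tight H D" and L: "tight H L" and w: "w \<in> beta_span D" "w \<in> beta_span L"
  shows "w \<in> beta_span (D \<inter> L)"
proof -
  note sD = tightD(3)[OF D] and sL = tightD(3)[OF L]
  obtain u v where u: "u \<in> \<Lambda> D" "w = f_beta u" and v: "v \<in> \<Lambda> L" "w = f_beta v"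
    using w unfolding beta_span_def by blast
  have "u \<in> \<Lambda> (ssum D L)" "v \<in> \<Lambda> (ssum D L)"
    using u(1) v(1) ext.ext_mono[OF ssum_upper(1)[OF sD sL]] ext.ext_mono[OF ssum_upper(2)[OF sD sL]]
    by auto
  then have "u - v \<in> N (ssum D L)"
    using u(2) v(2) by (simp add: N_eq f.diff free.subspace_diff[OF ext.subspace_ext])
  then obtain x y where xy: "u - v = x + y" "x \<in> N D" "y \<in> N L"
    unfolding tight_closed(3)[OF D L] by blast
  have x: "x \<in> \<Lambda> D" "f_beta x = 0" and y: "y \<in> \<Lambda> L" using xy by (auto simp: N_eq)
  have "u - x = v + y" using xy(1) by (simp add: algebra_simps)
  moreover have "u - x \<in> \<Lambda> D" "v + y \<in> \<Lambda> L"
    using u(1) x(1) v(1) y free.subspace_diff[OF ext.subspace_ext] free.subspace_add[OF ext.subspace_ext]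
    by blast+
  ultimately have "u - x \<in> \<Lambda> (D \<inter> L)" using ext.ext_Int[OF sD sL] by auto
  moreover have "f_beta (u - x) = w" using u(2) x(2) by (simp add: f.diff)
  ultimately show ?thesis unfolding beta_span_def by blast
qed

text \<open>A tight subspace of largest dimension absorbs every other one, since their sum is again
  tight.\<close>

lemma finite_Union_tight:
  assumes "\<And>D. tight H D \<Longrightarrow> M.dim D \<le> n"
  shows "finite (\<Union> {D. tight H D})"
proof (cases "\<exists>D. tight H D")
  case True
  then obtain D0 where "tight H D0" by blast
  moreover have "\<forall>E. tight H E \<longrightarrow> M.dim E < Suc n" using assms by (simp add: less_Suc_eq_le)
  ultimately have "\<exists>D. tight H D \<and> (\<forall>E. tight H E \<longrightarrow> M.dim E \<le> M.dim D)"
    by (rule ex_has_greatest_nat)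
  then obtain D where D: "tight H D" "\<And>E. tight H E \<Longrightarrow> M.dim E \<le> M.dim D" by blast
  have "E \<subseteq> D" if E: "tight H E" for E
  proof -
    note S = tight_closed(2)[OF D(1) E]
    have "D = ssum D E"
      using D(2)[OF S] ssum_upper(1)[OF tightD(3)[OF D(1)] tightD(3)[OF E]]
      by (intro Mf.subspace_eq_of_dim_le tightD(3,4)[OF S] tightD(3)[OF D(1)])
    then show ?thesis using ssum_upper(2)[OF tightD(3)[OF D(1)] tightD(3)[OF E]] by simp
  qed
  then have "\<Union> {D. tight H D} \<subseteq> D" by blast
  then show ?thesis using tightD(4)[OF D(1)] finite_subset by blast
qed auto

text \<open>If \<open>dim D = n\<close>, then \<open>beta_span D\<close> has about \<open>p\<^bsup>n\<^sup>2/2\<^esup>\<close> elements, whereas its elements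
  supported on subspaces of bounded dimension number at most \<open>p\<^bsup>O(n)\<^esup>\<close>.\<close>

lemma tight_dim_bound:
  assumes B: "\<And>w L. tight H L \<Longrightarrow> w \<in> beta_span L \<Longrightarrow>
      \<exists>L'. tight H L' \<and> M.dim L' \<le> B \<and> w \<in> beta_span L'"
    and D: "tight H D"
  shows "M.dim D \<le> 2 * (k + B + B * B) + 1"
proof -
  note finD = tightD(1)[OF D]
  let ?n = "M.dim D" and ?q = "CARD('p)"
  \<comment> \<open>An element of \<open>beta_span D\<close> is supported on some
    \<open>D \<inter> L\<close> of dimension at most \<open>B\<close>; it is coded by
    \<open>B\<close> generators in \<open>D\<close> and \<open>B * B\<close> coefficients.\<close>
  let ?T = "({..<B} \<rightarrow>\<^sub>E D) \<times> (({..<B} \<times> {..<B}) \<rightarrow>\<^sub>E (UNIV :: 'p mod_ring set))"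
  let ?F = "\<lambda>(g, c). \<Sum>(i, j)\<in>{..<B} \<times> {..<B}. scaleW (c (i, j)) (\<beta> (g i) (g j))"
  have "beta_span D \<subseteq> ?F ` ?T"
  proof
    fix w assume w: "w \<in> beta_span D"
    then obtain L where L: "tight H L" "M.dim L \<le> B" "w \<in> beta_span L" using B[OF D] by blast
    let ?I = "D \<inter> L"
    have I: "tight H ?I" by (rule tight_closed(1)[OF D L(1)])
    have "M.dim ?I \<le> B"
      using Mf.dim_mono_finite[OF tightD(3)[OF I] tightD(3,4)[OF L(1)]] L(2) by simp
    then obtain g where g: "?I = M.span (g ` {..<B})"
      using fin_subspace_tuple[OF tightD(1)[OF I]] by blast
    let ?g = "restrict g {..<B}"
    have "?I = M.span (?g ` {..<B})" unfolding g by simp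
    then obtain c where c: "c \<in> {..<B} \<times> {..<B} \<rightarrow>\<^sub>E UNIV" "w = ?F (?g, c)"
      using beta_span_Int_tight[OF D L(1) w L(3)] beta_span_tuple[of "{..<B}" ?g] by auto
    moreover have "g i \<in> D" if "i < B" for i
    proof -
      have "g i \<in> ?I" unfolding g using that by (auto intro: M.span_base)
      then show ?thesis by blast
    qed
    ultimately show "w \<in> ?F ` ?T" by (intro image_eqI[of _ _ "(?g, c)"]) auto
  qed
  moreover have finT: "finite ?T"
    using tightD(4)[OF D] by (intro finite_cartesian_product finite_PiE) auto
  ultimately have "card (beta_span D) \<le> card ?T"
    by (rule surj_card_le[rotated])
  also have "\<dots> = ?q ^ (?n * B + B * B)"
    using card_fin_subspace[OF finD]
    by (simp add: card_cartesian_product card_PiE power_add power_mult)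
  finally have W: "card (beta_span D) \<le> ?q ^ (?n * B + B * B)" .
  have "?q ^ (?n choose 2) = ?q ^ free.dim (N D) * card (beta_span D)"
    by (rule card_beta_span[OF finD])
  also have "\<dots> \<le> ?q ^ (k * ?n) * ?q ^ (?n * B + B * B)"
    using bounded finD one_less_p W unfolding relations_bounded_def
    by (intro mult_mono power_increasing) auto
  finally have "?n choose 2 \<le> k * ?n + (?n * B + B * B)"
    using one_less_p by (simp flip: power_add)
  \<comment> \<open>The summand \<open>1\<close> absorbs the rounding of the division by two in
    \<open>choose_two\<close>.\<close>
  then have le: "?n * (?n - 1) \<le> 2 * (k * ?n + (?n * B + B * B)) + 1"
    unfolding choose_two by presburger
  show ?thesis
  proof (rule ccontr)
    assume "\<not> ?thesis"
    then obtain m where m: "?n = Suc m" "2 * (k + B + B * B) + 1 \<le> m" by (cases ?n) auto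
    have "?n * (2 * (k + B + B * B) + 1) \<le> ?n * (?n - 1)"
      using m by (intro mult_le_mono) auto
    also note le
    finally have "?n * (2 * (k + B + B * B) + 1) \<le> 2 * (k * ?n + (?n * B + B * B)) + 1" .
    \<comment> \<open>The left side of the last inequality exceeds the right side by
      \<open>(2 * B * B + 1) * (?n - 1)\<close>, which is positive.\<close>
    moreover have "B * (B * 2) \<le> B * (B * (2 * ?n))" "1 < ?n" using m by auto
    ultimately show False by (simp add: algebra_simps)
  qed
qed

end

section \<open>Definability of bounded support\<close>

text \<open>Adding an index raises the cardinality by one unless its value has already
  occurred.\<close>

lemma definable_card_image:
  assumes "finite I" "\<And>i j. i \<in> I \<Longrightarrow> j \<in> I \<Longrightarrow> definable S (\<lambda>e d. F i e d = F j e d)"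
  shows "definable S (\<lambda>e d. card ((\<lambda>i. F i e d) ` I) = n)"
  using assms
proof (induction I arbitrary: n rule: finite_induct)
  case empty
  show ?case by (simp add: definable_const)
next
  case (insert i I)
  let ?old = "\<lambda>e d. \<exists>j\<in>I. F i e d = F j e d" and ?card = "\<lambda>n e d. card ((\<lambda>i. F i e d) ` I) = n"
  have "definable S ?old" using insert.prems insert.hyps(1) by (intro definable_bex) auto
  moreover have "definable S (?card m)" for m using insert.prems by (intro insert.IH) auto
  ultimately have "definable S (\<lambda>e d. (?old e d \<and> ?card n e d) \<or> (\<not> ?old e d \<and> n \<noteq> 0 \<and> ?card (n - 1) e d))"
    by (intro definable_disj definable_conj definable_not definable_const)
  moreover have "card ((\<lambda>i. F i e d) ` insert i I) = n \<longleftrightarrow>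
      (?old e d \<and> ?card n e d) \<or> (\<not> ?old e d \<and> n \<noteq> 0 \<and> ?card (n - 1) e d)" for e d
    using insert.hyps(1) by (auto simp: card_insert_if image_iff)
  ultimately show ?case by simp
qed

section \<open>Formulas about finite subspaces\<close>

context bilinear_Bp
begin

abbreviation "S \<equiv> bilinear_structure scaleM scaleW \<beta>"

lemma S_full: "Mdom S = UNIV" "Wdom S = UNIV"
  by (simp_all add: bilinear_structure_def)

text \<open>The variables below \<open>r\<close> are reserved for parameters; the \<open>n\<close>
  generators of a subspace follow from position \<open>r\<close> on.\<close>

definition lincomb :: "nat \<Rightarrow> nat \<Rightarrow> (nat \<Rightarrow> 'p mod_ring) \<Rightarrow> (nat \<Rightarrow> 'm) \<Rightarrow> 'm" where
  "lincomb r n c e = (\<Sum>i<n. scaleM (c i) (e (r + i)))"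

definition betacomb :: "nat \<Rightarrow> nat \<Rightarrow> (nat \<times> nat \<Rightarrow> 'p mod_ring) \<Rightarrow> (nat \<Rightarrow> 'm) \<Rightarrow> 'w" where
  "betacomb r n c e = (\<Sum>(i, j)\<in>{..<n} \<times> {..<n}. scaleW (c (i, j)) (\<beta> (e (r + i)) (e (r + j))))"

lemma lincomb_term: "\<exists>t. \<forall>e. mval S e t = lincomb r n c e"
proof (induction n)
  case 0
  show ?case by (rule exI[of _ MZero]) (simp add: lincomb_def bilinear_structure_def)
next
  case (Suc n)
  then obtain t where "\<forall>e. mval S e t = lincomb r n c e" by blast
  then show ?case
    by (intro exI[of _ "MAdd t (MScale (c n) (MVar (r + n)))"])
      (simp add: lincomb_def bilinear_structure_def)
qed

lemma betacomb_term: "\<exists>t. \<forall>e d. wval S e d t = betacomb r n c e"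
proof -
  have "\<exists>t. \<forall>e d. wval S e d t = (\<Sum>(i, j)\<in>I. scaleW (c (i, j)) (\<beta> (e (r + i)) (e (r + j))))"
    if "finite I" for I
    using that
  proof (induction I rule: finite_induct)
    case empty
    show ?case by (rule exI[of _ WZero]) (simp add: bilinear_structure_def)
  next
    case (insert x I)
    then obtain t where "\<forall>e d. wval S e d t = (\<Sum>(i, j)\<in>I. scaleW (c (i, j)) (\<beta> (e (r + i)) (e (r + j))))"
      by blast
    then show ?case using insert.hyps
      by (intro exI[of _ "WAdd (WScale (c x) (Beta (MVar (r + fst x)) (MVar (r + snd x)))) t"])
        (simp add: bilinear_structure_def case_prod_unfold)
  qed
  then show ?thesis unfolding betacomb_def by simp
qed

lemma definable_comb:
  "definable S (\<lambda>e d. e x = lincomb r n c e)"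
  "definable S (\<lambda>e d. lincomb r n c e = lincomb r n c' e)"
  "definable S (\<lambda>e d. d y = betacomb r n b e)"
  "definable S (\<lambda>e d. betacomb r n b e = betacomb r n b' e)"
proof -
  obtain t t' where t: "\<And>e. mval S e t = lincomb r n c e" "\<And>e. mval S e t' = lincomb r n c' e"
    using lincomb_term by meson
  obtain u u' where u: "\<And>e d. wval S e d u = betacomb r n b e" "\<And>e d. wval S e d u' = betacomb r n b' e"
    using betacomb_term by meson
  show "definable S (\<lambda>e d. e x = lincomb r n c e)"
    by (rule definableI[of _ "MEq (MVar x) t"]) (simp add: t)
  show "definable S (\<lambda>e d. lincomb r n c e = lincomb r n c' e)"
    by (rule definableI[of _ "MEq t t'"]) (simp add: t)
  show "definable S (\<lambda>e d. d y = betacomb r n b e)"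
    by (rule definableI[of _ "WEq (WVar y) u"]) (simp add: u)
  show "definable S (\<lambda>e d. betacomb r n b e = betacomb r n b' e)"
    by (rule definableI[of _ "WEq u u'"]) (simp add: u)
qed

text \<open>The bound \<open>n\<close> lets \<open>L\<close> be given by \<open>n\<close>
  generators. Membership in \<open>L\<close> and in \<open>beta_span L\<close> becomes a finite
  disjunction over coefficients, \<open>rho\<close> is controlled by cardinalities, and the
  generators are finally quantified away.\<close>

lemma definable_subspace:
  fixes r n :: nat
  shows "definable S (\<lambda>e d. \<exists>L. fin_subspace L \<and> M.dim L \<le> n \<and> rho k L \<le> v \<and> e ` {..<r} \<subseteq> L \<and> d 0 \<in> beta_span L)"
proof -
  define L where "L e = M.span ((\<lambda>i. e (r + i)) ` {..<n})" for e :: "nat \<Rightarrow> 'm"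
  define C :: "(nat \<Rightarrow> 'p mod_ring) set" where "C = {..<n} \<rightarrow>\<^sub>E UNIV"
  define C2 :: "(nat \<times> nat \<Rightarrow> 'p mod_ring) set" where "C2 = {..<n} \<times> {..<n} \<rightarrow>\<^sub>E UNIV"
  have fin: "finite C" "finite C2" unfolding C_def C2_def by (auto intro!: finite_PiE)
  have L: "L e = (\<lambda>c. lincomb r n c e) ` C" for e
    unfolding L_def C_def lincomb_def by (rule span_tuple) simp
  have L2: "beta_span (L e) = (\<lambda>c. betacomb r n c e) ` C2" for e
    unfolding L_def C2_def betacomb_def by (rule beta_span_tuple) simp
  have finL: "fin_subspace (L e)" for e unfolding L_def by (rule fin_subspace_span) simp
  \<comment> \<open>By \<open>rho_eqI\<close> the pair of cardinalities decides whether
    \<open>rho\<close> is at most \<open>v\<close>. The numbers of coefficient functions bound both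
    entries, so finitely many pairs remain.\<close>
  define R where "R = {x. (\<exists>K. fin_subspace K \<and> card K = fst x \<and> card (beta_span K) = snd x \<and> rho k K \<le> v)
    \<and> fst x \<le> card C \<and> snd x \<le> card C2}"
  have finR: "finite R"
    by (rule finite_subset[of _ "{..card C} \<times> {..card C2}"]) (auto simp: R_def)
  have le: "card (L e) \<le> card C" "card (beta_span (L e)) \<le> card C2" for e
    unfolding L2 unfolding L using fin by (simp_all add: card_image_le)
  have R: "rho k (L e) \<le> v \<longleftrightarrow> (\<exists>x\<in>R. card (L e) = fst x \<and> card (beta_span (L e)) = snd x)" for e
  proof
    assume "rho k (L e) \<le> v"
    then have "(card (L e), card (beta_span (L e))) \<in> R"
      unfolding R_def mem_Collect_eq fst_conv snd_conv using finL[of e] le[of e] by blast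
    then show "\<exists>x\<in>R. card (L e) = fst x \<and> card (beta_span (L e)) = snd x"
      by (rule bexI[rotated]) simp
  next
    assume "\<exists>x\<in>R. card (L e) = fst x \<and> card (beta_span (L e)) = snd x"
    then obtain x where x: "x \<in> R" "card (L e) = fst x" "card (beta_span (L e)) = snd x" by blast
    from x(1) obtain K where K: "fin_subspace K" "card K = fst x" "card (beta_span K) = snd x" "rho k K \<le> v"
      unfolding R_def by blast
    then show "rho k (L e) \<le> v" using rho_eqI[OF finL[of e] K(1), of k] x by simp
  qed
  define P where "P e d \<longleftrightarrow> rho k (L e) \<le> v \<and> e ` {..<r} \<subseteq> L e \<and> d 0 \<in> beta_span (L e)"
    for e and d :: "nat \<Rightarrow> 'w"
  have "definable S (\<lambda>e d. (\<exists>x\<in>R. card ((\<lambda>c. lincomb r n c e) ` C) = fst x \<and> card ((\<lambda>c. betacomb r n c e) ` C2) = snd x)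
      \<and> (\<forall>i\<in>{..<r}. \<exists>c\<in>C. e i = lincomb r n c e) \<and> (\<exists>c\<in>C2. d 0 = betacomb r n c e))"
    by (intro definable_conj definable_bex definable_ball definable_card_image definable_comb
        fin finR finite_lessThan)
  moreover have "P e d \<longleftrightarrow> (\<exists>x\<in>R. card ((\<lambda>c. lincomb r n c e) ` C) = fst x \<and> card ((\<lambda>c. betacomb r n c e) ` C2) = snd x)
      \<and> (\<forall>i\<in>{..<r}. \<exists>c\<in>C. e i = lincomb r n c e) \<and> (\<exists>c\<in>C2. d 0 = betacomb r n c e)" for e d
    unfolding P_def R L2 unfolding L image_subset_iff image_iff ..
  ultimately have "definable S P" by (simp only: definable_def)
  from definable_project[OF S_full this, of "{..<r}" "{0}"]
  have "definable S (\<lambda>e d. \<exists>e' d'. (\<forall>i\<in>{..<r}. e' i = e i) \<and> (\<forall>i\<in>{0}. d' i = d i) \<and> P e' d')" .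
  moreover have "(\<exists>e' d'. (\<forall>i\<in>{..<r}. e' i = e i) \<and> (\<forall>i\<in>{0}. d' i = d i) \<and> P e' d') \<longleftrightarrow>
    (\<exists>L. fin_subspace L \<and> M.dim L \<le> n \<and> rho k L \<le> v \<and> e ` {..<r} \<subseteq> L \<and> d 0 \<in> beta_span L)"
    (is "?lhs \<longleftrightarrow> ?rhs") for e :: "nat \<Rightarrow> 'm" and d :: "nat \<Rightarrow> 'w"
  proof
    assume ?lhs
    then obtain e' d' where e': "\<forall>i\<in>{..<r}. e' i = e i" "d' 0 = d 0" "P e' d'" by auto
    then have "e ` {..<r} = e' ` {..<r}" by (auto intro!: image_cong)
    moreover have "M.dim (L e') \<le> n" unfolding L_def by (rule dim_span_tuple)
    ultimately show ?rhs using e' finL[of e'] unfolding P_def by metis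
  next
    assume ?rhs
    then obtain K where K: "fin_subspace K" "M.dim K \<le> n" "rho k K \<le> v" "e ` {..<r} \<subseteq> K" "d 0 \<in> beta_span K"
      by blast
    from fin_subspace_tuple[OF K(1,2)] obtain g where g: "K = M.span (g ` {..<n})" by blast
    let ?e = "\<lambda>i. if i < r then e i else g (i - r)"
    have "L ?e = K" unfolding L_def g by simp
    moreover have "?e ` {..<r} = e ` {..<r}" by (rule image_cong) auto
    ultimately have "P ?e d" unfolding P_def using K by metis
    then show ?lhs by (intro exI[of _ ?e] exI[of _ d]) simp
  qed
  ultimately show ?thesis by (simp only: definable_def)
qed

end

section \<open>Finiteness and algebraicity of the closure\<close>

context bounded_bilinear_Bp
begin

lemma tight_subspaces_iff:
  assumes "fin_subspace H"
  shows "fin_subspace L \<and> rho k L \<le> rho k (CSS k H) \<and> H \<subseteq> L \<longleftrightarrow> tight H L"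
  using tight_iff[OF CSS_tight[OF assms]] by auto

text \<open>The stabilisation concerns formulas without parameters, so the elements of
  \<open>H\<close> become variables; an enumeration \<open>h\<close> of \<open>H\<close> is
  substituted afterwards.\<close>

lemma bounded_support:
  assumes cat: "aleph0_categorical S" and inf: "infinite (UNIV :: 'm set)" and H: "fin_subspace H"
  shows "\<exists>B. \<forall>w L. tight H L \<longrightarrow> w \<in> beta_span L \<longrightarrow>
    (\<exists>L'. tight H L' \<and> M.dim L' \<le> B \<and> w \<in> beta_span L')"
proof -
  obtain h :: "nat \<Rightarrow> 'm" and r where h: "H = h ` {..<r}"
    using H finite_imp_nat_seg_image_inj_on[of H] unfolding fin_subspace_def lessThan_def by metis
  let ?Q = "\<lambda>n e d. \<exists>L. fin_subspace L \<and> M.dim L \<le> n \<and> rho k L \<le> rho k (CSS k H) \<and>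
    e ` {..<r} \<subseteq> L \<and> d 0 \<in> beta_span L"
  have "\<forall>n. \<exists>\<phi>. \<forall>e d. sat S e d \<phi> \<longleftrightarrow> ?Q n e d"
    using definable_subspace unfolding definable_def by blast
  then obtain \<psi> where "\<forall>n e d. sat S e d (\<psi> n) \<longleftrightarrow> ?Q n e d" by (rule choice[THEN exE])
  then have \<psi>: "sat S e d (\<psi> n) \<longleftrightarrow> ?Q n e d" for n e d by simp
  have "\<exists>B. \<forall>n e d. sat S e d (\<psi> n) \<longrightarrow> sat S e d (\<psi> B)"
  proof (rule aleph0_categorical_chain_stabilises[OF S_full inf cat])
    \<comment> \<open>The bound \<open>Suc r\<close> ensures that the index \<open>0\<close> of the
      variable of sort \<open>W\<close> lies below it for every \<open>r\<close>.\<close>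
    show "depends_below (Suc r) S (\<psi> n)" for n
      unfolding depends_below_def
    proof (intro allI impI)
      fix e e' d d' assume eq: "\<forall>i<Suc r. e i = e' i \<and> d i = d' i" and "sat S e d (\<psi> n)"
      moreover have "e ` {..<r} = e' ` {..<r}" using eq by (intro image_cong) auto
      ultimately show "sat S e' d' (\<psi> n)" unfolding \<psi> by simp
    qed
    show "sat S e d (\<psi> m)" if "n \<le> m" "sat S e d (\<psi> n)" for n m e d
      using that unfolding \<psi> by (meson order_trans)
  qed
  then obtain B where B: "\<And>n e d. sat S e d (\<psi> n) \<Longrightarrow> sat S e d (\<psi> B)" by blast
  have iff: "sat S h (\<lambda>_. w) (\<psi> n) \<longleftrightarrow> (\<exists>L. tight H L \<and> M.dim L \<le> n \<and> w \<in> beta_span L)" for w n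
    unfolding \<psi> tight_subspaces_iff[OF H, symmetric] h[symmetric] by blast
  show ?thesis
  proof (intro exI[of _ B] allI impI)
    fix w L assume "tight H L" "w \<in> beta_span L"
    then have "sat S h (\<lambda>_. w) (\<psi> (M.dim L))" unfolding iff by blast
    then have "sat S h (\<lambda>_. w) (\<psi> B)" by (rule B)
    then show "\<exists>L'. tight H L' \<and> M.dim L' \<le> B \<and> w \<in> beta_span L'" unfolding iff .
  qed
qed

text \<open>The case of finite \<open>M\<close> is immediate; infinite \<open>M\<close> makes the
  models compared by categoricity infinite.\<close>

lemma finite_cl:
  assumes cat: "aleph0_categorical S" and H: "fin_subspace H"
  shows "finite (cl k H)"
proof (cases "finite (UNIV :: 'm set)")
  case False
  then obtain B where "\<And>w L. tight H L \<Longrightarrow> w \<in> beta_span L \<Longrightarrow>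
      \<exists>L'. tight H L' \<and> M.dim L' \<le> B \<and> w \<in> beta_span L'"
    using bounded_support[OF cat _ H] by blast
  then show ?thesis
    unfolding cl_eq_Union_tight[OF H] by (intro finite_Union_tight, rule tight_dim_bound)
qed (auto intro: finite_subset)

text \<open>With \<open>H\<close> as the values of the variables below \<open>r\<close>, the formula
  says of variable \<open>r\<close> that it lies with \<open>H\<close> in a subspace of dimension at
  most \<open>dim D\<close> and least predimension. All solutions belong to the finite set
  \<open>cl k H\<close>.\<close>

lemma cl_subset_acl:
  assumes fin: "finite (cl k H)" and H: "fin_subspace H"
  shows "Inl ` cl k H \<subseteq> acl S (Inl ` H)"
proof clarify
  fix a assume "a \<in> cl k H"
  then obtain D where D: "tight H D" "a \<in> D" unfolding cl_eq_Union_tight[OF H] by blast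
  obtain h :: "nat \<Rightarrow> 'm" and r where h: "H = h ` {..<r}"
    using H finite_imp_nat_seg_image_inj_on[of H] unfolding fin_subspace_def lessThan_def by metis
  let ?n = "M.dim D"
  let ?Q = "\<lambda>e. \<exists>L. fin_subspace L \<and> M.dim L \<le> ?n \<and> rho k L \<le> rho k (CSS k H) \<and> e ` {..<Suc r} \<subseteq> L"
  obtain \<phi> where \<phi>: "\<And>e d. sat S e d \<phi> \<longleftrightarrow>
      (\<exists>L. fin_subspace L \<and> M.dim L \<le> ?n \<and> rho k L \<le> rho k (CSS k H) \<and> e ` {..<Suc r} \<subseteq> L \<and> d 0 \<in> beta_span L)"
    using definable_subspace[of ?n k "rho k (CSS k H)" "Suc r"] unfolding definable_def by blast
  \<comment> \<open>The formula \<open>\<phi>\<close> also speaks of \<open>d 0\<close>, but no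
    parameters of sort \<open>W\<close> are available. This variable is quantified away, with
    \<open>0\<close> as a witness that lies in every \<open>beta_span L\<close>.\<close>
  obtain \<phi>' where vars: "fmvars \<phi>' \<subseteq> {..<Suc r}" "fwvars \<phi>' \<subseteq> {}"
    and \<phi>': "\<And>e d. sat S e d \<phi>' \<longleftrightarrow> (\<exists>e' d'. (\<forall>i\<in>{..<Suc r}. e' i = e i) \<and> (\<forall>i\<in>{}. d' i = d i) \<and> sat S e' d' \<phi>)"
    by (rule formula_project[OF S_full, of "{..<Suc r}" "{}" \<phi>]) (rule that)
  have zero: "0 \<in> beta_span L" for L unfolding beta_span_eq by (rule W.span_zero)
  have Q: "sat S e d \<phi>' \<longleftrightarrow> ?Q e" for e d
  proof
    assume "sat S e d \<phi>'"
    then obtain e' d' where e': "\<forall>i\<in>{..<Suc r}. e' i = e i" "sat S e' d' \<phi>" unfolding \<phi>' by blast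
    then have "e' ` {..<Suc r} = e ` {..<Suc r}" by (intro image_cong) auto
    then show "?Q e" using e'(2) unfolding \<phi> by metis
  next
    assume "?Q e"
    then have "sat S e (\<lambda>_. 0) \<phi>" unfolding \<phi> using zero by blast
    then show "sat S e d \<phi>'" unfolding \<phi>' by (intro exI[of _ e] exI[of _ "\<lambda>_. 0"]) simp
  qed
  have img: "h(r := b) ` {..<Suc r} = insert b H" for b
    unfolding h by (auto simp: lessThan_Suc)
  have iff: "sat S (h(r := b)) d \<phi>' \<longleftrightarrow> (\<exists>L. tight H L \<and> M.dim L \<le> ?n \<and> b \<in> L)" for b d
    unfolding Q img insert_subset tight_subspaces_iff[OF H, symmetric] by blast
  have "{b \<in> Mdom S. sat S (h(r := b)) d \<phi>'} \<subseteq> cl k H" for d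
    unfolding iff cl_eq_Union_tight[OF H] by blast
  then have "finite {b \<in> Mdom S. sat S (h(r := b)) d \<phi>'}" for d
    using fin finite_subset by blast
  moreover have "sat S (h(r := a)) d \<phi>'" for d
    unfolding iff using D by blast
  moreover have "\<forall>j\<in>fmvars \<phi>' - {r}. Inl (h j) \<in> Inl ` H"
    using vars(1) unfolding h by (auto simp: less_Suc_eq subset_iff)
  ultimately show "Inl a \<in> acl S (Inl ` H)"
    using vars(2) unfolding acl_def S_full by blast
qed

end

theorem corollary6p2:
  fixes scaleM :: "'p::prime_card mod_ring \<Rightarrow> 'm::ab_group_add \<Rightarrow> 'm"
    and scaleW :: "'p mod_ring \<Rightarrow> 'w::ab_group_add \<Rightarrow> 'w"
    and \<beta> :: "'m \<Rightarrow> 'm \<Rightarrow> 'w"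
    and k :: nat
    and H :: "'m set"
  assumes "bilinear_Bp scaleM scaleW \<beta>"
    and "aleph0_categorical (bilinear_structure scaleM scaleW \<beta>)"
    and "bilinear_Bp.few_relations scaleM scaleW \<beta>"
    and "k \<ge> 1"
    and "\<forall>H0. finite H0 \<and> module.subspace scaleM H0 \<longrightarrow>
           vector_space.dim free_scale (bilinear_Bp.N scaleM scaleW \<beta> H0)
             \<le> k * vector_space.dim scaleM H0"
    and "finite H" and "module.subspace scaleM H"
  shows "finite (bilinear_Bp.cl scaleM scaleW \<beta> k H)
       \<and> Inl ` bilinear_Bp.cl scaleM scaleW \<beta> k H
           \<subseteq> acl (bilinear_structure scaleM scaleW \<beta>) (Inl ` H)"
proof -
  interpret bilinear_Bp scaleM scaleW \<beta> by fact
  interpret bounded_bilinear_Bp scaleM scaleW \<beta> k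
    by unfold_locales (use assms(4,5) in \<open>auto simp: relations_bounded_def fin_subspace_def\<close>)
  have H: "fin_subspace H" using assms(6,7) by (simp add: fin_subspace_def)
  show ?thesis
    using finite_cl[OF assms(2) H] cl_subset_acl[OF finite_cl[OF assms(2) H] H] by simp
qed

end
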